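(* The following two equalities hold: $$\text{(i)}\quad \sum_{k=1}^{\infty}\frac{4^k H_{2k}^{(2)}}{k^2\binom{2k}{k}} = -8G^2+11\zeta(4)+2\operatorname{Li}_4\!\left(\tfrac12\right)+\ln^2(2)\,\zeta(2)+\tfrac{1}{12}\ln^4(2);$$ $$\text{(ii)}\quad \sum_{k=1}^{\infty}\frac{4^k H_{2k}^2}{k^2\binom{2k}{k}} = 8G^2+\tfrac{103}{2}\zeta(4)-22\operatorname{Li}_4\!\left(\tfrac12\right)+7\ln^2(2)\,\zeta(2)-\tfrac{11}{12}\ln^4(2).$$
   Context: For positive integers $k,m$, $H_k^{(m)}=\sum_{n=1}^k n^{-m}$ is the generalized harmonic number and $H_k=H_k^{(1)}$. $\binom{2k}{k}$ is the central binomial coefficient, $\zeta$ is the Riemann zeta function, $\operatorname{Li}_4(z)=\sum_{k\ge1} z^k/k^4$ is the polylogarithm of order $4$, and $G=\sum_{k\ge1}(-1)^{k+1}/(2k-1)^2$ is Catalan's constant. *)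

theory Defs
  imports "HOL-Analysis.Analysis"
begin

definition gen_harm :: "nat \<Rightarrow> nat \<Rightarrow> real" where
  "gen_harm m k = (\<Sum>n=1..k. 1 / (real n) ^ m)"

definition zeta_nat :: "nat \<Rightarrow> real" where
  "zeta_nat s = (\<Sum>n. 1 / (real (Suc n)) ^ s)"

definition Li4 :: "real \<Rightarrow> real" where
  "Li4 z = (\<Sum>k. z ^ (Suc k) / (real (Suc k)) ^ 4)"

definition catalan :: real where
  "catalan = (\<Sum>k. (-1) ^ k / (2 * real k + 1) ^ 2)"

end

theory Submission
  imports Defs "HOL-Real_Asymp.Real_Asymp"
begin

text \<open>
  Write \<open>a k = 4 ^ k / (k\<^sup>2 * (2 k choose k))\<close>. Since \<open>\<Sum> a k * sin t ^ (2 k) = 2 t\<^sup>2\<close>, a sum of \<open>a k\<close> against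
  moments \<open>\<integral> w d(sin t ^ (2 k))\<close> is the integral of \<open>4 t * w t\<close> over \<open>(0, pi/2)\<close>.

  The harmonic numbers of order 2 split as \<open>H\<^sub>2 (2 k) = O\<^sub>2 k + H\<^sub>2 k / 4\<close>, with \<open>O\<^sub>2\<close> running over odd denominators.
  The first part leads to \<open>\<integral> (pi/2 - t)\<^sup>2 * ln (cos t) / sin t\<close>, where \<open>G\<^sup>2\<close> comes from \<open>\<integral> Ti\<^sub>2 dTi\<^sub>2\<close> with
  \<open>Ti\<^sub>2\<close> the inverse tangent integral; the second one telescopes up to \<open>\<Sum> a k / k\<^sup>2 = 8 \<integral> t * ln\<^sup>2 (sin t)\<close>.
  The combination \<open>H\<^sup>2 + H\<^sub>2\<close> corresponds to \<open>w = ln\<^sup>2 (1 - sin t)\<close>.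

  Both logarithmic integrals are evaluated through the boundary values of \<open>Ln\<^sup>2 (1 - z)\<close> on the unit circle, which
  reduces them to Euler sums \<open>\<Sum> (\<plusminus>1)\<^sup>n H n / n\<^sup>3\<close> and their analogues with odd denominators. The alternating sum is
  where \<open>Li4 (1/2)\<close> enters, by the Landen substitution \<open>s = x / (1 + x)\<close>.
\<close>

subsection \<open>Termwise integration and Abel summation\<close>

text \<open>Only \<open>H\<^sup>2 + H\<^sub>2\<close> arises as a moment of one weight, so (ii) is
  reached by subtracting (i); this is why \<open>G\<^sup>2\<close> enters the two sums with opposite
  signs. The obstacle is convergence on the unit circle: the coefficients of
  \<open>Ln\<^sup>2 (1 - z)\<close> are of size \<open>ln n / n\<close>, so the boundary series does
  not converge absolutely. Paired with a test function it does, because the Fourier coefficients of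
  that function add further decay. Hence every Fourier evaluation is an integral identity obtained
  from one Abel summation lemma, with the square of a logarithm as majorant. Splitting by parity and
  evaluating one integral twice reduce the four Euler sums to \<open>hsum\<close> and
  \<open>ahsum\<close>. To pass from \<open>ln (2 * sin (t / 2))\<close> to
  \<open>ln (sin (t / 2))\<close> or to half of \<open>ln (1 - cos t)\<close>, the constants
  \<open>ln 2\<close> and \<open>ln 2 / 2\<close> are subtracted. This creates multiples of
  \<open>ln 2 * zeta(3)\<close>, which cancel in both results against the same term inside
  \<open>ahsum\<close>.\<close>

lemma has_integral_FTC_limits:
  fixes F f :: "real \<Rightarrow> real"
  assumes "a < b"
    and deriv: "\<And>x. a < x \<Longrightarrow> x < b \<Longrightarrow> (F has_real_derivative f x) (at x)"
    and A: "(F \<longlongrightarrow> A) (at_right a)" and B: "(F \<longlongrightarrow> B) (at_left b)"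
  shows "(f has_integral (B - A)) {a<..<b}"
proof -
  \<comment> \<open>The one-sided limits extend \<open>F\<close> continuously to the closed
    interval, so the values of \<open>F\<close> at the endpoints, often involving
    \<open>ln 0\<close>, do not matter.\<close>
  define G where "G x = (if x = a then A else if x = b then B else F x)" for x
  have ev_nhds: "eventually (\<lambda>x. G x = F x) (nhds x)" if "a < x" "x < b" for x
    using eventually_nhds_in_open[of "{a<..<b}" x] that
    by (auto simp: G_def elim!: eventually_mono)
  have derivG: "(G has_real_derivative f x) (at x)" if "a < x" "x < b" for x
    using deriv[OF that] ev_nhds[OF that] DERIV_cong_ev by blast
  have "continuous_on {a..b} G"
  proof (rule continuous_on_IccI)
    have "eventually (\<lambda>x. F x = G x) (at_right a)"
      using eventually_at_right_real[OF \<open>a < b\<close>] by eventually_elim (auto simp: G_def)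
    then show "(G \<longlongrightarrow> G a) (at_right a)"
      using A by (auto simp: G_def[of a] intro: Lim_transform_eventually)
    have "eventually (\<lambda>x. F x = G x) (at_left b)"
      using eventually_at_left_real[OF \<open>a < b\<close>] by eventually_elim (auto simp: G_def)
    then show "(G \<longlongrightarrow> G b) (at_left b)"
      using B \<open>a < b\<close> by (auto simp: G_def[of b] intro: Lim_transform_eventually)
    show "G \<midarrow>x\<rightarrow> G x" if "a < x" "x < b" for x
      using DERIV_isCont[OF derivG[OF that]] by (simp add: isCont_def)
  qed (fact \<open>a < b\<close>)
  then have "(f has_integral (G b - G a)) {a..b}"
    using derivG \<open>a < b\<close>
    by (intro fundamental_theorem_of_calculus_interior)
       (auto simp: has_real_derivative_iff_has_vector_derivative)
  then show ?thesis
    using \<open>a < b\<close> by (simp add: has_integral_Icc_iff_Ioo G_def)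
qed

lemma has_integral_FTC_continuous:
  fixes F f :: "real \<Rightarrow> real"
  assumes "a < b"
    and "\<And>x. a < x \<Longrightarrow> x < b \<Longrightarrow> (F has_real_derivative f x) (at x)"
    and "continuous_on {a..b} F"
  shows "(f has_integral (F b - F a)) {a<..<b}"
  using assms continuous_on_Icc_at_rightD continuous_on_Icc_at_leftD
  by (intro has_integral_FTC_limits) blast+

lemma has_integral_sums_nonneg:
  fixes f :: "nat \<Rightarrow> real \<Rightarrow> real"
  assumes f: "\<And>n. (f n has_integral c n) S"
    and nonneg: "\<And>n x. x \<in> S \<Longrightarrow> 0 \<le> f n x"
    and F: "\<And>x. x \<in> S \<Longrightarrow> (\<lambda>n. f n x) sums F x"
    and "c sums C"
  shows "(F has_integral C) S"
proof (rule has_integral_monotone_convergence_increasing)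
  show "((\<lambda>x. \<Sum>n<k. f n x) has_integral (\<Sum>n<k. c n)) S" for k
    by (intro has_integral_sum f) auto
  show "(\<lambda>k. \<Sum>n<k. f n x) \<longlonglongrightarrow> F x" if "x \<in> S" for x
    using F[OF that] by (simp add: sums_def)
  show "(\<lambda>k. \<Sum>n<k. c n) \<longlonglongrightarrow> C"
    using \<open>c sums C\<close> by (simp add: sums_def)
qed (use nonneg in auto)

text \<open>Here the integral is given and convergence of the series of integrals is a conclusion:
  the partial sums are bounded by \<open>I\<close>. The slowly convergent series over
  \<open>cb\<close> thus need no convergence estimate of their own.\<close>

lemma sums_integral_nonneg:
  fixes f :: "nat \<Rightarrow> real \<Rightarrow> real"
  assumes f: "\<And>n. (f n has_integral c n) S"
    and nonneg: "\<And>n x. x \<in> S \<Longrightarrow> 0 \<le> f n x"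
    and F: "\<And>x. x \<in> S \<Longrightarrow> (\<lambda>n. f n x) sums F x"
    and I: "(F has_integral I) S"
  shows "c sums I"
proof -
  have c_nonneg: "0 \<le> c n" for n
    using has_integral_nonneg[OF f] nonneg by blast
  have "(\<Sum>n<k. c n) \<le> I" for k
  proof (rule has_integral_le)
    show "((\<lambda>x. \<Sum>n<k. f n x) has_integral (\<Sum>n<k. c n)) S"
      by (intro has_integral_sum f) auto
    show "(\<Sum>n<k. f n x) \<le> F x" if "x \<in> S" for x
      using sum_le_suminf[of "\<lambda>n. f n x" "{..<k}"] F[OF that] nonneg[OF that]
      by (auto simp: sums_iff)
  qed (fact I)
  then have "summable c"
    using c_nonneg by (intro summableI_nonneg_bounded[of c I])
  then have "(F has_integral (suminf c)) S"
    using has_integral_sums_nonneg[OF f nonneg F] summable_sums by blast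
  then show ?thesis
    using has_integral_unique[OF _ I] summable_sums[OF \<open>summable c\<close>] by simp
qed

text \<open>Monotone convergence applies to the nonnegative series of \<open>f n + g n\<close> and
  of \<open>g n\<close>; the claim is their difference.\<close>

lemma has_integral_sums_dominated:
  fixes f :: "nat \<Rightarrow> real \<Rightarrow> real"
  assumes f: "\<And>n. (f n has_integral c n) S"
    and g: "\<And>n. (g n has_integral d n) S"
    and le: "\<And>n x. x \<in> S \<Longrightarrow> \<bar>f n x\<bar> \<le> g n x"
    and gs: "\<And>x. x \<in> S \<Longrightarrow> summable (\<lambda>n. g n x)"
    and F: "\<And>x. x \<in> S \<Longrightarrow> (\<lambda>n. f n x) sums F x"
    and d: "summable d"
  shows "summable (\<lambda>n. \<bar>c n\<bar>)" "(F has_integral (\<Sum>n. c n)) S"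
proof -
  have "\<bar>c n\<bar> \<le> d n" for n
  proof -
    have "c n \<le> d n"
      using f g by (rule has_integral_le) (use le in \<open>fastforce simp: abs_le_iff\<close>)
    moreover have "- c n \<le> d n"
      using has_integral_neg[OF f] g by (rule has_integral_le) (use le in \<open>fastforce simp: abs_le_iff\<close>)
    ultimately show ?thesis by simp
  qed
  then show *: "summable (\<lambda>n. \<bar>c n\<bar>)"
    by (intro summable_comparison_test'[OF d, of 0]) auto
  then have c: "summable c" by (rule summable_rabs_cancel)
  have 1: "((\<lambda>x. F x + (\<Sum>n. g n x)) has_integral (\<Sum>n. c n + d n)) S"
  proof (rule has_integral_sums_nonneg)
    show "((\<lambda>x. f n x + g n x) has_integral (c n + d n)) S" for n
      by (intro has_integral_add f g)
    show "0 \<le> f n x + g n x" if "x \<in> S" for n x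
      using le[OF that, of n] by linarith
    show "(\<lambda>n. f n x + g n x) sums (F x + (\<Sum>n. g n x))" if "x \<in> S" for x
      by (intro sums_add F gs that summable_sums)
    show "(\<lambda>n. c n + d n) sums (\<Sum>n. c n + d n)"
      by (intro summable_sums summable_add c d)
  qed
  have 2: "((\<lambda>x. \<Sum>n. g n x) has_integral (\<Sum>n. d n)) S"
  proof (rule has_integral_sums_nonneg[OF g])
    show "0 \<le> g n x" if "x \<in> S" for n x
      using le[OF that, of n] by linarith
  qed (use gs d in \<open>auto intro: summable_sums\<close>)
  show "(F has_integral (\<Sum>n. c n)) S"
    using has_integral_diff[OF 1 2] by (simp add: suminf_add[OF c d, symmetric])
qed

text \<open>Abel summation of a boundary Fourier series: the identity holds on circles of radius
  \<open>r < 1\<close> by uniform convergence, and dominated convergence lets \<open>r\<close> tend to 1.\<close>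

lemma has_integral_boundary_power_series:
  fixes c \<gamma> :: "nat \<Rightarrow> real" and p :: "nat \<Rightarrow> nat" and f :: "complex \<Rightarrow> complex"
    and T :: "complex \<Rightarrow> real" and g D :: "real \<Rightarrow> real"
  assumes T: "bounded_linear T" and "0 < \<alpha>"
    and f: "\<And>z. norm z < 1 \<Longrightarrow> (\<lambda>n. of_real (c n) * z ^ p n) sums f z"
    and c: "\<And>n. \<bar>c n\<bar> \<le> B" and p: "\<And>n. n \<le> p n"
    and cont: "\<And>t. 0 < t \<Longrightarrow> t < \<alpha> \<Longrightarrow> isCont f (cis t)"
    and bound: "\<And>t r. 0 < t \<Longrightarrow> t < \<alpha> \<Longrightarrow> 0 < r \<Longrightarrow> r < 1 \<Longrightarrow> norm (f (of_real r * cis t)) \<le> D t"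
    and D: "D integrable_on {0<..<\<alpha>}"
    and g: "continuous_on {0..\<alpha>} g"
    and \<gamma>: "\<And>n. ((\<lambda>t. g t * T (cis (real (p n) * t))) has_integral \<gamma> n) {0<..<\<alpha>}"
    and sum: "summable (\<lambda>n. \<bar>c n * \<gamma> n\<bar>)"
  shows "((\<lambda>t. g t * T (f (cis t))) has_integral (\<Sum>n. c n * \<gamma> n)) {0<..<\<alpha>}"
proof -
  interpret T: bounded_linear T by fact
  obtain K where K: "K > 0" "\<And>z. \<bar>T z\<bar> \<le> norm z * K"
    using T.pos_bounded by auto
  have "compact (g ` {0..\<alpha>})"
    using g by (intro compact_continuous_image) auto
  then obtain G where G: "G > 0" "\<And>t. 0 < t \<Longrightarrow> t < \<alpha> \<Longrightarrow> \<bar>g t\<bar> \<le> G"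
  proof -
    obtain G where "G > 0" "\<forall>y\<in>g ` {0..\<alpha>}. norm y \<le> G"
      using \<open>compact (g ` {0..\<alpha>})\<close>[THEN compact_imp_bounded] unfolding bounded_pos by auto
    then show ?thesis by (intro that[of G]) auto
  qed
  have abs: "summable (\<lambda>n. \<bar>c n\<bar> * r ^ p n)" if r: "0 < r" "r < 1" for r
  proof (rule summable_comparison_test')
    show "summable (\<lambda>n. B * r ^ n)"
      using r by (intro summable_mult summable_geometric) auto
    have "r ^ p n \<le> r ^ n" for n
      using r p by (intro power_decreasing) auto
    then show "norm (\<bar>c n\<bar> * r ^ p n) \<le> B * r ^ n" for n
      using r c[of n] order_trans[OF abs_ge_zero c[of n]] by (auto simp: abs_mult intro!: mult_mono)
  qed
  define S where "S = {0<..<\<alpha>}"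
  have circle: "((\<lambda>t. g t * T (f (of_real r * cis t))) has_integral (\<Sum>n. c n * \<gamma> n * r ^ p n)) S"
    if r: "0 < r" "r < 1" for r
  proof (rule has_integral_sums_dominated(2))
    show "((\<lambda>t. (c n * r ^ p n) * (g t * T (cis (real (p n) * t)))) has_integral c n * \<gamma> n * r ^ p n) S" for n
      using has_integral_mult_right[OF \<gamma>[of n], of "c n * r ^ p n"] by (simp add: S_def mult_ac)
    show "((\<lambda>t. \<bar>c n\<bar> * r ^ p n * (G * K)) has_integral (\<bar>c n\<bar> * r ^ p n * (G * K)) * \<alpha>) S" for n
      using has_integral_const_real[of "\<bar>c n\<bar> * r ^ p n * (G * K)" 0 \<alpha>] \<open>0 < \<alpha>\<close>
      by (simp add: S_def has_integral_Icc_iff_Ioo mult_ac)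
    show "\<bar>(c n * r ^ p n) * (g t * T (cis (real (p n) * t)))\<bar> \<le> \<bar>c n\<bar> * r ^ p n * (G * K)"
      if "t \<in> S" for n t
    proof -
      have "\<bar>T (cis (real (p n) * t))\<bar> \<le> K"
        using K(2)[of "cis (real (p n) * t)"] by simp
      then have "\<bar>g t\<bar> * \<bar>T (cis (real (p n) * t))\<bar> \<le> G * K"
        using G that by (intro mult_mono) (auto simp: S_def)
      then have "\<bar>c n\<bar> * r ^ p n * (\<bar>g t\<bar> * \<bar>T (cis (real (p n) * t))\<bar>) \<le> \<bar>c n\<bar> * r ^ p n * (G * K)"
        using r by (intro mult_left_mono) auto
      then show ?thesis using r by (simp add: abs_mult)
    qed
    show "summable (\<lambda>n. \<bar>c n\<bar> * r ^ p n * (G * K))"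
      by (intro summable_mult2 abs r)
    show "summable (\<lambda>n. \<bar>c n\<bar> * r ^ p n * (G * K) * \<alpha>)"
      by (intro summable_mult2 abs r)
    show "(\<lambda>n. (c n * r ^ p n) * (g t * T (cis (real (p n) * t)))) sums (g t * T (f (of_real r * cis t)))" for t
    proof -
      have "(\<lambda>n. of_real (c n) * (of_real r * cis t) ^ p n) sums f (of_real r * cis t)"
        using r by (intro f) (auto simp: norm_mult)
      then have "(\<lambda>n. T (of_real (c n) * (of_real r * cis t) ^ p n)) sums T (f (of_real r * cis t))"
        by (rule T.sums)
      moreover have "T (of_real (c n) * (of_real r * cis t) ^ p n) = (c n * r ^ p n) * T (cis (real (p n) * t))" for n
      proof -
        have "of_real (c n) * (of_real r * cis t) ^ p n = (c n * r ^ p n) *\<^sub>R cis (real (p n) * t)"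
          by (simp add: power_mult_distrib Complex.DeMoivre scaleR_conv_of_real mult.assoc)
        then show ?thesis by (simp add: T.scaleR)
      qed
      ultimately have "(\<lambda>n. (c n * r ^ p n) * T (cis (real (p n) * t))) sums T (f (of_real r * cis t))"
        by simp
      from sums_mult[OF this, of "g t"] show ?thesis by (simp add: mult_ac)
    qed
  qed
  define r :: "nat \<Rightarrow> real" where "r k = 1 - 1 / (real k + 2)" for k
  have r: "0 < r k" "r k < 1" for k
    by (auto simp: r_def)
  have r_lim: "r \<longlonglongrightarrow> 1"
    unfolding r_def by real_asymp
  have dom: "(\<lambda>t. G * K * D t) integrable_on S"
    using integrable_on_mult_right[OF D, of "G * K"] by (simp add: S_def)
  have le: "norm (g t * T (f (of_real (r k) * cis t))) \<le> G * K * D t" if "t \<in> S" for k t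
  proof -
    have "\<bar>T (f (of_real (r k) * cis t))\<bar> \<le> norm (f (of_real (r k) * cis t)) * K"
      by (rule K)
    also have "\<dots> \<le> D t * K"
      using bound[of t "r k"] that r K by (intro mult_right_mono) (auto simp: S_def)
    finally have "\<bar>g t\<bar> * \<bar>T (f (of_real (r k) * cis t))\<bar> \<le> G * (D t * K)"
      using G that by (intro mult_mono) (auto simp: S_def)
    then show ?thesis by (simp add: abs_mult mult_ac)
  qed
  have lim: "(\<lambda>k. g t * T (f (of_real (r k) * cis t))) \<longlonglongrightarrow> g t * T (f (cis t))" if "t \<in> S" for t
  proof -
    have "(\<lambda>k. of_real (r k) * cis t) \<longlonglongrightarrow> of_real 1 * cis t"
      by (intro tendsto_intros r_lim)
    then have "(\<lambda>k. f (of_real (r k) * cis t)) \<longlonglongrightarrow> f (cis t)"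
      using cont[of t] that by (intro isCont_tendsto_compose[of "cis t" f]) (auto simp: S_def)
    then show ?thesis by (intro tendsto_intros T.tendsto)
  qed
  note integrable = circle[OF r, THEN has_integral_integrable]
  note dc = dominated_convergence[OF integrable dom le lim]
  \<comment> \<open>The series side passes to the limit by Tannery's theorem with majorant
    \<open>\<bar>c n * \<gamma> n\<bar>\<close>; this is where the assumed absolute convergence
    enters.\<close>
  have "(\<lambda>k. \<Sum>n. c n * \<gamma> n * r k ^ p n) \<longlonglongrightarrow> (\<Sum>n. c n * \<gamma> n)"
  proof (rule tannerys_theorem[THEN conjunct2, THEN conjunct2])
    show "(\<lambda>k. c n * \<gamma> n * r k ^ p n) \<longlonglongrightarrow> c n * \<gamma> n" for n
      using tendsto_mult[OF tendsto_const tendsto_power[OF r_lim, of "p n"], of "c n * \<gamma> n"] by simp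
    show "\<forall>\<^sub>F (n, k) in sequentially \<times>\<^sub>F sequentially. norm (c n * \<gamma> n * r k ^ p n) \<le> \<bar>c n * \<gamma> n\<bar>"
    proof (intro always_eventually allI)
      show "case x of (n, k) \<Rightarrow> norm (c n * \<gamma> n * r k ^ p n) \<le> \<bar>c n * \<gamma> n\<bar>" for x
        using r[of "snd x"] by (auto simp: abs_mult power_abs split_beta intro!: mult_left_le power_le_one)
    qed
  qed (use sum in auto)
  moreover have "(\<lambda>k. \<Sum>n. c n * \<gamma> n * r k ^ p n) \<longlonglongrightarrow> integral S (\<lambda>t. g t * T (f (cis t)))"
    using dc(2) by (simp add: integral_unique[OF circle[OF r]])
  ultimately have "integral S (\<lambda>t. g t * T (f (cis t))) = (\<Sum>n. c n * \<gamma> n)"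
    using LIMSEQ_unique by blast
  then show ?thesis
    using integrable_integral[OF dc(1)] by (simp add: S_def)
qed

subsection \<open>The series of the squared arcsine\<close>

lemma tendsto_power_times_ln_cubic:
  "((\<lambda>x::real. x ^ Suc n * (a * (\<mu> + ln x) ^ 3 + b * (\<mu> + ln x) ^ 2 + c * (\<mu> + ln x) + d)) \<longlongrightarrow> 0) (at_right 0)"
proof -
  have "((\<lambda>x::real. x * (a * (\<mu> + ln x) ^ 3 + b * (\<mu> + ln x) ^ 2 + c * (\<mu> + ln x) + d)) \<longlongrightarrow> 0) (at_right 0)"
    by real_asymp
  moreover have "((\<lambda>x::real. x ^ n) \<longlongrightarrow> 0 ^ n) (at_right 0)"
    by (intro tendsto_intros)
  ultimately have "((\<lambda>x::real. x ^ n * (x * (a * (\<mu> + ln x) ^ 3 + b * (\<mu> + ln x) ^ 2 + c * (\<mu> + ln x) + d))) \<longlongrightarrow> 0 ^ n * 0) (at_right 0)"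
    by (rule tendsto_mult[rotated])
  then show ?thesis by (simp add: mult_ac)
qed

text \<open>Differentiating \<open>x ^ Suc n\<close> times a cubic in \<open>\<mu> + ln x\<close>
  gives \<open>x ^ n\<close> times a cubic whose coefficients depend on \<open>a\<close>,
  \<open>b\<close>, \<open>c\<close>, \<open>d\<close> in a triangular way; leaving these free
  allows any pure power of the logarithm to be reached. The inner function \<open>y\<close> will be
  \<open>sin\<close>, \<open>tan (t / 2)\<close>, the identity, \<open>x / (1 + x)\<close> or
  \<open>1 / (1 + x)\<close>. An endpoint value 0 is allowed because the power dominates the
  logarithms and \<open>G 0 = 0\<close>. The shift \<open>\<mu>\<close> makes the logarithm vanish
  at a chosen endpoint.\<close>

lemma has_integral_power_ln_cubic:
  fixes y y' :: "real \<Rightarrow> real" and \<mu> a b c d :: real and n :: nat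
  assumes "\<alpha> < \<beta>"
    and y: "\<And>x. \<alpha> < x \<Longrightarrow> x < \<beta> \<Longrightarrow> (y has_real_derivative y' x) (at x)"
    and pos: "\<And>x. \<alpha> < x \<Longrightarrow> x < \<beta> \<Longrightarrow> 0 < y x"
    and lim1: "(y \<longlongrightarrow> y1) (at_right \<alpha>)" and lim2: "(y \<longlongrightarrow> y2) (at_left \<beta>)"
  defines "G \<equiv> \<lambda>x. x ^ Suc n * (a * (\<mu> + ln x) ^ 3 + b * (\<mu> + ln x) ^ 2 + c * (\<mu> + ln x) + d)"
  defines "K \<equiv> real n + 1"
  shows "((\<lambda>x. y' x * (y x ^ n * (K * a * (\<mu> + ln (y x)) ^ 3 + (K * b + 3 * a) * (\<mu> + ln (y x)) ^ 2
              + (K * c + 2 * b) * (\<mu> + ln (y x)) + (K * d + c)))) has_integral (G y2 - G y1)) {\<alpha><..<\<beta>}"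
proof -
  have G0: "(G \<longlongrightarrow> G 0) (at_right 0)"
    using tendsto_power_times_ln_cubic[of n a \<mu> b c d] by (simp add: G_def)
  have G_lim: "((\<lambda>x. G (y x)) \<longlongrightarrow> G l) F"
    if "(y \<longlongrightarrow> l) F" and ev: "eventually (\<lambda>x. 0 < y x) F" and "F \<noteq> bot" for l F
  proof -
    have "0 \<le> l"
      by (rule tendsto_lowerbound[OF that(1) _ \<open>F \<noteq> bot\<close>]) (use ev in \<open>auto elim: eventually_mono\<close>)
    show ?thesis
    proof (cases "l = 0")
      case True
      have "filterlim y (at_right 0) F"
        using that True by (auto simp: filterlim_at elim: eventually_mono)
      then show ?thesis using filterlim_compose[OF G0] True by simp
    next
      case False
      then show ?thesis unfolding G_def using \<open>0 \<le> l\<close> by (intro tendsto_intros that) auto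
    qed
  qed
  show ?thesis
  proof (rule has_integral_FTC_limits[OF \<open>\<alpha> < \<beta>\<close>])
    show "((\<lambda>x. G (y x)) \<longlongrightarrow> G y1) (at_right \<alpha>)"
      using eventually_at_right_real[OF \<open>\<alpha> < \<beta>\<close>] pos by (intro G_lim lim1) (auto elim!: eventually_mono)
    show "((\<lambda>x. G (y x)) \<longlongrightarrow> G y2) (at_left \<beta>)"
      using eventually_at_left_real[OF \<open>\<alpha> < \<beta>\<close>] pos by (intro G_lim lim2) (auto elim!: eventually_mono)
    fix x assume x: "\<alpha> < x" "x < \<beta>"
    define l where "l = \<mu> + ln (y x)"
    define L where "L = (\<lambda>x. \<mu> + ln (y x))"
    have y0: "y x > 0" using pos x by blast
    have L: "(L has_real_derivative y' x / y x) (at x)"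
      unfolding L_def using y[OF x] y0 by (auto intro!: derivative_eq_intros)
    have p: "((\<lambda>x. y x ^ Suc n) has_real_derivative K * y x ^ n * y' x) (at x)"
      using DERIV_power[OF y[OF x], of "Suc n"] by (simp add: K_def algebra_simps del: power_Suc)
    have q: "((\<lambda>x. a * L x ^ 3 + b * L x ^ 2 + c * L x + d) has_real_derivative
       (3 * a * l ^ 2 + 2 * b * l + c) * (y' x / y x)) (at x)"
    proof -
      have "L x = l" by (simp add: L_def l_def)
      then show ?thesis
        using L by (auto intro!: derivative_eq_intros simp: algebra_simps power2_eq_square)
    qed
    have "((\<lambda>x. y x ^ Suc n * (a * L x ^ 3 + b * L x ^ 2 + c * L x + d)) has_real_derivative
        K * y x ^ n * y' x * (a * L x ^ 3 + b * L x ^ 2 + c * L x + d)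
        + (3 * a * l ^ 2 + 2 * b * l + c) * (y' x / y x) * y x ^ Suc n) (at x)"
      by (rule DERIV_mult[OF p q])
    also have "(3 * a * l ^ 2 + 2 * b * l + c) * (y' x / y x) * y x ^ Suc n = (3 * a * l ^ 2 + 2 * b * l + c) * y' x * y x ^ n"
      using y0 by simp
    also have "K * y x ^ n * y' x * (a * L x ^ 3 + b * L x ^ 2 + c * L x + d) + (3 * a * l ^ 2 + 2 * b * l + c) * y' x * y x ^ n
      = y' x * (y x ^ n * (K * a * l ^ 3 + (K * b + 3 * a) * l ^ 2 + (K * c + 2 * b) * l + (K * d + c)))"
      by (simp add: L_def l_def algebra_simps)
    finally show "((\<lambda>x. G (y x)) has_real_derivative y' x * (y x ^ n * (K * a * (\<mu> + ln (y x)) ^ 3 + (K * b + 3 * a) * (\<mu> + ln (y x)) ^ 2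
              + (K * c + 2 * b) * (\<mu> + ln (y x)) + (K * d + c)))) (at x)"
      by (simp add: G_def L_def l_def)
  qed
qed

lemma
  fixes y y' :: "real \<Rightarrow> real" and \<mu> :: real and n :: nat
  assumes "\<alpha> < \<beta>"
    and "\<And>x. \<alpha> < x \<Longrightarrow> x < \<beta> \<Longrightarrow> (y has_real_derivative y' x) (at x)"
    and "\<And>x. \<alpha> < x \<Longrightarrow> x < \<beta> \<Longrightarrow> 0 < y x"
    and "(y \<longlongrightarrow> y1) (at_right \<alpha>)" and "(y \<longlongrightarrow> y2) (at_left \<beta>)"
  defines "K \<equiv> real n + 1"
  shows has_integral_power_ln_1: "((\<lambda>x. y' x * (y x ^ n * (\<mu> + ln (y x)))) has_integral
            y2 ^ Suc n * ((\<mu> + ln y2) / K - 1 / K ^ 2) - y1 ^ Suc n * ((\<mu> + ln y1) / K - 1 / K ^ 2)) {\<alpha><..<\<beta>}" (is ?A)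
    and has_integral_power_ln_2: "((\<lambda>x. y' x * (y x ^ n * (\<mu> + ln (y x)) ^ 2)) has_integral
            y2 ^ Suc n * ((\<mu> + ln y2) ^ 2 / K - 2 * (\<mu> + ln y2) / K ^ 2 + 2 / K ^ 3)
            - y1 ^ Suc n * ((\<mu> + ln y1) ^ 2 / K - 2 * (\<mu> + ln y1) / K ^ 2 + 2 / K ^ 3)) {\<alpha><..<\<beta>}" (is ?B)
    and has_integral_power_ln_3: "((\<lambda>x. y' x * (y x ^ n * (\<mu> + ln (y x)) ^ 3)) has_integral
            y2 ^ Suc n * ((\<mu> + ln y2) ^ 3 / K - 3 * (\<mu> + ln y2) ^ 2 / K ^ 2 + 6 * (\<mu> + ln y2) / K ^ 3 - 6 / K ^ 4)
            - y1 ^ Suc n * ((\<mu> + ln y1) ^ 3 / K - 3 * (\<mu> + ln y1) ^ 2 / K ^ 2 + 6 * (\<mu> + ln y1) / K ^ 3 - 6 / K ^ 4)) {\<alpha><..<\<beta>}" (is ?C)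
proof -
  have "K > 0" by (simp add: K_def)
  note * = has_integral_power_ln_cubic[OF assms(1-5), of n _ \<mu>, folded K_def]
  \<comment> \<open>These identities solve the triangular system for the right-hand sides
    \<open>(\<mu> + ln x) ^ j\<close> with \<open>j = 1, 2, 3\<close>.\<close>
  have "K * (1 / K) = 1" "K * (- (1 / K ^ 2)) + 1 / K = 0"
    "K * (- (2 / K ^ 2)) + 2 * (1 / K) = 0" "K * (2 / K ^ 3) + - (2 / K ^ 2) = 0"
    "K * (- (3 / K ^ 2)) + 3 * (1 / K) = 0" "K * (6 / K ^ 3) + 2 * (- (3 / K ^ 2)) = 0"
    "K * (- (6 / K ^ 4)) + 6 / K ^ 3 = 0"
    using \<open>K > 0\<close> by (simp_all add: field_simps eval_nat_numeral)
  note coeffs = this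
  show ?A
    using *[of 0 0 "1 / K" "- (1 / K ^ 2)", unfolded coeffs] by simp
  show ?B
    using *[of 0 "1 / K" "- (2 / K ^ 2)" "2 / K ^ 3", unfolded coeffs] \<open>K > 0\<close> by simp
  show ?C
    using *[of "1 / K" "- (3 / K ^ 2)" "6 / K ^ 3" "- (6 / K ^ 4)", unfolded coeffs] \<open>K > 0\<close> by simp
qed

section \<open>The weights and the arcsine series\<close>

definition cb :: "nat \<Rightarrow> real" where
  "cb k = 4 ^ k / ((real k)\<^sup>2 * real ((2 * k) choose k))"

lemma cb_1: "cb (Suc 0) = 2"
  by (simp add: cb_def)

lemma cb_pos: "0 < cb (Suc k)"
  unfolding cb_def by (intro divide_pos_pos mult_pos_pos) (simp_all add: zero_less_binomial_iff del: binomial_Suc_Suc)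

text \<open>With \<open>n = 2 * k + 4\<close>, the new weight times \<open>n * (n - 1)\<close>
  equals the old weight times \<open>(n - 2)\<^sup>2\<close>. These are the two coefficients in
  \<open>(sin ^ n)'' = n * (n - 1) * sin ^ (n - 2) - n\<^sup>2 * sin ^ n\<close>, so neighbouring
  terms of the weighted sum cancel.\<close>

lemma cb_Suc: "cb (Suc (Suc k)) * ((2 * real k + 4) * (2 * real k + 3)) = 4 * (real k + 1)\<^sup>2 * cb (Suc k)"
proof -
  define n where "n = Suc k"
  have "Suc n * ((2 * Suc n) choose (Suc n)) = (2 * Suc n) * ((2 * n + 1) choose n)"
    using Suc_times_binomial[of n "2 * n + 1"] by simp
  moreover have "(2 * n + 1) choose n = (2 * n + 1) choose (Suc n)"
    using binomial_symmetric[of n "2 * n + 1"] by simp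
  moreover have "Suc n * ((2 * n + 1) choose (Suc n)) = (2 * n + 1) * ((2 * n) choose n)"
    using Suc_times_binomial[of n "2 * n"] by simp
  ultimately have "Suc n * (Suc n * ((2 * Suc n) choose (Suc n))) = (2 * Suc n) * ((2 * n + 1) * ((2 * n) choose n))"
    by (metis mult.left_commute)
  then have "real (Suc n * (Suc n * ((2 * Suc n) choose (Suc n)))) = real ((2 * Suc n) * ((2 * n + 1) * ((2 * n) choose n)))"
    by presburger
  then have *: "(real n + 1) * (real n + 1) * real ((2 * Suc n) choose (Suc n)) = 2 * (real n + 1) * (2 * real n + 1) * real ((2 * n) choose n)"
    by (simp add: algebra_simps del: binomial_Suc_Suc)
  define B B' where "B = real ((2 * n) choose n)" and "B' = real ((2 * Suc n) choose (Suc n))"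
  have pos: "B > 0" "real n > 0"
    by (simp_all add: zero_less_binomial_iff n_def B_def del: binomial_Suc_Suc)
  define c where "c = (2 * real n + 2) * (2 * real n + 1)"
  have "c > 0" by (simp add: c_def)
  have "(real (Suc n))\<^sup>2 * B' = c * B"
    using * unfolding c_def by (simp add: B_def B'_def power2_eq_square algebra_simps del: binomial_Suc_Suc)
  then have "cb (Suc n) = 4 * 4 ^ n / (c * B)"
    unfolding cb_def B'_def[symmetric] by simp
  moreover have "cb n = 4 ^ n / ((real n)\<^sup>2 * B)"
    unfolding cb_def B_def ..
  ultimately have "cb (Suc n) * c = 4 * (real n)\<^sup>2 * cb n"
    using pos \<open>c > 0\<close> by (simp del: of_nat_Suc)
  then show ?thesis by (simp add: n_def c_def algebra_simps)
qed

lemma cb_le: "cb (Suc k) \<le> 2"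
proof (induction k)
  case (Suc k)
  have "cb (Suc (Suc k)) * ((2 * real k + 4) * (2 * real k + 3)) \<le> 2 * (4 * (real k + 1)\<^sup>2)"
    unfolding cb_Suc using Suc by (simp add: mult_left_mono)
  also have "\<dots> \<le> 2 * ((2 * real k + 4) * (2 * real k + 3))"
    by (simp add: power2_eq_square algebra_simps)
  finally show ?case by (simp add: mult_le_cancel_right_pos)
qed (simp add: cb_1)

lemma has_integral_sin_power_step:
  assumes "0 < a"
  shows "((\<lambda>t. 2 * (real k + 1) * (2 * real k + 1) * sin t ^ (2 * k) - 4 * (real k + 1)\<^sup>2 * sin t ^ (2 * k + 2))
            has_integral 2 * (real k + 1) * (sin a ^ (2 * k + 1) * cos a)) {0<..<a}"
proof -
  have "((\<lambda>t. 2 * (real k + 1) * (2 * real k + 1) * sin t ^ (2 * k) - 4 * (real k + 1)\<^sup>2 * sin t ^ (2 * k + 2))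
            has_integral (2 * (real k + 1) * (sin a ^ (2 * k + 1) * cos a)
               - 2 * (real k + 1) * (sin 0 ^ (2 * k + 1) * cos 0))) {0<..<a}"
  proof (rule has_integral_FTC_continuous[OF assms])
    fix t :: real
    have c2: "cos t * cos t = 1 - sin t * sin t"
      using sin_cos_squared_add[of t] by (simp add: power2_eq_square)
    have "((\<lambda>t. 2 * (real k + 1) * (sin t ^ (2 * k + 1) * cos t)) has_real_derivative
        2 * (real k + 1) * (((2 * real k + 1) * sin t ^ (2 * k) * cos t) * cos t + sin t ^ (2 * k + 1) * (- sin t))) (at t)"
      by (rule derivative_eq_intros refl)+ (simp add: algebra_simps)
    also have "2 * (real k + 1) * (((2 * real k + 1) * sin t ^ (2 * k) * cos t) * cos t + sin t ^ (2 * k + 1) * (- sin t))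
      = 2 * (real k + 1) * ((2 * real k + 1) * sin t ^ (2 * k) * (cos t * cos t) - sin t ^ (2 * k) * (sin t * sin t))"
      by (simp add: algebra_simps)
    also have "\<dots> = 2 * (real k + 1) * (2 * real k + 1) * sin t ^ (2 * k) - 4 * (real k + 1)\<^sup>2 * sin t ^ (2 * k + 2)"
      unfolding c2 by (simp add: algebra_simps power2_eq_square)
    finally show "((\<lambda>t. 2 * (real k + 1) * (sin t ^ (2 * k + 1) * cos t)) has_real_derivative
       2 * (real k + 1) * (2 * real k + 1) * sin t ^ (2 * k) - 4 * (real k + 1)\<^sup>2 * sin t ^ (2 * k + 2)) (at t)" .
  qed (intro continuous_intros)
  then show ?thesis by simp
qed

lemma has_integral_sin_power:
  "((\<lambda>t. sin t ^ n) has_integral integral {0<..<a} (\<lambda>t. sin t ^ n)) {0<..<a::real}"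
proof -
  have "(\<lambda>t. sin t ^ n) integrable_on {0..a}"
    by (intro integrable_continuous_real continuous_intros)
  then show ?thesis
    by (simp add: integrable_on_Icc_iff_Ioo integrable_integral)
qed

text \<open>Multiplying \<open>(sin\<^sup>n)'' = n (n - 1) sin\<^sup>n\<^sup>-\<^sup>2 - n\<^sup>2 sin\<^sup>n\<close> by \<open>cb\<close> makes the sum telescope; the remainder
  after \<open>k\<close> terms is \<open>4 k\<^sup>2 * cb k\<close> times the integral of \<open>sin ^ (2 k)\<close>.\<close>

lemma arcsin_deriv_series:
  assumes "0 \<le> a" "a < pi / 2"
  shows "(\<lambda>k. 2 * (real k + 1) * cb (Suc k) * (sin a ^ (2 * k + 1) * cos a)) sums (4 * a)"
proof (cases "a = 0")
  case False
  then have "0 < a" using assms by simp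
  define X where "X n = integral {0<..<a} (\<lambda>t. sin t ^ (2 * n))" for n
  have X: "((\<lambda>t. sin t ^ (2 * n)) has_integral X n) {0<..<a}" for n
    unfolding X_def by (rule has_integral_sin_power)
  have X0: "X 0 = a"
    unfolding X_def using \<open>0 < a\<close> by (simp add: integral_open_interval_real[symmetric])
  have step: "2 * (real k + 1) * (2 * real k + 1) * X k - 4 * (real k + 1)\<^sup>2 * X (Suc k)
                = 2 * (real k + 1) * (sin a ^ (2 * k + 1) * cos a)" for k
  proof -
    have "((\<lambda>t. 2 * (real k + 1) * (2 * real k + 1) * sin t ^ (2 * k) - 4 * (real k + 1)\<^sup>2 * sin t ^ (2 * Suc k))
      has_integral 2 * (real k + 1) * (2 * real k + 1) * X k - 4 * (real k + 1)\<^sup>2 * X (Suc k)) {0<..<a}"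
      by (intro has_integral_diff has_integral_mult_right X)
    then show ?thesis
      using has_integral_sin_power_step[OF \<open>0 < a\<close>, of k] by (auto intro: has_integral_unique)
  qed
  have partial: "(\<Sum>k<Suc n. 2 * (real k + 1) * cb (Suc k) * (sin a ^ (2 * k + 1) * cos a))
                   = 4 * a - 4 * (real n + 1)\<^sup>2 * cb (Suc n) * X (Suc n)" for n
  proof (induction n)
    case 0
    then show ?case using step[of 0] X0 by (simp add: cb_1)
  next
    case (Suc n)
    have "2 * (real (Suc n) + 1) * cb (Suc (Suc n)) * (sin a ^ (2 * Suc n + 1) * cos a)
        = cb (Suc (Suc n)) * ((2 * real n + 4) * (2 * real n + 3)) * X (Suc n)
           - 4 * (real (Suc n) + 1)\<^sup>2 * cb (Suc (Suc n)) * X (Suc (Suc n))"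
      using arg_cong[OF step[of "Suc n"], of "\<lambda>x. cb (Suc (Suc n)) * x"] by (simp add: algebra_simps)
    then show ?case
      using Suc unfolding cb_Suc by (subst sum.lessThan_Suc) simp
  qed
  have s: "0 \<le> sin a" "sin a < 1"
    using assms sin_ge_zero[of a] sin_monotone_2pi[of a "pi/2"] by auto
  have X_bound: "0 \<le> X n" "X n \<le> a * sin a ^ (2 * n)" for n
  proof -
    have sin_t: "0 \<le> sin t" "sin t \<le> sin a" if "t \<in> {0<..<a}" for t
      using that assms by (auto intro!: sin_ge_zero sin_monotone_2pi_le)
    show "0 \<le> X n"
      using X[of n] by (rule has_integral_nonneg) (simp add: power_mult)
    have "((\<lambda>t. sin a ^ (2 * n)) has_integral (a * sin a ^ (2 * n))) {0<..<a}"
      using has_integral_const_real[of "sin a ^ (2 * n)" 0 a] \<open>0 < a\<close> by (simp add: has_integral_Icc_iff_Ioo)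
    with X show "X n \<le> a * sin a ^ (2 * n)"
      by (rule has_integral_le) (intro power_mono sin_t)
  qed
  \<comment> \<open>The remainder is at most
    \<open>8 * a * (real (Suc n) * sin a ^ Suc n)\<^sup>2\<close>. It tends to 0 because
    \<open>sin a < 1\<close>, which is where \<open>a < pi / 2\<close> enters.\<close>
  have "(\<lambda>n. real n * sin a ^ n) \<longlonglongrightarrow> 0"
    using powser_times_n_limit_0[of "sin a"] s by simp
  then have "(\<lambda>n. (real n * sin a ^ n)\<^sup>2 * (8 * a)) \<longlonglongrightarrow> 0\<^sup>2 * (8 * a)"
    by (intro tendsto_intros)
  then have "(\<lambda>n. (real (Suc n) * sin a ^ (Suc n))\<^sup>2 * (8 * a)) \<longlonglongrightarrow> 0"
    using LIMSEQ_Suc by fastforce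
  then have "(\<lambda>n. 4 * (real n + 1)\<^sup>2 * cb (Suc n) * X (Suc n)) \<longlonglongrightarrow> 0"
  proof (rule Lim_null_comparison[rotated], intro always_eventually allI)
    fix n
    have "4 * (real n + 1)\<^sup>2 * (cb (Suc n) * X (Suc n)) \<le> 4 * (real n + 1)\<^sup>2 * (2 * (a * sin a ^ (2 * Suc n)))"
      using cb_le[of n] cb_pos[of n] X_bound[of "Suc n"] by (intro mult_left_mono mult_mono) auto
    moreover have "(real (Suc n) * sin a ^ (Suc n))\<^sup>2 * (8 * a) = 4 * (real n + 1)\<^sup>2 * (2 * (a * sin a ^ (2 * Suc n)))"
      unfolding power_mult_distrib power_even_eq by (simp add: add.commute)
    ultimately show "norm (4 * (real n + 1)\<^sup>2 * cb (Suc n) * X (Suc n)) \<le> (real (Suc n) * sin a ^ (Suc n))\<^sup>2 * (8 * a)"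
      using cb_pos[of n] X_bound[of "Suc n"] unfolding mult.assoc
      by (simp only: real_norm_def abs_mult abs_of_nonneg abs_of_pos) simp
  qed
  then have "(\<lambda>n. 4 * a - 4 * (real n + 1)\<^sup>2 * cb (Suc n) * X (Suc n)) \<longlonglongrightarrow> 4 * a - 0"
    by (intro tendsto_intros)
  then show ?thesis
    unfolding sums_def partial[symmetric] by (subst (asm) filterlim_sequentially_Suc) simp
qed simp

lemma has_integral_sin_power_cos:
  assumes "0 < a"
  shows "((\<lambda>t. 2 * (real k + 1) * (sin t ^ (2 * k + 1) * cos t)) has_integral sin a ^ (2 * k + 2)) {0<..<a}"
proof -
  have "((\<lambda>t. 2 * (real k + 1) * (sin t ^ (2 * k + 1) * cos t)) has_integral sin a ^ (2 * k + 2) - sin 0 ^ (2 * k + 2)) {0<..<a}"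
    by (rule has_integral_FTC_continuous[OF assms])
       ((rule derivative_eq_intros refl)+, simp add: algebra_simps, intro continuous_intros)
  then show ?thesis by simp
qed

text \<open>Termwise integration of the derivative series. Monotone convergence reaches the endpoint
  \<open>a = pi / 2\<close>, where the derivative series itself fails: its terms all vanish there,
  while \<open>4 * a\<close> is \<open>2 * pi\<close>.\<close>

lemma arcsin_series:
  assumes "0 < a" "a \<le> pi / 2"
  shows "(\<lambda>k. cb (Suc k) * sin a ^ (2 * k + 2)) sums (2 * a\<^sup>2)"
proof (rule sums_integral_nonneg)
  show "((\<lambda>t. cb (Suc k) * (2 * (real k + 1) * (sin t ^ (2 * k + 1) * cos t))) has_integral cb (Suc k) * sin a ^ (2 * k + 2)) {0<..<a}" for k
    by (intro has_integral_mult_right has_integral_sin_power_cos assms)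
  show "0 \<le> cb (Suc k) * (2 * (real k + 1) * (sin t ^ (2 * k + 1) * cos t))" if "t \<in> {0<..<a}" for k t
    using that assms cb_pos[of k] by (auto intro!: mult_nonneg_nonneg zero_le_power sin_ge_zero cos_ge_zero)
  show "(\<lambda>k. cb (Suc k) * (2 * (real k + 1) * (sin t ^ (2 * k + 1) * cos t))) sums (4 * t)" if "t \<in> {0<..<a}" for t
    using arcsin_deriv_series[of t] that assms by (simp add: mult_ac)
  have "((\<lambda>t. 4 * t) has_integral (2 * a\<^sup>2 - 2 * 0\<^sup>2)) {0<..<a}"
    by (rule has_integral_FTC_continuous[OF assms(1)])
       (auto intro!: derivative_eq_intros continuous_intros)
  then show "((\<lambda>t. 4 * t) has_integral 2 * a\<^sup>2) {0<..<a}" by simp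
qed

lemma cb_sums: "(\<lambda>k. cb (Suc k)) sums (pi\<^sup>2 / 2)"
  using arcsin_series[of "pi / 2"] by (simp add: power2_eq_square)

section \<open>Moments that produce the harmonic factors\<close>

lemma cb_weighted_sums:
  assumes w: "\<And>t. 0 < t \<Longrightarrow> t < pi / 2 \<Longrightarrow> 0 \<le> w t"
    and m: "\<And>k. ((\<lambda>t. 2 * (real k + 1) * (sin t ^ (2 * k + 1) * cos t) * w t) has_integral m k) {0<..<pi/2}"
    and I: "((\<lambda>t. t * w t) has_integral I) {0<..<pi/2}"
  shows "(\<lambda>k. cb (Suc k) * m k) sums (4 * I)"
proof (rule sums_integral_nonneg)
  show "((\<lambda>t. cb (Suc k) * (2 * (real k + 1) * (sin t ^ (2 * k + 1) * cos t) * w t)) has_integral cb (Suc k) * m k) {0<..<pi/2}" for k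
    by (intro has_integral_mult_right m)
  show "0 \<le> cb (Suc k) * (2 * (real k + 1) * (sin t ^ (2 * k + 1) * cos t) * w t)" if "t \<in> {0<..<pi/2}" for k t
    using that cb_pos[of k] w[of t] by (auto intro!: mult_nonneg_nonneg zero_le_power sin_ge_zero cos_ge_zero)
  show "(\<lambda>k. cb (Suc k) * (2 * (real k + 1) * (sin t ^ (2 * k + 1) * cos t) * w t)) sums (4 * (t * w t))" if "t \<in> {0<..<pi/2}" for t
    using sums_mult2[OF arcsin_deriv_series[of t], of "w t"] that by (simp add: mult_ac)
  show "((\<lambda>t. 4 * (t * w t)) has_integral 4 * I) {0<..<pi/2}"
    by (intro has_integral_mult_right I)
qed

lemma filterlim_one_minus_sin: "filterlim (\<lambda>x::real. 1 - sin x) (at_right 0) (at_left (pi/2))"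
proof -
  have "((\<lambda>x::real. 1 - sin x) \<longlongrightarrow> 1 - sin (pi/2)) (at_left (pi/2))"
    by (intro tendsto_intros)
  moreover have "eventually (\<lambda>x::real. 1 - sin x > 0) (at_left (pi/2))"
  proof -
    have "sin x < sin (pi/2)" if "x \<in> {0<..<pi/2}" for x :: real
      using that by (intro sin_monotone_2pi) auto
    then show ?thesis
      using eventually_at_left_real[of 0 "pi/2"] pi_gt_zero by (auto elim!: eventually_mono)
  qed
  ultimately show ?thesis by (auto simp: filterlim_at elim!: eventually_mono)
qed

text \<open>The weight is \<open>ln (sin t) ^ 2\<close>: in \<open>s = sin t\<close>, the integral
  of \<open>ln\<^sup>2 s\<close> against \<open>d(s ^ (2 * k + 2))\<close> over the unit interval is
  \<open>2 / (2 * k + 2)\<^sup>2\<close>.\<close>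

lemma cb_div_square_sums:
  assumes "((\<lambda>t. t * ln (sin t) ^ 2) has_integral I) {0<..<pi/2}"
  shows "(\<lambda>k. cb (Suc k) / (real (Suc k))\<^sup>2) sums (8 * I)"
proof -
  have "(\<lambda>k. cb (Suc k) * (1 / (2 * (real k + 1)\<^sup>2))) sums (4 * I)"
  proof (rule cb_weighted_sums[OF _ _ assms])
    fix k :: nat
    define n where "n = 2 * k + 1"
    define K where "K = real n + 1"
    have K: "K = 2 * (real k + 1)" by (simp add: K_def n_def)
    then have "K > 0" by simp
    have "((\<lambda>t. K * (cos t * (sin t ^ n * (0 + ln (sin t)) ^ 2))) has_integral
        K * (1 ^ Suc n * ((0 + ln 1) ^ 2 / K - 2 * (0 + ln 1) / K ^ 2 + 2 / K ^ 3)
        - 0 ^ Suc n * ((0 + ln 0) ^ 2 / K - 2 * (0 + ln 0) / K ^ 2 + 2 / K ^ 3))) {0<..<pi/2}"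
    proof (intro has_integral_mult_right has_integral_power_ln_2[where y = sin and n = n, folded K_def])
      show "(sin \<longlongrightarrow> 0) (at_right (0::real))" by real_asymp
      show "(sin \<longlongrightarrow> 1) (at_left (pi/2))"
        using tendsto_sin[OF tendsto_ident_at, of "pi/2" "{..<pi/2}"] by simp
    qed (auto intro!: sin_gt_zero DERIV_sin)
    moreover have "K * (1 ^ Suc n * ((0 + ln 1) ^ 2 / K - 2 * (0 + ln 1) / K ^ 2 + 2 / K ^ 3)
        - 0 ^ Suc n * ((0 + ln 0) ^ 2 / K - 2 * (0 + ln 0) / K ^ 2 + 2 / K ^ 3)) = 1 / (2 * (real k + 1)\<^sup>2)"
    proof -
      have "K\<^sup>2 = 4 * (real k + 1)\<^sup>2" unfolding K by (simp only: power_mult_distrib) simp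
      moreover have "K * (2 / K ^ 3) = 2 / K\<^sup>2"
        using \<open>K > 0\<close> by (simp add: field_simps eval_nat_numeral)
      ultimately show ?thesis by simp
    qed
    moreover have "K * (cos t * (sin t ^ n * (0 + ln (sin t)) ^ 2))
        = 2 * (real k + 1) * (sin t ^ (2 * k + 1) * cos t) * ln (sin t) ^ 2" for t
      by (simp add: K n_def)
    ultimately show "((\<lambda>t. 2 * (real k + 1) * (sin t ^ (2 * k + 1) * cos t) * ln (sin t) ^ 2) has_integral 1 / (2 * (real k + 1)\<^sup>2)) {0<..<pi/2}"
      by (simp only:)
  qed simp
  from sums_mult[OF this, of 2] show ?thesis by (simp add: field_simps add.commute)
qed

lemma DERIV_truncated_log:
  "((\<lambda>x. \<Sum>i=1..n. x ^ i / real i) has_real_derivative (\<Sum>i<n. x ^ i)) (at x)"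
proof -
  have "((\<lambda>x. \<Sum>i=1..n. x ^ i / real i) has_real_derivative (\<Sum>i=1..n. x ^ (i - 1))) (at x)"
  proof (rule DERIV_sum)
    fix i assume "i \<in> {1..n}"
    then show "((\<lambda>x. x ^ i / real i) has_real_derivative x ^ (i - 1)) (at x)"
      by (auto intro!: derivative_eq_intros simp del: power_Suc)
  qed
  also have "(\<Sum>i=1..n. x ^ (i - 1)) = (\<Sum>i<n. x ^ i)"
    by (rule sum.reindex_bij_witness[of _ Suc "\<lambda>i. i - 1"]) auto
  finally show ?thesis .
qed

text \<open>By induction: two consecutive moments differ by
  \<open>2 * harm (Suc n) / real (Suc n)\<close>, and this is the increment of
  \<open>H\<^sup>2 + H\<^sub>2\<close>, since the \<open>- 1 / (n + 1)\<^sup>2\<close> left from the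
  difference of squares is compensated by the new term of \<open>H\<^sub>2\<close>.\<close>

lemma has_integral_power_ln_one_minus_sin:
  "((\<lambda>t. real n * (sin t ^ (n - 1) * cos t) * ln (1 - sin t) ^ 2) has_integral (harm n)\<^sup>2 + gen_harm 2 n) {0<..<pi/2}"
proof (induction n)
  case 0
  then show ?case by (simp add: harm_def gen_harm_def)
next
  case (Suc n)
  define P where "P x = (\<Sum>i=1..Suc n. x ^ i / real i)" for x :: real
  \<comment> \<open>Integration by parts for \<open>(x ^ Suc n - x ^ n)'\<close> against
    \<open>ln (1 - x) ^ 2\<close>: the factor \<open>x - 1\<close> cancels the pole of the
    logarithmic derivative and leaves \<open>2 * x ^ n * ln (1 - x)\<close>, which the second
    summand removes. Its constant of integration makes the factor \<open>x ^ Suc n - 1\<close>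
    vanish at 1, so that \<open>F\<close> has a limit there.\<close>
  define F where "F x = x ^ n * (x - 1) * ln (1 - x) ^ 2 - 2 * ((x ^ Suc n - 1) * ln (1 - x) / real (Suc n) - P x / real (Suc n))" for x :: real
  have P1: "P 1 = harm (Suc n)"
    by (simp add: P_def harm_def inverse_eq_divide)
  have P0: "P 0 = 0"
    unfolding P_def by (intro sum.neutral) auto
  have geo: "x ^ Suc n - 1 = (x - 1) * (\<Sum>i<Suc n. x ^ i)" for x :: real
    by (rule power_diff_1_eq)
  have "((\<lambda>t. real (Suc n) * (sin t ^ n * cos t) * ln (1 - sin t) ^ 2 - real n * (sin t ^ (n - 1) * cos t) * ln (1 - sin t) ^ 2)
          has_integral (2 * P 1 / real (Suc n) - F (sin 0))) {0<..<pi/2}"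
  proof (rule has_integral_FTC_limits)
    show "((\<lambda>t. F (sin t)) \<longlongrightarrow> F (sin 0)) (at_right 0)"
      unfolding F_def P_def by (intro tendsto_intros) auto
    have l1: "((\<lambda>t. (1 - sin t) * ln (1 - sin t)) \<longlongrightarrow> 0) (at_left (pi/2))"
      by (rule filterlim_compose[OF _ filterlim_one_minus_sin]) real_asymp
    have l2: "((\<lambda>t. (1 - sin t) * ln (1 - sin t) ^ 2) \<longlongrightarrow> 0) (at_left (pi/2))"
      by (rule filterlim_compose[OF _ filterlim_one_minus_sin]) real_asymp
    let ?g = "\<lambda>t. - (sin t ^ n * ((1 - sin t) * ln (1 - sin t) ^ 2))
             + 2 * ((\<Sum>i<Suc n. sin t ^ i) * ((1 - sin t) * ln (1 - sin t))) / real (Suc n) + 2 * P (sin t) / real (Suc n)"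
    have "((\<lambda>t. ?g t)
        \<longlongrightarrow> - (sin (pi/2) ^ n * 0) + 2 * ((\<Sum>i<Suc n. sin (pi/2) ^ i) * 0) / real (Suc n) + 2 * P (sin (pi/2)) / real (Suc n)) (at_left (pi/2))"
      unfolding P_def by (intro tendsto_intros l1 l2) auto
    moreover have "F (sin t) = ?g t" for t
    proof -
      define N Q where "N = real (Suc n)" and "Q = (\<Sum>i<Suc n. sin t ^ i)"
      have "N > 0" by (simp add: N_def)
      then show ?thesis
        unfolding F_def geo N_def[symmetric] Q_def[symmetric] by (simp add: field_simps)
    qed
    ultimately show "((\<lambda>t. F (sin t)) \<longlongrightarrow> 2 * P 1 / real (Suc n)) (at_left (pi/2))"
      by simp
    fix t :: real assume t: "0 < t" "t < pi/2"
    then have "sin t < sin (pi/2)" by (intro sin_monotone_2pi) auto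
    then have s: "sin t < 1" by simp
    define x where "x = sin t"
    have x: "x < 1" using s by (simp add: x_def)
    have dP: "(P has_real_derivative (\<Sum>i<Suc n. x ^ i)) (at x)"
      unfolding P_def by (rule DERIV_truncated_log)
    define G where "G = (\<Sum>i<Suc n. x ^ i)"
    have gG: "x ^ Suc n = 1 + (x - 1) * G"
      using geo[of x] by (simp add: G_def)
    have xn: "real n * x ^ (n - Suc 0) * x = real n * x ^ n"
      by (cases n) auto
    let ?D = "((real n * x ^ (n - 1) * (x - 1) + x ^ n) * ln (1 - x) ^ 2 + x ^ n * (x - 1) * (2 * ln (1 - x) * (- 1 / (1 - x))))
         - 2 * ((real (Suc n) * x ^ n * ln (1 - x) + (x ^ Suc n - 1) * (- 1 / (1 - x))) / real (Suc n) - G / real (Suc n))"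
    have "(F has_real_derivative
        ?D) (at x)"
      unfolding F_def using x dP[folded G_def]
      by (auto intro!: derivative_eq_intros simp del: power_Suc of_nat_Suc)
         (simp add: xn field_simps)
    also have "?D
       = (real n * (x ^ (n - 1) * x) - real n * x ^ (n - 1) + x ^ n) * ln (1 - x) ^ 2"
    proof -
      have 1: "x ^ n * (x - 1) * (2 * ln (1 - x) * (- 1 / (1 - x))) = 2 * x ^ n * ln (1 - x)"
        using x by (simp add: field_simps)
      have 2: "(x ^ Suc n - 1) * (- 1 / (1 - x)) = G"
        unfolding gG using x by (simp add: field_simps)
      show ?thesis unfolding 1 2 by (simp add: field_simps del: of_nat_Suc)
    qed
    also have "real n * (x ^ (n - 1) * x) = real n * x ^ n"
      by (cases n) auto
    also have "(real n * x ^ n - real n * x ^ (n - 1) + x ^ n) * ln (1 - x) ^ 2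
      = real (Suc n) * x ^ n * ln (1 - x) ^ 2 - real n * x ^ (n - 1) * ln (1 - x) ^ 2"
      by (simp add: algebra_simps)
    finally have "(F has_real_derivative real (Suc n) * x ^ n * ln (1 - x) ^ 2 - real n * x ^ (n - 1) * ln (1 - x) ^ 2) (at (sin t))"
      by (simp add: x_def)
    from DERIV_chain2[OF this DERIV_sin]
    show "((\<lambda>t. F (sin t)) has_real_derivative
       real (Suc n) * (sin t ^ n * cos t) * ln (1 - sin t) ^ 2 - real n * (sin t ^ (n - 1) * cos t) * ln (1 - sin t) ^ 2) (at t)"
      by (simp add: x_def algebra_simps)
  qed simp
  from has_integral_add[OF this Suc]
  have "((\<lambda>t. real (Suc n) * (sin t ^ n * cos t) * ln (1 - sin t) ^ 2) has_integral (2 * P 1 / real (Suc n) - F (sin 0) + ((harm n)\<^sup>2 + gen_harm 2 n))) {0<..<pi/2}"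
    by simp
  moreover have "2 * P 1 / real (Suc n) - F (sin 0) + ((harm n)\<^sup>2 + gen_harm 2 n) = (harm (Suc n))\<^sup>2 + gen_harm 2 (Suc n)"
  proof -
    have "F (sin 0) = 0" by (simp add: F_def P0)
    moreover define e where "e = 1 / real (Suc n)"
    moreover have "gen_harm 2 (Suc n) = gen_harm 2 n + e\<^sup>2"
      by (simp add: gen_harm_def e_def power_divide)
    moreover have "harm (Suc n) = harm n + e"
      by (simp add: harm_Suc inverse_eq_divide e_def)
    moreover have "2 * P 1 / real (Suc n) = 2 * P 1 * e"
      by (simp add: e_def)
    ultimately show ?thesis
      unfolding P1 by (simp add: power2_eq_square algebra_simps)
  qed
  ultimately show ?case by simp
qed

lemma cb_harm_sums:
  assumes "((\<lambda>t. t * ln (1 - sin t) ^ 2) has_integral I) {0<..<pi/2}"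
  shows "(\<lambda>k. cb (Suc k) * ((harm (2 * Suc k))\<^sup>2 + gen_harm 2 (2 * Suc k))) sums (4 * I)"
proof (rule cb_weighted_sums[OF _ _ assms])
  show "((\<lambda>t. 2 * (real k + 1) * (sin t ^ (2 * k + 1) * cos t) * ln (1 - sin t) ^ 2) has_integral (harm (2 * Suc k))\<^sup>2 + gen_harm 2 (2 * Suc k)) {0<..<pi/2}" for k
    using has_integral_power_ln_one_minus_sin[of "2 * Suc k"] by (simp add: algebra_simps)
qed simp

section \<open>Odd and even denominators in the harmonic numbers of order 2\<close>

definition odd_harm :: "nat \<Rightarrow> nat \<Rightarrow> real" where
  "odd_harm m k = (\<Sum>j<k. 1 / (2 * real j + 1) ^ m)"

lemma odd_harm_0 [simp]: "odd_harm m 0 = 0"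
  by (simp add: odd_harm_def)

lemma odd_harm_Suc: "odd_harm m (Suc k) = odd_harm m k + 1 / (2 * real k + 1) ^ m"
  by (simp add: odd_harm_def)

lemma gen_harm_Suc: "gen_harm m (Suc k) = gen_harm m k + 1 / (real k + 1) ^ m"
  by (simp add: gen_harm_def add.commute)

lemma gen_harm_double: "gen_harm m (2 * k) = odd_harm m k + gen_harm m k / 2 ^ m"
proof (induction k)
  case (Suc k)
  have "gen_harm m (2 * Suc k) = gen_harm m (2 * k) + 1 / (2 * real k + 1) ^ m + 1 / (2 * (real k + 1)) ^ m"
    by (simp add: gen_harm_Suc algebra_simps)
  moreover have "1 / (2 * (real k + 1)) ^ m = 1 / (real k + 1) ^ m / 2 ^ m"
    by (simp only: power_mult_distrib) simp
  ultimately show ?case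
    using Suc unfolding odd_harm_Suc gen_harm_Suc[of m k] add_divide_distrib by linarith
qed (simp add: gen_harm_def)

text \<open>Wallis' integrals. Up to the factor \<open>(k + 1) / 2\<close> the weight
  \<open>cb (Suc k)\<close> is itself such an integral, so moments over odd powers of
  \<open>sin\<close> carry the weight automatically.\<close>

lemma has_integral_sin_odd_power:
  "((\<lambda>t. sin t ^ (2 * k + 1)) has_integral (real k + 1) * cb (Suc k) / 2) {0<..<pi/2}"
proof (induction k)
  case 0
  have "((\<lambda>t. sin t) has_integral ((- cos (pi/2)) - (- cos 0))) {0<..<pi/2}"
    by (rule has_integral_FTC_continuous) (auto intro!: derivative_eq_intros continuous_intros)
  then show ?case by (simp add: cb_1)
next
  case (Suc k)
  define n where "n = 2 * k + 1"
  define N where "N = real n + 2"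
  have "N > 0" by (simp add: N_def)
  have "((\<lambda>t. N * sin t ^ (n + 2) - (N - 1) * sin t ^ n) has_integral
       (- (sin (pi/2) ^ (n + 1) * cos (pi/2))) - (- (sin 0 ^ (n + 1) * cos 0))) {0<..<pi/2}"
  proof (rule has_integral_FTC_continuous)
    fix t :: real
    have "((\<lambda>t. - (sin t ^ (n + 1) * cos t)) has_real_derivative
        - ((real (n + 1) * sin t ^ n * cos t) * cos t + sin t ^ (n + 1) * (- sin t))) (at t)"
      by (rule derivative_eq_intros refl)+ (simp add: algebra_simps)
    also have "- ((real (n + 1) * sin t ^ n * cos t) * cos t + sin t ^ (n + 1) * (- sin t))
       = - (real (n + 1) * sin t ^ n * (cos t)\<^sup>2) + sin t ^ n * (sin t)\<^sup>2"
      by (simp add: algebra_simps power2_eq_square)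
    also have "\<dots> = N * sin t ^ (n + 2) - (N - 1) * sin t ^ n"
      unfolding cos_squared_eq by (simp add: N_def algebra_simps power2_eq_square)
    finally show "((\<lambda>t. - (sin t ^ (n + 1) * cos t)) has_real_derivative N * sin t ^ (n + 2) - (N - 1) * sin t ^ n) (at t)" .
  qed (auto intro!: continuous_intros)
  then have "((\<lambda>t. N * sin t ^ (n + 2) - (N - 1) * sin t ^ n) has_integral 0) {0<..<pi/2}"
    by simp
  from has_integral_add[OF this has_integral_mult_right[OF Suc, of "N - 1"]]
  have "((\<lambda>t. N * sin t ^ (n + 2)) has_integral (N - 1) * ((real k + 1) * cb (Suc k) / 2)) {0<..<pi/2}"
    by (simp add: n_def)
  from has_integral_divide[OF this, of N]
  have "((\<lambda>t. sin t ^ (n + 2)) has_integral (N - 1) * ((real k + 1) * cb (Suc k) / 2) / N) {0<..<pi/2}"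
    using \<open>N > 0\<close> by simp
  moreover have "(N - 1) * ((real k + 1) * cb (Suc k) / 2) / N = (real (Suc k) + 1) * cb (Suc (Suc k)) / 2"
  proof -
    have "cb (Suc (Suc k)) * ((2 * real k + 4) * N) = 4 * (real k + 1)\<^sup>2 * cb (Suc k)"
      using cb_Suc[of k] by (simp add: N_def n_def algebra_simps)
    moreover have "N > 0" "N - 1 = 2 * (real k + 1)" by (simp_all add: N_def n_def)
    ultimately show ?thesis
      by (simp add: divide_simps power2_eq_square) (simp add: algebra_simps)
  qed
  moreover have "n + 2 = 2 * Suc k + 1" by (simp add: n_def)
  ultimately show ?case by (simp only:)
qed

text \<open>Two integrations by parts give \<open>N\<^sup>2 * J' = N * (N - 1) * J - 2 * W\<close>
  with \<open>N = 2 * k + 3\<close> and the Wallis integral \<open>W\<close>. Dividing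
  \<open>J\<close> by \<open>(k + 1) * cb (Suc k)\<close> turns this into
  \<open>Q' = Q - 1 / N\<^sup>2\<close>, so \<open>Q\<close> is a tail of the sum
  \<open>pi\<^sup>2 / 8\<close> of the reciprocal odd squares.\<close>

lemma has_integral_square_sin_odd_power:
  "((\<lambda>t. (pi/2 - t)\<^sup>2 * sin t ^ (2 * k + 1)) has_integral
      (real k + 1) * cb (Suc k) * (pi\<^sup>2 / 8 - odd_harm 2 (Suc k))) {0<..<pi/2}"
proof (induction k)
  case 0
  define F where "F t = - ((pi/2 - t)\<^sup>2 * cos t) - 2 * (pi/2 - t) * sin t + 2 * cos t" for t :: real
  have "((\<lambda>t. (pi/2 - t)\<^sup>2 * sin t) has_integral (F (pi/2) - F 0)) {0<..<pi/2}"
    unfolding F_def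
    by (rule has_integral_FTC_continuous) (auto intro!: derivative_eq_intros continuous_intros simp: algebra_simps)
  moreover have "F (pi/2) - F 0 = pi\<^sup>2 / 4 - 2"
    by (simp add: F_def power_divide)
  ultimately show ?case by (simp add: cb_1 odd_harm_def)
next
  case (Suc k)
  define n where "n = 2 * k + 1"
  define N where "N = real n + 2"
  \<comment> \<open>With \<open>u = pi/2 - t\<close> this is
    \<open>u\<^sup>2 * (sin ^ N)' + 2 * u * sin ^ N\<close>: the mixed terms cancel in the
    derivative, and both boundary values are 0.\<close>
  define F where "F t = (pi/2 - t)\<^sup>2 * (N * sin t ^ (n + 1) * cos t) + 2 * (pi/2 - t) * sin t ^ (n + 2)" for t :: real
  have "((\<lambda>t. (pi/2 - t)\<^sup>2 * (N * (N - 1) * sin t ^ n - N\<^sup>2 * sin t ^ (n + 2)) - 2 * sin t ^ (n + 2))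
      has_integral (F (pi/2) - F 0)) {0<..<pi/2}"
  proof (rule has_integral_FTC_continuous)
    show "continuous_on {0..pi/2} F"
      unfolding F_def by (intro continuous_intros)
    fix t :: real
    let ?D = "(- 2 * (pi/2 - t)) * (N * sin t ^ (n + 1) * cos t)
        + (pi/2 - t)\<^sup>2 * (N * ((real (n + 1) * sin t ^ n * cos t) * cos t + sin t ^ (n + 1) * (- sin t)))
        + (- 2 * sin t ^ (n + 2) + 2 * (pi/2 - t) * (real (n + 2) * sin t ^ (n + 1) * cos t))"
    have "(F has_real_derivative
        ?D) (at t)"
      unfolding F_def by (rule derivative_eq_intros refl)+ (simp add: algebra_simps)
    also have "?D
      = (pi/2 - t)\<^sup>2 * (N * (real (n + 1) * sin t ^ n * (cos t)\<^sup>2 - sin t ^ (n + 1) * sin t)) - 2 * sin t ^ (n + 2)"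
      by (simp add: N_def algebra_simps power2_eq_square)
    also have "real (n + 1) * sin t ^ n * (cos t)\<^sup>2 - sin t ^ (n + 1) * sin t = (N - 1) * sin t ^ n - N * sin t ^ (n + 2)"
      unfolding cos_squared_eq by (simp add: N_def algebra_simps power2_eq_square)
    also have "N * ((N - 1) * sin t ^ n - N * sin t ^ (n + 2)) = N * (N - 1) * sin t ^ n - N\<^sup>2 * sin t ^ (n + 2)"
      by (simp add: algebra_simps power2_eq_square)
    finally show "(F has_real_derivative (pi/2 - t)\<^sup>2 * (N * (N - 1) * sin t ^ n - N\<^sup>2 * sin t ^ (n + 2)) - 2 * sin t ^ (n + 2)) (at t)" .
  qed simp
  moreover have "F (pi/2) - F 0 = 0" by (simp add: F_def)
  ultimately have 1: "((\<lambda>t. (pi/2 - t)\<^sup>2 * (N * (N - 1) * sin t ^ n - N\<^sup>2 * sin t ^ (n + 2)) - 2 * sin t ^ (n + 2))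
      has_integral 0) {0<..<pi/2}" by simp
  define J where "J = (real k + 1) * cb (Suc k) * (pi\<^sup>2 / 8 - odd_harm 2 (Suc k))"
  define W where "W = (real (Suc k) + 1) * cb (Suc (Suc k)) / 2"
  have W: "((\<lambda>t. sin t ^ (n + 2)) has_integral W) {0<..<pi/2}"
    using has_integral_sin_odd_power[of "Suc k"] by (simp add: n_def W_def)
  have J: "((\<lambda>t. (pi/2 - t)\<^sup>2 * sin t ^ n) has_integral J) {0<..<pi/2}"
    using Suc by (simp add: n_def J_def)
  have "N > 0" by (simp add: N_def)
  let ?f = "\<lambda>t. (N * (N - 1) * ((pi/2 - t)\<^sup>2 * sin t ^ n) - 2 * sin t ^ (n + 2)
            - ((pi/2 - t)\<^sup>2 * (N * (N - 1) * sin t ^ n - N\<^sup>2 * sin t ^ (n + 2)) - 2 * sin t ^ (n + 2))) / N\<^sup>2"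
  have "((\<lambda>t. ?f t)
      has_integral (N * (N - 1) * J - 2 * W - 0) / N\<^sup>2) {0<..<pi/2}"
    by (intro has_integral_divide has_integral_diff[OF has_integral_diff 1] has_integral_mult_right W J)
  note this[unfolded diff_0_right]
  then have "((\<lambda>t. (pi/2 - t)\<^sup>2 * sin t ^ (n + 2)) has_integral (N * (N - 1) * J - 2 * W) / N\<^sup>2) {0<..<pi/2}"
  proof (rule has_integral_eq[rotated])
    show "?f t
         = (pi/2 - t)\<^sup>2 * sin t ^ (n + 2)" for t
      using \<open>N > 0\<close> by (simp add: field_simps)
  qed
  moreover have "(N * (N - 1) * J - 2 * W) / N\<^sup>2
      = (real (Suc k) + 1) * cb (Suc (Suc k)) * (pi\<^sup>2 / 8 - odd_harm 2 (Suc (Suc k)))"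
  proof -
    define c where "c = (real (Suc k) + 1) * cb (Suc (Suc k))"
    define Q where "Q = pi\<^sup>2 / 8 - odd_harm 2 (Suc k)"
    have Q: "pi\<^sup>2 / 8 - odd_harm 2 (Suc (Suc k)) = Q - 1 / N\<^sup>2"
      by (simp add: odd_harm_Suc[of 2 "Suc k"] Q_def N_def n_def add.commute)
    have "(N - 1) * ((real k + 1) * cb (Suc k)) = c * N"
      using cb_Suc[of k] by (simp add: N_def n_def c_def algebra_simps power2_eq_square)
    then have "N * (N - 1) * J = N * (c * N) * Q"
      unfolding J_def Q_def[symmetric] by (simp add: mult.assoc)
    moreover have W2: "2 * W = c" by (simp add: W_def c_def)
    ultimately show ?thesis
      unfolding Q c_def[symmetric] using \<open>N > 0\<close>
      by (simp add: W2 field_simps power2_eq_square)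
  qed
  moreover have "n + 2 = 2 * Suc k + 1" by (simp add: n_def)
  ultimately show ?case by (simp only:)
qed

text \<open>Divided by \<open>k + 1\<close>, the preceding moments are \<open>cb\<close> times a
  tail of the odd squares, and the expansion of \<open>ln (1 - sin\<^sup>2 t)\<close> sums
  \<open>sin t ^ (2 * k + 1) / (k + 1)\<close> to \<open>- 2 * ln (cos t) / sin t\<close>. The total
  \<open>pi\<^sup>2 / 2\<close> of the weights then turns tails into partial sums.\<close>

lemma cb_odd_harm_sums:
  assumes K: "((\<lambda>t. (pi/2 - t)\<^sup>2 * (ln (cos t) / sin t)) has_integral K) {0<..<pi/2}"
  shows "(\<lambda>k. cb (Suc k) * odd_harm 2 (Suc k)) sums (pi ^ 4 / 16 + 2 * K)"
proof -
  have "(\<lambda>k. cb (Suc k) * (pi\<^sup>2 / 8 - odd_harm 2 (Suc k))) sums (- 2 * K)"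
  proof (rule sums_integral_nonneg)
    show "((\<lambda>t. 1 / (real k + 1) * ((pi/2 - t)\<^sup>2 * sin t ^ (2 * k + 1))) has_integral
        cb (Suc k) * (pi\<^sup>2 / 8 - odd_harm 2 (Suc k))) {0<..<pi/2}" for k
      using has_integral_mult_right[OF has_integral_square_sin_odd_power[of k], of "1 / (real k + 1)"] by simp
    show "0 \<le> 1 / (real k + 1) * ((pi/2 - t)\<^sup>2 * sin t ^ (2 * k + 1))" if "t \<in> {0<..<pi/2}" for k t
      using that by (intro mult_nonneg_nonneg zero_le_power sin_ge_zero) auto
    show "((\<lambda>t. - 2 * ((pi/2 - t)\<^sup>2 * (ln (cos t) / sin t))) has_integral - 2 * K) {0<..<pi/2}"
      by (intro has_integral_mult_right K)
    show "(\<lambda>k. 1 / (real k + 1) * ((pi/2 - t)\<^sup>2 * sin t ^ (2 * k + 1))) sums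
        (- 2 * ((pi/2 - t)\<^sup>2 * (ln (cos t) / sin t)))" if t: "t \<in> {0<..<pi/2}" for t
    proof -
      have s: "0 < sin t" "0 < cos t"
        using t by (auto intro!: sin_gt_zero cos_gt_zero)
      have "(sin t)\<^sup>2 < 1"
        using s sin_cos_squared_add[of t] zero_less_power[OF s(2), of 2] by linarith
      then have "(\<lambda>n. - ((- (- (sin t)\<^sup>2)) ^ n) / of_nat n) sums ln (1 + - (sin t)\<^sup>2)"
        by (intro ln_series') simp
      then have "(\<lambda>n. - (((sin t)\<^sup>2) ^ Suc n) / of_nat (Suc n)) sums ln (1 - (sin t)\<^sup>2)"
        by (subst sums_Suc_iff) simp
      moreover have "ln (1 - (sin t)\<^sup>2) = 2 * ln (cos t)"
        using s by (simp add: cos_squared_eq[symmetric] ln_realpow)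
      ultimately have "(\<lambda>n. - (((sin t)\<^sup>2) ^ Suc n) / of_nat (Suc n)) sums (2 * ln (cos t))"
        by simp
      from sums_mult[OF this, of "- ((pi/2 - t)\<^sup>2 / sin t)"]
      have "(\<lambda>n. - ((pi/2 - t)\<^sup>2 / sin t) * (- (((sin t)\<^sup>2) ^ Suc n) / of_nat (Suc n))) sums
          (- 2 * ((pi/2 - t)\<^sup>2 * (ln (cos t) / sin t)))"
        by (simp add: field_simps)
      moreover have "- ((pi/2 - t)\<^sup>2 / sin t) * (- (((sin t)\<^sup>2) ^ Suc n) / of_nat (Suc n))
          = 1 / (real n + 1) * ((pi/2 - t)\<^sup>2 * sin t ^ (2 * n + 1))" for n
      proof -
        have "((sin t)\<^sup>2) ^ Suc n = sin t * sin t ^ (2 * n + 1)"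
          by (simp add: power_mult power2_eq_square)
        then show ?thesis using s by (simp add: add.commute)
      qed
      ultimately show ?thesis by simp
    qed
  qed
  from sums_diff[OF sums_mult[OF cb_sums, of "pi\<^sup>2 / 8"] this]
  have "(\<lambda>k. cb (Suc k) * odd_harm 2 (Suc k)) sums (pi\<^sup>2 / 8 * (pi\<^sup>2 / 2) - - 2 * K)"
    by (simp add: algebra_simps)
  moreover have "pi\<^sup>2 / 8 * (pi\<^sup>2 / 2) - - 2 * K = pi ^ 4 / 16 + 2 * K"
    by (simp add: power2_eq_square power4_eq_xxxx)
  ultimately show ?thesis by simp
qed

lemma gen_harm_2_le: "gen_harm 2 k \<le> 2"
proof -
  have "gen_harm 2 (Suc k) \<le> 2 - 1 / (real k + 1)" for k
  proof (induction k)
    case (Suc k)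
    have "1 / (real (Suc k) + 1) ^ 2 \<le> 1 / (real k + 1) - 1 / (real (Suc k) + 1)"
      by (simp add: divide_simps power2_eq_square)
    then show ?case using Suc gen_harm_Suc[of 2 "Suc k"] by linarith
  qed (simp add: gen_harm_def)
  note * = this
  show ?thesis
  proof (cases k)
    case (Suc j)
    have "1 / (real j + 1) \<ge> 0" by simp
    then show ?thesis using *[of j] unfolding Suc by linarith
  qed (simp add: gen_harm_def)
qed

text \<open>Summation by parts replaces \<open>gen_harm 2 k\<close> by the tails of the sum of
  \<open>cb\<close>, each divided by \<open>(k + 1)\<^sup>2\<close>. A tail equals
  \<open>4 * (k + 1)\<^sup>2 * cb (Suc k) * N (Suc k)\<close>, so the squares cancel and the arcsine
  series can be summed under the integral. The index is \<open>k\<close> rather than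
  \<open>Suc k\<close>: the diagonal term \<open>cb (Suc k) / (k + 1)\<^sup>2\<close> is the part
  evaluated separately through \<open>ln\<^sup>2 (sin t)\<close>.\<close>

lemma cb_gen_harm_sums: "(\<lambda>k. cb (Suc k) * gen_harm 2 k) sums (pi ^ 4 / 24)"
proof -
  define S where "S n = (\<Sum>k<n. cb (Suc k))" for n
  define N where "N k = integral {0<..<pi/2} (\<lambda>t. (pi/2 - t) * sin t ^ (2 * k))" for k
  have N: "((\<lambda>t. (pi/2 - t) * sin t ^ (2 * k)) has_integral N k) {0<..<pi/2}" for k
  proof -
    have "(\<lambda>t. (pi/2 - t) * sin t ^ (2 * k)) integrable_on {0..pi/2}"
      by (intro integrable_continuous_real continuous_intros)
    then show ?thesis
      by (simp add: N_def integrable_on_Icc_iff_Ioo integrable_integral)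
  qed
  have N0: "N 0 = pi\<^sup>2 / 8"
  proof -
    have "((\<lambda>t. pi/2 - t) has_integral ((pi/2 * (pi/2) - (pi/2)\<^sup>2 / 2) - (pi/2 * 0 - 0\<^sup>2 / 2))) {0<..<pi/2}"
      by (rule has_integral_FTC_continuous) (auto intro!: derivative_eq_intros continuous_intros)
    then show ?thesis
      using N[of 0] by (auto dest: has_integral_unique simp: power2_eq_square)
  qed
  have step: "2 * (real k + 1) * (2 * real k + 1) * N k - 4 * (real k + 1)\<^sup>2 * N (Suc k) = 1" for k
  proof -
    \<comment> \<open>This is \<open>(pi/2 - t) * (sin ^ (2 * k + 2))' + sin ^ (2 * k + 2)\<close>,
      with boundary values 0 and 1; the 1 is the right-hand side of the recurrence and makes the
      tails appear.\<close>
    define F where "F t = (pi/2 - t) * (2 * (real k + 1) * (sin t ^ (2 * k + 1) * cos t)) + sin t ^ (2 * k + 2)" for t :: real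
    have "((\<lambda>t. 2 * (real k + 1) * (2 * real k + 1) * ((pi/2 - t) * sin t ^ (2 * k))
             - 4 * (real k + 1)\<^sup>2 * ((pi/2 - t) * sin t ^ (2 * k + 2))) has_integral (F (pi/2) - F 0)) {0<..<pi/2}"
    proof (rule has_integral_FTC_continuous)
      show "continuous_on {0..pi/2} F" unfolding F_def by (intro continuous_intros)
      fix t :: real
      let ?D = "- (2 * (real k + 1) * (sin t ^ (2 * k + 1) * cos t))
          + (pi/2 - t) * (2 * (real k + 1) * ((2 * real k + 1) * sin t ^ (2 * k) * cos t * cos t - sin t ^ (2 * k + 1) * sin t))
          + real (2 * k + 2) * sin t ^ (2 * k + 1) * cos t"
      have "(F has_real_derivative ?D) (at t)"
        unfolding F_def by (rule derivative_eq_intros refl)+ (simp add: algebra_simps)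
      also have "?D
        = (pi/2 - t) * (2 * (real k + 1) * ((2 * real k + 1) * sin t ^ (2 * k) * (cos t)\<^sup>2 - sin t ^ (2 * k + 1) * sin t))"
        by (simp add: algebra_simps power2_eq_square)
      also have "\<dots> = 2 * (real k + 1) * (2 * real k + 1) * ((pi/2 - t) * sin t ^ (2 * k))
             - 4 * (real k + 1)\<^sup>2 * ((pi/2 - t) * sin t ^ (2 * k + 2))"
        unfolding cos_squared_eq by (simp add: algebra_simps power2_eq_square)
      finally show "(F has_real_derivative 2 * (real k + 1) * (2 * real k + 1) * ((pi/2 - t) * sin t ^ (2 * k))
             - 4 * (real k + 1)\<^sup>2 * ((pi/2 - t) * sin t ^ (2 * k + 2))) (at t)" .
    qed simp
    moreover have "((\<lambda>t. 2 * (real k + 1) * (2 * real k + 1) * ((pi/2 - t) * sin t ^ (2 * k))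
             - 4 * (real k + 1)\<^sup>2 * ((pi/2 - t) * sin t ^ (2 * Suc k))) has_integral
        2 * (real k + 1) * (2 * real k + 1) * N k - 4 * (real k + 1)\<^sup>2 * N (Suc k)) {0<..<pi/2}"
      by (intro has_integral_diff has_integral_mult_right N)
    moreover have "F (pi/2) - F 0 = 1" by (simp add: F_def)
    ultimately show ?thesis by (auto dest: has_integral_unique)
  qed
  have tail: "4 * (real k + 1)\<^sup>2 * cb (Suc k) * N (Suc k) = pi\<^sup>2 / 2 - S (Suc k)" for k
  proof (induction k)
    case 0
    then show ?case using step[of 0] by (simp add: N0 cb_1 S_def)
  next
    case (Suc k)
    have "cb (Suc (Suc k)) * ((2 * real k + 4) * (2 * real k + 3)) * N (Suc k)
        - 4 * (real (Suc k) + 1)\<^sup>2 * cb (Suc (Suc k)) * N (Suc (Suc k)) = cb (Suc (Suc k))"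
      using arg_cong[OF step[of "Suc k"], of "\<lambda>x. cb (Suc (Suc k)) * x"] by (simp add: algebra_simps)
    moreover have "S (Suc (Suc k)) = S (Suc k) + cb (Suc (Suc k))"
      by (simp add: S_def)
    ultimately show ?case using Suc unfolding cb_Suc by linarith
  qed
  have "(\<lambda>k. 4 * (cb (Suc k) * N (Suc k))) sums (pi ^ 4 / 24)"
  proof (rule sums_integral_nonneg)
    show "((\<lambda>t. 4 * (cb (Suc k) * ((pi/2 - t) * sin t ^ (2 * Suc k)))) has_integral 4 * (cb (Suc k) * N (Suc k))) {0<..<pi/2}" for k
      by (intro has_integral_mult_right N)
    show "0 \<le> 4 * (cb (Suc k) * ((pi/2 - t) * sin t ^ (2 * Suc k)))" if "t \<in> {0<..<pi/2}" for k t
      using that cb_pos[of k] by (auto intro!: mult_nonneg_nonneg zero_le_power sin_ge_zero)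
    show "(\<lambda>k. 4 * (cb (Suc k) * ((pi/2 - t) * sin t ^ (2 * Suc k)))) sums (4 * (pi/2 - t) * (2 * t\<^sup>2))"
      if "t \<in> {0<..<pi/2}" for t
    proof -
      define u where "u = pi/2 - t"
      show ?thesis
        using sums_mult[OF arcsin_series[of t], of "4 * u"] that
        unfolding u_def[symmetric] by (simp add: mult_ac)
    qed
    have "((\<lambda>t. 4 * (pi/2 - t) * (2 * t\<^sup>2)) has_integral ((4 * pi * (pi/2) ^ 3 / 3 - 2 * (pi/2) ^ 4) - (4 * pi * 0 ^ 3 / 3 - 2 * 0 ^ 4))) {0<..<pi/2}"
      by (rule has_integral_FTC_continuous)
         (auto intro!: derivative_eq_intros continuous_intros simp: algebra_simps power2_eq_square power3_eq_cube)
    moreover have "(4 * pi * (pi/2) ^ 3 / 3 - 2 * (pi/2) ^ 4) - (4 * pi * 0 ^ 3 / 3 - 2 * 0 ^ 4) = pi ^ 4 / 24"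
      by (simp add: power_divide power3_eq_cube power4_eq_xxxx)
    ultimately show "((\<lambda>t. 4 * (pi/2 - t) * (2 * t\<^sup>2)) has_integral pi ^ 4 / 24) {0<..<pi/2}" by (simp only:)
  qed
  then have lim1: "(\<lambda>n. \<Sum>k<n. 4 * (cb (Suc k) * N (Suc k))) \<longlonglongrightarrow> pi ^ 4 / 24"
    by (simp add: sums_def)
  have partial: "(\<Sum>k<n. cb (Suc k) * gen_harm 2 k) = (\<Sum>k<n. 4 * (cb (Suc k) * N (Suc k))) - gen_harm 2 n * (pi\<^sup>2 / 2 - S n)" for n
  proof (induction n)
    case (Suc n)
    have "4 * (cb (Suc n) * N (Suc n)) = (pi\<^sup>2 / 2 - S (Suc n)) / (real n + 1)\<^sup>2"
      unfolding tail[symmetric] by simp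
    moreover have "S (Suc n) = S n + cb (Suc n)" by (simp add: S_def)
    ultimately show ?case
      using Suc gen_harm_Suc[of 2 n] by (simp add: algebra_simps diff_divide_distrib add_divide_distrib)
  qed (simp add: gen_harm_def)
  \<comment> \<open>The boundary term of the summation by parts: a bounded factor times a tail of a
    convergent series.\<close>
  have "(\<lambda>n. gen_harm 2 n * (pi\<^sup>2 / 2 - S n)) \<longlonglongrightarrow> 0"
  proof (rule Lim_null_comparison)
    show "(\<lambda>n. 2 * \<bar>pi\<^sup>2 / 2 - S n\<bar>) \<longlonglongrightarrow> 0"
      using cb_sums unfolding sums_def S_def by (auto intro!: tendsto_eq_intros)
    have "0 \<le> gen_harm 2 n" for n by (simp add: gen_harm_def sum_nonneg)
    then show "\<forall>\<^sub>F n in sequentially. norm (gen_harm 2 n * (pi\<^sup>2 / 2 - S n)) \<le> 2 * \<bar>pi\<^sup>2 / 2 - S n\<bar>"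
      using gen_harm_2_le by (auto simp: abs_mult intro!: always_eventually mult_right_mono)
  qed
  from tendsto_diff[OF lim1 this] show ?thesis
    unfolding sums_def partial by simp
qed

subsection \<open>Logarithms on the unit circle\<close>

text \<open>From \<open>y * cos y \<le> sin y\<close> with \<open>y = x / 2\<close>: \<open>sin x =
  2 * sin y * cos y \<ge> 2 * y * cos\<^sup>2 y = y * (1 + cos x) \<ge> y\<close>.\<close>

lemma sin_ge_half:
  assumes "0 \<le> x" "x \<le> pi / 2"
  shows "x / 2 \<le> sin x"
proof -
  define y where "y = x / 2"
  have y: "0 \<le> y" "y \<le> pi / 4" using assms by (auto simp: y_def)
  have "sin 0 - 0 * cos 0 \<le> sin y - y * cos y"
  proof (rule DERIV_nonneg_imp_nondecreasing[OF y(1)])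
    fix t assume t: "0 \<le> t" "t \<le> y"
    have "((\<lambda>t. sin t - t * cos t) has_real_derivative t * sin t) (at t)"
      by (auto intro!: derivative_eq_intros)
    moreover have "0 \<le> t * sin t"
      using t y pi_gt_zero by (intro mult_nonneg_nonneg sin_ge_zero) linarith+
    ultimately show "\<exists>d. ((\<lambda>t. sin t - t * cos t) has_real_derivative d) (at t) \<and> 0 \<le> d" by blast
  qed
  moreover have "0 \<le> cos y" using y pi_gt_zero by (intro cos_ge_zero) linarith+
  ultimately have "y * cos y * cos y \<le> sin y * cos y"
    by (intro mult_right_mono) auto
  moreover have "0 \<le> cos x" using assms by (intro cos_ge_zero) auto
  moreover have "cos x = 2 * (cos y * cos y) - 1"
    using cos_double_cos[of y] by (simp add: y_def power2_eq_square)
  moreover have "sin x = 2 * (sin y * cos y)"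
    using sin_double[of y] by (simp add: y_def)
  moreover have "y * (1 / 2) \<le> y * (cos y * cos y)"
    using calculation y by (intro mult_left_mono) auto
  ultimately show ?thesis by (simp add: y_def)
qed

text \<open>A lower bound uniform in \<open>r\<close>, as dominated convergence requires. Since
  \<open>1 - r\<close> is at most the norm of \<open>1 - r * cis t\<close>, the triangle inequality
  gives at least half the norm of \<open>1 - cis t\<close>, and that norm is
  \<open>2 * sin (t / 2) \<ge> t / 2\<close>.\<close>

lemma norm_one_minus_cis:
  assumes "0 < t" "t < pi" "0 \<le> r" "r \<le> 1"
  shows "t / 4 \<le> norm (1 - of_real r * cis t)" "norm (1 - of_real r * cis t) \<le> 2"
proof -
  have "cmod (1 - of_real r * cis t) \<le> cmod 1 + cmod (of_real r * cis t)"
    by (rule norm_triangle_ineq4)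
  then show "cmod (1 - of_real r * cis t) \<le> 2"
    using assms by (simp add: norm_mult)
  have "cis t - 1 = (cis t - of_real r * cis t) - (1 - of_real r * cis t)" by simp
  then have "cmod (cis t - 1) \<le> cmod (cis t - of_real r * cis t) + cmod (1 - of_real r * cis t)"
    using norm_triangle_ineq4 by metis
  moreover have "cmod (cis t - of_real r * cis t) = 1 - r"
  proof -
    have "cis t - of_real r * cis t = of_real (1 - r) * cis t" by (simp add: algebra_simps)
    then show ?thesis using assms by (simp add: norm_mult del: of_real_diff)
  qed
  moreover have "1 - r \<le> cmod (1 - of_real r * cis t)"
    using norm_triangle_ineq2[of 1 "of_real r * cis t"] assms by (simp add: norm_mult)
  moreover have "cmod (cis t - 1) = 2 * sin (t / 2)"
  proof -
    have "(cmod (cis t - 1))\<^sup>2 = (2 * sin (t / 2))\<^sup>2"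
    proof -
      have "(cmod (cis t - 1))\<^sup>2 = (cos t - 1)\<^sup>2 + (sin t)\<^sup>2"
        by (simp add: cmod_power2)
      also have "\<dots> = 2 - 2 * cos t"
        unfolding sin_squared_eq by (simp add: power2_eq_square algebra_simps)
      finally show ?thesis
        using cos_double_sin[of "t / 2"] by (simp add: power_mult_distrib)
    qed
    moreover have "0 \<le> sin (t / 2)" using assms by (intro sin_ge_zero) auto
    ultimately show ?thesis using power2_eq_imp_eq[of "cmod (cis t - 1)" "2 * sin (t / 2)"] by simp
  qed
  ultimately show "t / 4 \<le> cmod (1 - of_real r * cis t)"
    using sin_ge_half[of "t / 2"] assms by simp
qed

lemma norm_Ln_bound:
  assumes "0 < a" "a \<le> 2" "a / 4 \<le> norm w" "norm w \<le> 2"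
  shows "norm (Ln w) \<le> 3 + pi - ln a"
proof -
  have "w \<noteq> 0" using assms by auto
  have ln2: "ln 2 < (1::real)"
    using ln_2_less_1 by simp
  have "ln (cmod w) \<le> ln 2"
    using assms \<open>w \<noteq> 0\<close> by simp
  moreover have "ln (a / 4) \<le> ln (cmod w)"
    using assms by (intro ln_mono) auto
  moreover have "ln (a / 4) = ln a - 2 * ln 2"
    using assms ln_realpow[of 2 2] by (simp add: ln_div)
  moreover have "ln a \<le> ln 2"
    using assms by simp
  ultimately have "\<bar>ln (cmod w)\<bar> \<le> 3 - ln a"
    using ln2 by linarith
  moreover have "\<bar>Im (Ln w)\<bar> \<le> pi"
    using mpi_less_Im_Ln[OF \<open>w \<noteq> 0\<close>] Im_Ln_le_pi[OF \<open>w \<noteq> 0\<close>] by linarith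
  moreover have "Re (Ln w) = ln (cmod w)"
    using \<open>w \<noteq> 0\<close> by simp
  ultimately show ?thesis
    using cmod_le[of "Ln w"] by linarith
qed

lemma Ln_one_minus_cis_bound:
  assumes "0 < t" "t < pi" "0 \<le> r" "r \<le> 1"
  shows "norm (Ln (1 - of_real r * cis t)) \<le> 5 + pi - ln t"
proof -
  \<comment> \<open>The general bound is applied with \<open>a = t / 2\<close>, because
    \<open>t\<close> itself may exceed 2.\<close>
  have "cmod (Ln (1 - of_real r * cis t)) \<le> 3 + pi - ln (t / 2)"
    using norm_one_minus_cis[OF assms] assms pi_less_4
    by (intro norm_Ln_bound) auto
  moreover have "ln (t / 2) = ln t - ln 2" using assms by (simp add: ln_div)
  ultimately show ?thesis using ln_2_less_1 by linarith
qed

text \<open>Allows the integrable majorant \<open>(C - ln t)\<^sup>2\<close> to serve also where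
  only a first power of the logarithm occurs.\<close>

lemma minus_ln_le_square:
  assumes "0 < x" "x < pi"
  shows "1 \<le> 6 + pi - ln x" "6 + pi - ln x \<le> (6 + pi - ln x)\<^sup>2"
proof -
  have "ln x \<le> ln 4" using assms pi_less_4 by simp
  moreover have "ln 4 < (2::real)" using ln_2_less_1 ln_realpow[of 2 2] by simp
  ultimately show 1: "1 \<le> 6 + pi - ln x" using pi_gt_zero by linarith
  have "(6 + pi - ln x) * 1 \<le> (6 + pi - ln x) * (6 + pi - ln x)"
    using 1 by (intro mult_left_mono) auto
  then show "6 + pi - ln x \<le> (6 + pi - ln x)\<^sup>2"
    by (simp add: power2_eq_square)
qed

lemma Ln_of_real_times_cis:
  assumes "0 < r" "- pi < t" "t \<le> pi"
  shows "Ln (of_real r * cis t) = of_real (ln r) + \<i> * of_real t"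
proof (rule Ln_unique)
  show "exp (of_real (ln r) + \<i> * of_real t) = of_real r * cis t"
    using assms by (simp add: exp_add cis_conv_exp exp_of_real[symmetric] del: exp_of_real)
      (simp add: exp_of_real)
qed (use assms in auto)

text \<open>Half-angle polar form. For \<open>0 < t < 2 * pi\<close> the modulus is positive and the
  angle lies strictly between \<open>- pi / 2\<close> and \<open>pi / 2\<close>, so the principal
  logarithm can be read off.\<close>

lemma one_minus_cis_eq: "1 - cis t = of_real (2 * sin (t / 2)) * cis ((t - pi) / 2)"
proof -
  have "cos t = 1 - 2 * (sin (t/2) * sin (t/2))" "sin t = 2 * (sin (t/2) * cos (t/2))"
    using cos_double_sin[of "t/2"] sin_double[of "t/2"] by (simp_all add: power2_eq_square)
  moreover have "cos ((t - pi) / 2) = sin (t / 2)" "sin ((t - pi) / 2) = - cos (t / 2)"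
    by (simp_all add: diff_divide_distrib cos_diff sin_diff)
  ultimately show ?thesis by (simp add: complex_eq_iff)
qed

lemma one_plus_cis_eq: "1 + cis t = of_real (2 * cos (t / 2)) * cis (t / 2)"
proof -
  have "cos t = 2 * (cos (t/2) * cos (t/2)) - 1" "sin t = 2 * (sin (t/2) * cos (t/2))"
    using cos_double_cos[of "t/2"] sin_double[of "t/2"] by (simp_all add: power2_eq_square)
  then show ?thesis by (simp add: complex_eq_iff)
qed

lemma Ln_one_minus_cis:
  assumes "0 < t" "t < 2 * pi"
  shows "Ln (1 - cis t) = of_real (ln (2 * sin (t / 2))) + \<i> * of_real ((t - pi) / 2)"
  unfolding one_minus_cis_eq using assms
  by (intro Ln_of_real_times_cis) (auto intro!: sin_gt_zero)

lemma Ln_one_plus_cis: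
  assumes "- pi < t" "t < pi"
  shows "Ln (1 + cis t) = of_real (ln (2 * cos (t / 2))) + \<i> * of_real (t / 2)"
  unfolding one_plus_cis_eq using assms
  by (intro Ln_of_real_times_cis) (auto intro!: cos_gt_zero_pi)

lemma one_minus_cis_not_nonpos:
  assumes "0 < t" "t < 2 * pi"
  shows "1 - cis t \<notin> \<real>\<^sub>\<le>\<^sub>0"
proof -
  have "0 < sin (t / 2)" using assms by (intro sin_gt_zero) auto
  then have "cos t < 1" using cos_double_sin[of "t / 2"] by simp
  then show ?thesis by (auto simp: complex_nonpos_Reals_iff)
qed

lemma one_plus_cis_not_nonpos:
  assumes "- pi < t" "t < pi"
  shows "1 + cis t \<notin> \<real>\<^sub>\<le>\<^sub>0"
proof -
  have "0 < cos (t / 2)" using assms by (intro cos_gt_zero_pi) auto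
  then have "0 < 1 + cos t" using cos_double_cos[of "t / 2"] by simp
  then show ?thesis by (auto simp: complex_nonpos_Reals_iff)
qed

lemma integrable_minus_ln_square:
  assumes "0 < \<alpha>"
  shows "(\<lambda>x::real. (C - ln x)\<^sup>2) integrable_on {0<..<\<alpha>}"
proof -
  define F where "F x = x * (C - ln x)\<^sup>2 + 2 * x * (C - ln x) + 2 * x" for x :: real
  have "((\<lambda>x. (C - ln x)\<^sup>2) has_integral (F \<alpha> - 0)) {0<..<\<alpha>}"
  proof (rule has_integral_FTC_limits[OF assms])
    show "(F \<longlongrightarrow> 0) (at_right 0)" unfolding F_def by real_asymp
    show "(F \<longlongrightarrow> F \<alpha>) (at_left \<alpha>)" unfolding F_def using assms by (intro tendsto_intros) auto
    show "(F has_real_derivative (C - ln x)\<^sup>2) (at x)" if "0 < x" for x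
      unfolding F_def using that
      by (auto intro!: derivative_eq_intros simp: field_simps power2_eq_square)
  qed
  then show ?thesis by blast
qed

section \<open>Power series of squared logarithms\<close>

lemma Ln_one_minus_sums:
  fixes z :: complex
  assumes "norm z < 1"
  shows "(\<lambda>n. z ^ n / of_nat n) sums (- Ln (1 - z))"
  using sums_minus[OF Ln_series'[of "- z"]] assms by simp

text \<open>Cauchy square of \<open>\<Sum>\<^sub>i \<xi>\<^sub>i z\<^sup>i / i\<close>; the terms with index 0 vanish because \<open>x / 0 = 0\<close>.\<close>

lemma square_log_series:
  fixes z :: complex and \<xi> :: "nat \<Rightarrow> real"
  assumes z: "norm z < 1" and \<xi>: "\<And>n. \<bar>\<xi> n\<bar> \<le> B" and s: "(\<lambda>n. of_real (\<xi> n / real n) * z ^ n) sums s"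
  shows "(\<lambda>n. of_real (2 / real n * (\<Sum>i=1..<n. \<xi> i * \<xi> (n - i) / real i)) * z ^ n) sums s\<^sup>2"
proof -
  let ?c = "\<lambda>i n. (of_real (\<xi> i / real i) * z ^ i) * (of_real (\<xi> (n - i) / real (n - i)) * z ^ (n - i))"
  have "summable (\<lambda>n. norm (of_real (\<xi> n / real n) * z ^ n))"
  proof (rule summable_comparison_test')
    show "summable (\<lambda>n. B * norm z ^ n)"
      using z by (intro summable_mult summable_geometric) auto
    have "\<bar>\<xi> n / real n\<bar> \<le> B" for n
    proof (cases "n = 0")
      case False
      then have "\<bar>\<xi> n\<bar> \<le> B * real n"
        using \<xi>[of n] order_trans[OF abs_ge_zero \<xi>[of n]] mult_left_mono[of 1 "real n" B] by simp
      then show ?thesis using False by (simp add: field_simps)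
    qed (use order_trans[OF abs_ge_zero \<xi>[of 0]] in simp)
    then have "\<bar>\<xi> n / real n\<bar> * norm z ^ n \<le> B * norm z ^ n" for n
      by (intro mult_right_mono) auto
    then show "norm (norm (of_real (\<xi> n / real n) * z ^ n)) \<le> B * norm z ^ n" for n
      by (simp only: norm_mult norm_power norm_of_real abs_mult abs_norm_cancel real_norm_def abs_idempotent power_abs)
  qed
  from Cauchy_product_sums[OF this this]
  have "(\<lambda>n. \<Sum>i\<le>n. ?c i n) sums s\<^sup>2"
    using s by (simp add: sums_iff power2_eq_square)
  moreover have "(\<Sum>i\<le>n. ?c i n)
      = of_real (2 / real n * (\<Sum>i=1..<n. \<xi> i * \<xi> (n - i) / real i)) * z ^ n" for n
  proof -
    have "(\<Sum>i\<le>n. ?c i n)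
       = (\<Sum>i\<le>n. of_real (\<xi> i / real i * (\<xi> (n - i) / real (n - i))) * z ^ n)"
    proof (rule sum.cong)
      fix i assume "i \<in> {..n}"
      then have "z ^ n = z ^ i * z ^ (n - i)" by (simp add: power_add[symmetric])
      then show "?c i n
         = of_real (\<xi> i / real i * (\<xi> (n - i) / real (n - i))) * z ^ n" by simp
    qed simp
    also have "\<dots> = of_real (\<Sum>i\<le>n. \<xi> i / real i * (\<xi> (n - i) / real (n - i))) * z ^ n"
      by (simp add: sum_distrib_right)
    also have "(\<Sum>i\<le>n. \<xi> i / real i * (\<xi> (n - i) / real (n - i))) = (\<Sum>i=1..<n. \<xi> i / real i * (\<xi> (n - i) / real (n - i)))"
      by (rule sum.mono_neutral_right) auto
    \<comment> \<open>Partial fractions,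
      \<open>1 / (i * (n - i)) = (1 / i + 1 / (n - i)) / n\<close>; the reflection of
      \<open>i\<close> to \<open>n - i\<close> then identifies the two halves.\<close>
    also have "\<dots> = (\<Sum>i=1..<n. \<xi> i * \<xi> (n - i) / real i / real n + \<xi> i * \<xi> (n - i) / real (n - i) / real n)"
    proof (rule sum.cong)
      fix i assume "i \<in> {1..<n}"
      then have "real n = real i + real (n - i)" "real i > 0" "real (n - i) > 0" by auto
      then show "\<xi> i / real i * (\<xi> (n - i) / real (n - i)) = \<xi> i * \<xi> (n - i) / real i / real n + \<xi> i * \<xi> (n - i) / real (n - i) / real n"
        by (simp add: divide_simps) (simp add: algebra_simps)
    qed simp
    also have "\<dots> = (\<Sum>i=1..<n. \<xi> i * \<xi> (n - i) / real i / real n) + (\<Sum>i=1..<n. \<xi> i * \<xi> (n - i) / real (n - i) / real n)"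
      by (rule sum.distrib)
    also have "(\<Sum>i=1..<n. \<xi> i * \<xi> (n - i) / real (n - i) / real n) = (\<Sum>i=1..<n. \<xi> i * \<xi> (n - i) / real i / real n)"
      by (rule sum.reindex_bij_witness[of _ "\<lambda>i. n - i" "\<lambda>i. n - i"]) (auto simp: mult.commute)
    also have "(\<Sum>i=1..<n. \<xi> i * \<xi> (n - i) / real i / real n) + (\<Sum>i=1..<n. \<xi> i * \<xi> (n - i) / real i / real n)
       = 2 / real n * (\<Sum>i=1..<n. \<xi> i * \<xi> (n - i) / real i)"
      unfolding sum_divide_distrib[symmetric] by simp
    finally show ?thesis .
  qed
  ultimately show ?thesis by simp
qed

lemma Ln_one_minus_square_sums:
  assumes "norm (z :: complex) < 1"
  shows "(\<lambda>n. of_real (2 * harm (n - 1) / real n) * z ^ n) sums (Ln (1 - z))\<^sup>2"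
proof -
  have "(\<lambda>n. of_real (2 / real n * (\<Sum>i=1..<n. 1 * 1 / real i)) * z ^ n) sums (- Ln (1 - z))\<^sup>2"
    using Ln_one_minus_sums[OF assms] assms by (intro square_log_series[where B = 1]) (auto simp: field_simps)
  moreover have "2 / real n * (\<Sum>i=1..<n. 1 * 1 / real i) = 2 * harm (n - 1) / real n" for n
  proof -
    have "(\<Sum>i=1..<n. 1 * 1 / real i) = harm (n - 1)"
      unfolding harm_def by (rule sum.cong) (auto simp: inverse_eq_divide)
    then show ?thesis by simp
  qed
  ultimately show ?thesis by (simp only: power2_minus)
qed

lemma sum_odd_reciprocals: "(\<Sum>i=1..<2 * m. if odd i then 1 / real i else 0) = odd_harm 1 m"
proof (induction m)
  case (Suc m)
  have "{1..<2 * Suc m} = (if m = 0 then {1} else insert (2 * m) (insert (2 * m + 1) {1..<2 * m}))"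
    by auto
  then show ?case using Suc by (auto simp: odd_harm_Suc)
qed simp

text \<open>The function is \<open>(2 * artanh z)\<^sup>2\<close>. A product
  \<open>\<xi> i * \<xi> (n - i)\<close> is nonzero only if both indices are odd, so only even
  \<open>n\<close> survive and only odd reciprocals are summed.\<close>

lemma artanh_square_sums:
  assumes "norm (z :: complex) < 1"
  shows "(\<lambda>m. of_real (4 * odd_harm 1 m / real m) * z ^ (2 * m)) sums (Ln (1 - z) - Ln (1 + z))\<^sup>2"
proof -
  define \<xi> :: "nat \<Rightarrow> real" where "\<xi> n = (if odd n then 2 else 0)" for n
  define c where "c n = 2 / real n * (\<Sum>i=1..<n. \<xi> i * \<xi> (n - i) / real i)" for n
  have "(\<lambda>n. of_real (\<xi> n / real n) * z ^ n) sums (- (Ln (1 - z) - Ln (1 + z)))"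
  proof -
    have "(\<lambda>n. z ^ n / of_nat n - (- z) ^ n / of_nat n) sums (- Ln (1 - z) - (- Ln (1 - (- z))))"
      using assms by (intro sums_diff Ln_one_minus_sums) auto
    moreover have "of_real (\<xi> n / real n) * z ^ n = z ^ n / of_nat n - (- z) ^ n / of_nat n" for n
      by (auto simp: \<xi>_def)
    ultimately show ?thesis by simp
  qed
  then have "(\<lambda>n. of_real (c n) * z ^ n) sums (- (Ln (1 - z) - Ln (1 + z)))\<^sup>2"
    unfolding c_def using assms by (intro square_log_series[where B = 2]) (auto simp: \<xi>_def)
  moreover have "c n = 0" if "odd n" for n
    unfolding c_def using that by (auto simp: \<xi>_def intro!: sum.neutral)
  moreover have "c (2 * m) = 4 * odd_harm 1 m / real m" for m
  proof -
    have "(\<Sum>i=1..<2 * m. \<xi> i * \<xi> (2 * m - i) / real i) = (\<Sum>i=1..<2 * m. 4 * (if odd i then 1 / real i else 0))"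
      by (rule sum.cong) (auto simp: \<xi>_def)
    then show ?thesis
      unfolding c_def sum_distrib_left[symmetric] sum_odd_reciprocals by simp
  qed
  moreover have "(\<lambda>m. of_real (c (2 * m)) * z ^ (2 * m)) sums (- (Ln (1 - z) - Ln (1 + z)))\<^sup>2
     \<longleftrightarrow> (\<lambda>n. of_real (c n) * z ^ n) sums (- (Ln (1 - z) - Ln (1 + z)))\<^sup>2"
  proof (rule sums_mono_reindex[of "\<lambda>m. 2 * m"])
    show "of_real (c n) * z ^ n = 0" if "n \<notin> range (\<lambda>m. 2 * m)" for n
      using that \<open>\<And>n. odd n \<Longrightarrow> c n = 0\<close>[of n] by (auto elim!: evenE)
  qed (auto intro: strict_monoI)
  ultimately show ?thesis by (simp add: power2_commute)
qed

subsection \<open>Fourier evaluations\<close>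

text \<open>Sums indexed from 0 have a vanishing first term here, because \<open>1 / 0 = 0\<close>.\<close>

lemma zeta_nat_sums:
  assumes "2 \<le> k"
  shows "(\<lambda>n. 1 / real n ^ k) sums zeta_nat k"
proof -
  have "summable (\<lambda>n. 1 / real n ^ k)"
    using inverse_power_summable[of k, where 'a = real] assms by (simp add: inverse_eq_divide)
  then have "summable (\<lambda>n. 1 / real (Suc n) ^ k)"
    by (subst summable_Suc_iff)
  then have "(\<lambda>n. 1 / real (Suc n) ^ k) sums zeta_nat k"
    unfolding zeta_nat_def by (rule summable_sums)
  then show ?thesis
    using assms by (subst (asm) sums_Suc_iff) (simp add: power_0_left)
qed

lemma zeta_nat_Suc_sums:
  assumes "2 \<le> k"
  shows "(\<lambda>n. 1 / real (Suc n) ^ k) sums zeta_nat k"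
  using zeta_nat_sums[OF assms] assms by (subst sums_Suc_iff) (simp add: power_0_left)

lemma sums_even_terms:
  fixes a :: "nat \<Rightarrow> real"
  assumes "a sums s" "(\<lambda>n. (-1) ^ n * a n) sums t"
  shows "(\<lambda>m. a (2 * m)) sums ((s + t) / 2)"
proof -
  have "(\<lambda>n. (a n + (-1) ^ n * a n) / 2) sums ((s + t) / 2)"
    by (intro sums_divide sums_add assms)
  moreover have "(\<lambda>m. (a (2 * m) + (-1) ^ (2 * m) * a (2 * m)) / 2) sums ((s + t) / 2) \<longleftrightarrow>
      (\<lambda>n. (a n + (-1) ^ n * a n) / 2) sums ((s + t) / 2)"
  proof (rule sums_mono_reindex[of "\<lambda>m. 2 * m"])
    show "(a n + (-1) ^ n * a n) / 2 = 0" if "n \<notin> range (\<lambda>m. 2 * m)" for n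
    proof -
      have "odd n" using that by (auto elim!: evenE)
      then show ?thesis by simp
    qed
  qed (auto intro: strict_monoI)
  ultimately show ?thesis by simp
qed

lemma sums_cos_half_pi:
  fixes a :: "nat \<Rightarrow> real"
  assumes "(\<lambda>m. (-1) ^ m * a (2 * m)) sums s"
  shows "(\<lambda>n. cos (real n * (pi / 2)) * a n) sums s"
proof -
  have "(\<lambda>m. cos (real (2 * m) * (pi / 2)) * a (2 * m)) sums s \<longleftrightarrow> (\<lambda>n. cos (real n * (pi / 2)) * a n) sums s"
  proof (rule sums_mono_reindex[of "\<lambda>m. 2 * m"])
    show "cos (real n * (pi / 2)) * a n = 0" if "n \<notin> range (\<lambda>m. 2 * m)" for n
    proof -
      have "odd n" using that by (auto elim!: evenE)
      then have "cos (real n * (pi / 2)) = 0"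
        by (auto elim!: oddE simp: cos_zero_iff_int intro!: exI[of _ "int n"])
      then show ?thesis by simp
    qed
  qed (auto intro: strict_monoI)
  then show ?thesis using assms by simp
qed

lemma sums_sin_half_pi:
  fixes a :: "nat \<Rightarrow> real"
  assumes "(\<lambda>n. sin (real n * (pi / 2)) * a n) sums s"
  shows "(\<lambda>m. (-1) ^ m * a (2 * m + 1)) sums s"
proof -
  have "(\<lambda>m. sin (real (2 * m + 1) * (pi / 2)) * a (2 * m + 1)) sums s \<longleftrightarrow> (\<lambda>n. sin (real n * (pi / 2)) * a n) sums s"
  proof (rule sums_mono_reindex[of "\<lambda>m. 2 * m + 1"])
    show "sin (real n * (pi / 2)) * a n = 0" if "n \<notin> range (\<lambda>m. 2 * m + 1)" for n
    proof -
      have "even n" using that by (metis oddE rangeI)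
      then have "sin (real n * (pi / 2)) = 0"
        by (auto elim!: evenE)
      then show ?thesis by simp
    qed
  qed (auto intro: strict_monoI)
  moreover have "sin (real (2 * m + 1) * (pi / 2)) = (-1) ^ m" for m
  proof -
    have "real (2 * m + 1) * (pi / 2) = real m * pi + pi / 2"
      by (simp add: field_simps)
    then show ?thesis by (simp only: sin_add) simp
  qed
  ultimately show ?thesis using assms by simp
qed

text \<open>The even-indexed terms sum to \<open>(zeta + t) / 2\<close> by averaging with the
  alternating series and to \<open>zeta / 2 ^ k\<close> by scaling; comparing the two determines
  \<open>t\<close>. With the sign \<open>(-1) ^ n\<close> the value is negative.\<close>

lemma alternating_zeta_sums:
  assumes "2 \<le> k"
  shows "(\<lambda>n. (-1) ^ n / real n ^ k) sums ((2 / 2 ^ k - 1) * zeta_nat k)"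
proof -
  define t where "t = (\<Sum>n. (-1) ^ n * (1 / real n ^ k))"
  have "summable (\<lambda>n. (-1) ^ n * (1 / real n ^ k))"
    by (rule summable_rabs_cancel) (use zeta_nat_sums[OF assms] in \<open>simp add: abs_mult sums_iff\<close>)
  then have t: "(\<lambda>n. (-1) ^ n * (1 / real n ^ k)) sums t"
    unfolding t_def by (rule summable_sums)
  have "(\<lambda>m. 1 / real (2 * m) ^ k) sums ((zeta_nat k + t) / 2)"
    by (rule sums_even_terms[OF zeta_nat_sums[OF assms] t])
  moreover have "(\<lambda>m. 1 / real m ^ k / 2 ^ k) sums (zeta_nat k / 2 ^ k)"
    by (intro sums_divide zeta_nat_sums assms)
  then have "(\<lambda>m. 1 / real (2 * m) ^ k) sums (zeta_nat k / 2 ^ k)"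
    by (simp add: power_mult_distrib mult.commute)
  ultimately have "(zeta_nat k + t) / 2 = zeta_nat k / 2 ^ k"
    by (rule sums_unique2)
  then have "t = (2 / 2 ^ k - 1) * zeta_nat k"
    by (simp add: algebra_simps) 
  then show ?thesis using t by simp
qed

lemma cos_half_pi_zeta_sums:
  assumes "2 \<le> k"
  shows "(\<lambda>n. cos (real n * (pi / 2)) * (1 / real n ^ k)) sums ((2 / 2 ^ k - 1) / 2 ^ k * zeta_nat k)"
proof (rule sums_cos_half_pi)
  have "(\<lambda>m. (-1) ^ m / real m ^ k / 2 ^ k) sums ((2 / 2 ^ k - 1) * zeta_nat k / 2 ^ k)"
    by (intro sums_divide alternating_zeta_sums assms)
  then show "(\<lambda>m. (-1) ^ m * (1 / real (2 * m) ^ k)) sums ((2 / 2 ^ k - 1) / 2 ^ k * zeta_nat k)"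
    by (simp add: power_mult_distrib mult.commute)
qed

section \<open>The sawtooth series and the values \<open>zeta(4)\<close> and
  \<open>beta(3)\<close>\<close>

lemma zeta_2: "zeta_nat 2 = pi\<^sup>2 / 6"
  using inverse_squares_sums zeta_nat_sums[of 2] unfolding zeta_nat_def
  by (simp add: sums_iff add.commute)

text \<open>On the circle the imaginary part of \<open>- Ln (1 - z)\<close> is the sawtooth
  \<open>(pi - t) / 2\<close>, whose sine coefficients are \<open>1 / n\<close>.\<close>

lemma linear_log_fourier:
  assumes "0 < \<alpha>" "\<alpha> \<le> pi" "continuous_on {0..\<alpha>} g"
    and \<gamma>: "\<And>n. ((\<lambda>t. g t * sin (real n * t)) has_integral \<gamma> n) {0<..<\<alpha>}"
    and \<gamma>_le: "\<And>n. 0 < n \<Longrightarrow> \<bar>\<gamma> n\<bar> \<le> C / real n"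
  shows "((\<lambda>t. g t * ((pi - t) / 2)) has_integral (\<Sum>n. 1 / real n * \<gamma> n)) {0<..<\<alpha>}"
proof -
  have "((\<lambda>t. g t * Im (- Ln (1 - cis t))) has_integral (\<Sum>n. 1 / real n * \<gamma> n)) {0<..<\<alpha>}"
  proof (rule has_integral_boundary_power_series[where p = "\<lambda>n. n" and B = 1])
    show "(\<lambda>n. of_real (1 / real n) * z ^ n) sums - Ln (1 - z)" if "norm z < 1" for z
      using Ln_one_minus_sums[OF that] by simp
    show "isCont (\<lambda>z. - Ln (1 - z)) (cis t)" if "0 < t" "t < \<alpha>" for t
      using that assms one_minus_cis_not_nonpos[of t] by (intro continuous_intros) auto
    show "norm (- Ln (1 - of_real r * cis t)) \<le> (6 + pi - ln t)\<^sup>2" if "0 < t" "t < \<alpha>" "0 < r" "r < 1" for t r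
      using Ln_one_minus_cis_bound[of t r] minus_ln_le_square[of t] that assms by simp
    show "(\<lambda>t. (6 + pi - ln t)\<^sup>2) integrable_on {0<..<\<alpha>}"
      by (intro integrable_minus_ln_square assms)
    show "((\<lambda>t. g t * Im (cis (real n * t))) has_integral \<gamma> n) {0<..<\<alpha>}" for n
      using \<gamma>[of n] by simp
    show "summable (\<lambda>n. \<bar>1 / real n * \<gamma> n\<bar>)"
    proof (rule summable_comparison_test')
      show "summable (\<lambda>n. C * (1 / real n ^ 2))"
        using zeta_nat_sums[of 2] by (intro summable_mult) (simp add: sums_iff)
      show "norm \<bar>1 / real n * \<gamma> n\<bar> \<le> C * (1 / real n ^ 2)" if "n \<ge> 0" for n
      proof (cases "n = 0")
        case False
        then have "\<bar>\<gamma> n\<bar> * (1 / real n) \<le> C / real n * (1 / real n)"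
          using \<gamma>_le[of n] by (intro mult_right_mono) auto
        then show ?thesis by (simp add: abs_mult power2_eq_square)
      qed simp
    qed
    show "\<bar>1 / real n\<bar> \<le> 1" for n by (cases n) auto
  qed (use assms in \<open>auto intro: bounded_linear_Im\<close>)
  then show ?thesis
  proof (rule has_integral_eq[rotated])
    show "g t * Im (- Ln (1 - cis t)) = g t * ((pi - t) / 2)" if "t \<in> {0<..<\<alpha>}" for t
      using that assms Ln_one_minus_cis[of t] by (simp add: diff_divide_distrib)
  qed
qed

text \<open>The test function \<open>t * (pi - t)\<close> vanishes at both ends, so its sine moments
  are \<open>4 / n ^ 3\<close> for odd \<open>n\<close> and 0 for even \<open>n\<close>. Against the
  sawtooth this yields the sum of \<open>4 / n ^ 4\<close> over odd \<open>n\<close>, which is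
  \<open>15 / 4 * zeta(4)\<close>.\<close>

lemma zeta_4: "zeta_nat 4 = pi ^ 4 / 90"
proof -
  define \<gamma> where "\<gamma> n = 2 * (1 - (-1) ^ n) / real n ^ 3" for n
  have "((\<lambda>t. (t * (pi - t)) * ((pi - t) / 2)) has_integral (\<Sum>n. 1 / real n * \<gamma> n)) {0<..<pi}"
  proof (rule linear_log_fourier[where C = 4])
    show "((\<lambda>t. (t * (pi - t)) * sin (real n * t)) has_integral \<gamma> n) {0<..<pi}" for n
    proof (cases "n = 0")
      case False
      define N where "N = real n"
      have "N > 0" using False by (simp add: N_def)
      define F where "F x = - (x * (pi - x) * cos (N * x) / N) + (pi - 2 * x) * sin (N * x) / N\<^sup>2 - 2 * cos (N * x) / N ^ 3" for x
      have "((\<lambda>t. (t * (pi - t)) * sin (N * t)) has_integral (F pi - F 0)) {0<..<pi}"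
      proof (rule has_integral_FTC_continuous)
        show "continuous_on {0..pi} F" unfolding F_def using \<open>N > 0\<close> by (intro continuous_intros) auto
        show "(F has_real_derivative (x * (pi - x)) * sin (N * x)) (at x)" for x
          unfolding F_def using \<open>N > 0\<close>
          by (auto intro!: derivative_eq_intros simp: field_simps power2_eq_square power3_eq_cube)
      qed simp
      moreover have "F pi - F 0 = \<gamma> n"
        by (simp add: F_def \<gamma>_def N_def diff_divide_distrib)
      ultimately show ?thesis by (simp add: N_def)
    qed (simp add: \<gamma>_def)
    show "\<bar>\<gamma> n\<bar> \<le> 4 / real n" if "n > 0" for n
    proof -
      have "real n * 1 \<le> real n * (real n)\<^sup>2"
        using that by (intro mult_left_mono one_le_power) auto
      then have "4 / real n ^ 3 \<le> 4 / real n"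
        using that by (intro divide_left_mono) (auto simp: power3_eq_cube power2_eq_square)
      moreover have "\<bar>\<gamma> n\<bar> \<le> 4 / real n ^ 3"
        by (auto simp: \<gamma>_def minus_one_power_iff)
      ultimately show ?thesis by linarith
    qed
  qed (auto intro!: continuous_intros)
  moreover have "((\<lambda>t. (t * (pi - t)) * ((pi - t) / 2)) has_integral
      ((pi\<^sup>2 * pi\<^sup>2 / 4 - pi * pi ^ 3 / 3 + pi ^ 4 / 8) - (pi\<^sup>2 * 0\<^sup>2 / 4 - pi * 0 ^ 3 / 3 + 0 ^ 4 / 8))) {0<..<pi}"
    by (rule has_integral_FTC_continuous)
       (auto intro!: derivative_eq_intros continuous_intros simp: field_simps power2_eq_square power3_eq_cube)
  ultimately have "(\<Sum>n. 1 / real n * \<gamma> n) = (pi\<^sup>2 * pi\<^sup>2 / 4 - pi * pi ^ 3 / 3 + pi ^ 4 / 8) - (pi\<^sup>2 * 0\<^sup>2 / 4 - pi * 0 ^ 3 / 3 + 0 ^ 4 / 8)"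
    by (rule has_integral_unique)
  then have "(\<Sum>n. 1 / real n * \<gamma> n) = pi ^ 4 / 24"
    by (simp add: eval_nat_numeral)
  moreover have "(\<lambda>n. 2 * (1 / real n ^ 4) - 2 * ((-1) ^ n / real n ^ 4)) sums (2 * zeta_nat 4 - 2 * ((2 / 2 ^ 4 - 1) * zeta_nat 4))"
    by (intro sums_diff sums_mult zeta_nat_sums alternating_zeta_sums) auto
  moreover have "1 / real n * \<gamma> n = 2 * (1 / real n ^ 4) - 2 * ((-1) ^ n / real n ^ 4)" for n
    by (simp add: \<gamma>_def eval_nat_numeral diff_divide_distrib right_diff_distrib)
  ultimately show ?thesis by (simp add: sums_iff)
qed

text \<open>The sawtooth tested against \<open>t\<close> on half the interval: the cosine part of
  the moments gives a multiple of \<open>zeta(2)\<close>, already known, and the sine part is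
  Dirichlet's beta function at 3.\<close>

lemma beta_3_sums: "(\<lambda>m. (-1) ^ m / (2 * real m + 1) ^ 3) sums (pi ^ 3 / 32)"
proof -
  define \<gamma> where "\<gamma> n = - (pi / 2) * cos (real n * (pi / 2)) / real n + sin (real n * (pi / 2)) / real n ^ 2" for n
  have "((\<lambda>t. t * ((pi - t) / 2)) has_integral (\<Sum>n. 1 / real n * \<gamma> n)) {0<..<pi/2}"
  proof (rule linear_log_fourier[where C = "pi / 2 + 1"])
    show "((\<lambda>t. t * sin (real n * t)) has_integral \<gamma> n) {0<..<pi/2}" for n
    proof (cases "n = 0")
      case False
      define N where "N = real n"
      have "N > 0" using False by (simp add: N_def)
      define F where "F x = - x * cos (N * x) / N + sin (N * x) / N\<^sup>2" for x
      have "((\<lambda>t. t * sin (N * t)) has_integral (F (pi/2) - F 0)) {0<..<pi/2}"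
      proof (rule has_integral_FTC_continuous)
        show "continuous_on {0..pi/2} F" unfolding F_def using \<open>N > 0\<close> by (intro continuous_intros) auto
        show "(F has_real_derivative x * sin (N * x)) (at x)" for x
          unfolding F_def using \<open>N > 0\<close>
          by (auto intro!: derivative_eq_intros simp: field_simps power2_eq_square)
      qed simp
      moreover have "F (pi/2) - F 0 = \<gamma> n"
        by (simp add: F_def \<gamma>_def N_def)
      ultimately show ?thesis by (simp add: N_def)
    qed (simp add: \<gamma>_def)
    show "\<bar>\<gamma> n\<bar> \<le> (pi / 2 + 1) / real n" if "n > 0" for n
    proof -
      have "\<bar>- (pi / 2) * cos (real n * (pi / 2)) / real n\<bar> \<le> (pi / 2) / real n"
        using abs_cos_le_one[of "real n * (pi / 2)"] by (auto simp: abs_mult intro!: divide_right_mono mult_left_le)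
      moreover have "\<bar>sin (real n * (pi / 2)) / real n ^ 2\<bar> \<le> 1 / real n ^ 2"
        using abs_sin_le_one[of "real n * (pi / 2)"] by (auto intro!: divide_right_mono)
      moreover have "1 / real n ^ 2 \<le> 1 / real n"
        using that by (intro divide_left_mono) (auto simp: power2_eq_square)
      ultimately show ?thesis
        unfolding \<gamma>_def add_divide_distrib by linarith
    qed
  qed (auto intro!: continuous_intros)
  moreover have "((\<lambda>t. t * ((pi - t) / 2)) has_integral
      ((pi * (pi/2)\<^sup>2 / 4 - (pi/2) ^ 3 / 6) - (pi * 0\<^sup>2 / 4 - 0 ^ 3 / 6))) {0<..<pi/2}"
    by (rule has_integral_FTC_continuous)
       (auto intro!: derivative_eq_intros continuous_intros simp: field_simps power2_eq_square power3_eq_cube)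
  ultimately have "(\<Sum>n. 1 / real n * \<gamma> n) = (pi * (pi/2)\<^sup>2 / 4 - (pi/2) ^ 3 / 6) - (pi * 0\<^sup>2 / 4 - 0 ^ 3 / 6)"
    by (rule has_integral_unique)
  then have \<gamma>_sum: "(\<Sum>n. 1 / real n * \<gamma> n) = pi ^ 3 / 24"
    by (simp add: eval_nat_numeral)
  have "summable (\<lambda>n. sin (real n * (pi / 2)) * (1 / real n ^ 3))"
  proof (rule summable_comparison_test')
    show "summable (\<lambda>n. 1 / real n ^ 3)"
      using zeta_nat_sums[of 3] by (simp add: sums_iff)
    show "norm (sin (real n * (pi / 2)) * (1 / real n ^ 3)) \<le> 1 / real n ^ 3" for n
      using abs_sin_le_one[of "real n * (pi / 2)"] by (auto simp: abs_mult intro!: divide_right_mono)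
  qed
  then obtain s where s: "(\<lambda>n. sin (real n * (pi / 2)) * (1 / real n ^ 3)) sums s"
    by (auto simp: summable_def)
  have "(\<lambda>n. - (pi / 2) * (cos (real n * (pi / 2)) * (1 / real n ^ 2)) + sin (real n * (pi / 2)) * (1 / real n ^ 3))
      sums (- (pi / 2) * ((2 / 2 ^ 2 - 1) / 2 ^ 2 * zeta_nat 2) + s)"
    by (intro sums_add sums_mult cos_half_pi_zeta_sums s) simp
  moreover have "1 / real n * \<gamma> n = - (pi / 2) * (cos (real n * (pi / 2)) * (1 / real n ^ 2)) + sin (real n * (pi / 2)) * (1 / real n ^ 3)" for n
    by (simp add: \<gamma>_def eval_nat_numeral distrib_left diff_divide_distrib)
  ultimately have "- (pi / 2) * ((2 / 2 ^ 2 - 1) / 2 ^ 2 * zeta_nat 2) + s = pi ^ 3 / 24"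
    using \<gamma>_sum by (simp add: sums_iff)
  then have "s = pi ^ 3 / 24 + pi / 2 * (1 / 8 * (- (pi\<^sup>2 / 6)))"
    unfolding zeta_2 by simp
  then have "s = pi ^ 3 / 32"
    by (simp add: eval_nat_numeral field_simps)
  then show ?thesis
    using sums_sin_half_pi[OF s] by (simp only:) (simp add: add.commute)
qed

section \<open>The Fourier series of the squared logarithm\<close>

lemma harm_le: "harm n \<le> (real n :: real)"
proof -
  have "harm n \<le> (\<Sum>k=1..n. 1 :: real)"
    unfolding harm_def by (intro sum_mono) (auto simp: divide_simps)
  then show ?thesis by simp
qed

text \<open>The real part of \<open>(Ln (1 - z) - \<mu>)\<^sup>2\<close> on the circle. With
  \<open>\<mu> = ln 2\<close> the squared logarithm is \<open>ln\<^sup>2 (sin (t / 2))\<close>, with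
  \<open>\<mu> = ln 2 / 2\<close> it is a quarter of \<open>ln\<^sup>2 (1 - cos t)\<close>. The
  price is the extra coefficient \<open>2 * \<mu> / n\<close>, a source of \<open>zeta(3)\<close>,
  and the constant term \<open>\<mu>\<^sup>2\<close> at index 0.\<close>

lemma log_square_fourier:
  assumes "0 < \<alpha>" "\<alpha> \<le> pi" "continuous_on {0..\<alpha>} g"
    and \<gamma>: "\<And>n. ((\<lambda>t. g t * cos (real n * t)) has_integral \<gamma> n) {0<..<\<alpha>}"
    and \<gamma>_le: "\<And>n. 0 < n \<Longrightarrow> \<bar>\<gamma> n\<bar> \<le> C / real n ^ 2"
  shows "((\<lambda>t. g t * ((ln (2 * sin (t / 2)) - \<mu>)\<^sup>2 - ((pi - t) / 2)\<^sup>2)) has_integral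
      (\<Sum>n. ((2 * harm (n - 1) + 2 * \<mu>) / real n + (if n = 0 then \<mu>\<^sup>2 else 0)) * \<gamma> n)) {0<..<\<alpha>}"
proof -
  define c where "c n = (2 * harm (n - 1) + 2 * \<mu>) / real n + (if n = 0 then \<mu>\<^sup>2 else 0)" for n
  define B where "B = 2 + 2 * \<bar>\<mu>\<bar> + \<mu>\<^sup>2"
  have c_le: "\<bar>c n\<bar> \<le> B" for n
  proof (cases "n = 0")
    case False
    have "\<bar>2 * harm (n - 1) + 2 * \<mu>\<bar> \<le> 2 * real n + 2 * \<bar>\<mu>\<bar> * 1"
      using harm_le[of "n - 1"] harm_nonneg[of "n - 1", where 'a = real] False by (simp add: of_nat_diff)
    also have "\<dots> \<le> 2 * real n + 2 * \<bar>\<mu>\<bar> * real n"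
      using False by (intro add_left_mono mult_left_mono) auto
    also have "\<dots> \<le> B * real n"
      unfolding B_def by (simp add: distrib_right)
    finally show ?thesis using False by (simp add: c_def divide_le_eq)
  qed (auto simp: c_def B_def)
  have "((\<lambda>t. g t * Re ((Ln (1 - cis t) - of_real \<mu>)\<^sup>2)) has_integral (\<Sum>n. c n * \<gamma> n)) {0<..<\<alpha>}"
  proof (rule has_integral_boundary_power_series[where p = "\<lambda>n. n" and B = B])
    show "(\<lambda>n. of_real (c n) * z ^ n) sums (Ln (1 - z) - of_real \<mu>)\<^sup>2" if "norm z < 1" for z
    proof -
      have "(\<lambda>n. of_real (2 * harm (n - 1) / real n) * z ^ n + 2 * of_real \<mu> * (z ^ n / of_nat n) + (if n = 0 then of_real (\<mu>\<^sup>2) else 0))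
         sums ((Ln (1 - z))\<^sup>2 + 2 * of_real \<mu> * (- Ln (1 - z)) + of_real (\<mu>\<^sup>2))"
        using that sums_single[of 0 "\<lambda>_. complex_of_real (\<mu>\<^sup>2)"]
        by (intro sums_add sums_mult Ln_one_minus_square_sums Ln_one_minus_sums) auto
      moreover have "of_real (c n) * z ^ n = of_real (2 * harm (n - 1) / real n) * z ^ n + 2 * of_real \<mu> * (z ^ n / of_nat n) + (if n = 0 then of_real (\<mu>\<^sup>2) else 0)" for n
        by (simp add: c_def add_divide_distrib distrib_right)
      ultimately show ?thesis by (simp add: power2_eq_square algebra_simps)
    qed
    show "isCont (\<lambda>z. (Ln (1 - z) - of_real \<mu>)\<^sup>2) (cis t)" if "0 < t" "t < \<alpha>" for t
      using that assms one_minus_cis_not_nonpos[of t] by (intro continuous_intros) auto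
    show "norm ((Ln (1 - of_real r * cis t) - of_real \<mu>)\<^sup>2) \<le> (5 + pi + \<bar>\<mu>\<bar> - ln t)\<^sup>2" if "0 < t" "t < \<alpha>" "0 < r" "r < 1" for t r
    proof -
      have "norm (Ln (1 - of_real r * cis t) - of_real \<mu>) \<le> norm (Ln (1 - of_real r * cis t)) + \<bar>\<mu>\<bar>"
        using norm_triangle_ineq4[of _ "complex_of_real \<mu>"] by simp
      then show ?thesis
        using Ln_one_minus_cis_bound[of t r] that assms unfolding norm_power by (intro power_mono) auto
    qed
    show "(\<lambda>t. (5 + pi + \<bar>\<mu>\<bar> - ln t)\<^sup>2) integrable_on {0<..<\<alpha>}"
      by (intro integrable_minus_ln_square assms)
    show "((\<lambda>t. g t * Re (cis (real n * t))) has_integral \<gamma> n) {0<..<\<alpha>}" for n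
      using \<gamma>[of n] by simp
    show "summable (\<lambda>n. \<bar>c n * \<gamma> n\<bar>)"
    proof (rule summable_comparison_test'[of _ 1])
      show "summable (\<lambda>n. B * C * (1 / real n ^ 2))"
        using zeta_nat_sums[of 2] by (intro summable_mult) (simp add: sums_iff)
      show "norm \<bar>c n * \<gamma> n\<bar> \<le> B * C * (1 / real n ^ 2)" if "n \<ge> 1" for n
      proof -
        have "\<bar>c n\<bar> * \<bar>\<gamma> n\<bar> \<le> B * (C / real n ^ 2)"
          using c_le[of n] \<gamma>_le[of n] that by (intro mult_mono) (auto intro: order_trans[OF abs_ge_zero])
        then show ?thesis by (simp add: abs_mult)
      qed
    qed
  qed (use assms c_le in \<open>auto intro: bounded_linear_Re\<close>)
  then show ?thesis
    unfolding c_def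
  proof (rule has_integral_eq[rotated])
    show "g t * Re ((Ln (1 - cis t) - of_real \<mu>)\<^sup>2) = g t * ((ln (2 * sin (t / 2)) - \<mu>)\<^sup>2 - ((pi - t) / 2)\<^sup>2)"
      if "t \<in> {0<..<\<alpha>}" for t
      using that assms Ln_one_minus_cis[of t]
      by (simp add: power2_eq_square) (simp add: field_simps)
  qed
qed

section \<open>The four Euler sums and their relations by parity\<close>

lemma odd_harm_1_le: "0 \<le> odd_harm 1 m" "odd_harm 1 m \<le> real m"
proof -
  show "0 \<le> odd_harm 1 m" by (simp add: odd_harm_def sum_nonneg)
  have "odd_harm 1 m \<le> (\<Sum>j<m. 1)"
    unfolding odd_harm_def by (intro sum_mono) (auto simp: divide_simps)
  then show "odd_harm 1 m \<le> real m" by simp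
qed

lemma summable_div_cube:
  assumes "\<And>n. \<bar>h n\<bar> \<le> real n"
  shows "summable (\<lambda>n. \<bar>h n / real n ^ 3\<bar>)"
proof (rule summable_comparison_test')
  show "summable (\<lambda>n. 1 / real n ^ 2)"
    using zeta_nat_sums[of 2] by (simp add: sums_iff)
  show "norm \<bar>h n / real n ^ 3\<bar> \<le> 1 / real n ^ 2" for n
  proof (cases "n = 0")
    case False
    have "\<bar>h n\<bar> / real n ^ 3 \<le> real n / real n ^ 3"
      using assms by (intro divide_right_mono) auto
    also have "\<dots> = 1 / real n ^ 2"
      using False by (simp add: eval_nat_numeral)
    finally show ?thesis by simp
  qed simp
qed

lemma sums_div_cube:
  assumes "\<And>n. \<bar>h n\<bar> \<le> real n"
  shows "(\<lambda>n. h n / real n ^ 3) sums (\<Sum>n. h n / real n ^ 3)"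
    and "(\<lambda>n. (-1) ^ n * (h n / real n ^ 3)) sums (\<Sum>n. (-1) ^ n * (h n / real n ^ 3))"
proof -
  note * = summable_div_cube[of h, OF assms]
  show "(\<lambda>n. h n / real n ^ 3) sums (\<Sum>n. h n / real n ^ 3)"
    by (rule summable_sums[OF summable_rabs_cancel[OF *]])
  have "summable (\<lambda>n. \<bar>(-1) ^ n * (h n / real n ^ 3)\<bar>)"
    using * by (simp add: abs_mult)
  then show "(\<lambda>n. (-1) ^ n * (h n / real n ^ 3)) sums (\<Sum>n. (-1) ^ n * (h n / real n ^ 3))"
    by (rule summable_sums[OF summable_rabs_cancel])
qed

text \<open>The double zeta value \<open>zeta(3,1)\<close>. The index \<open>n - 1\<close> is that
  of the coefficients of \<open>Ln\<^sup>2 (1 - z)\<close>, whereas \<open>osum\<close> and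
  \<open>aosum\<close> use the coefficients of the squared artanh series.\<close>

definition hsum :: real where "hsum = (\<Sum>n. harm (n - 1) / real n ^ 3)"
definition ahsum :: real where "ahsum = (\<Sum>n. (-1) ^ n * (harm (n - 1) / real n ^ 3))"
definition osum :: real where "osum = (\<Sum>n. odd_harm 1 n / real n ^ 3)"
definition aosum :: real where "aosum = (\<Sum>n. (-1) ^ n * (odd_harm 1 n / real n ^ 3))"

lemma harm_pred_le: "\<bar>harm (n - 1)\<bar> \<le> real n"
  using harm_le[of "n - 1"] harm_nonneg[of "n - 1", where 'a = real] by linarith

lemma hsum_sums: "(\<lambda>n. harm (n - 1) / real n ^ 3) sums hsum"
  unfolding hsum_def by (rule sums_div_cube[OF harm_pred_le])

lemma ahsum_sums: "(\<lambda>n. (-1) ^ n * (harm (n - 1) / real n ^ 3)) sums ahsum"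
  unfolding ahsum_def by (rule sums_div_cube[OF harm_pred_le])

lemma osum_sums: "(\<lambda>n. odd_harm 1 n / real n ^ 3) sums osum"
  unfolding osum_def by (rule sums_div_cube) (use odd_harm_1_le in \<open>auto simp: abs_le_iff\<close>)

lemma aosum_sums: "(\<lambda>n. (-1) ^ n * (odd_harm 1 n / real n ^ 3)) sums aosum"
  unfolding aosum_def by (rule sums_div_cube) (use odd_harm_1_le in \<open>auto simp: abs_le_iff\<close>)

text \<open>Rests on \<open>harm (2 * m - 1) = odd_harm 1 m + harm (m - 1) / 2\<close>: dropping the
  last term \<open>1 / (2 * m)\<close> of \<open>harm (2 * m)\<close> drops half of the last term of
  \<open>harm m\<close>.\<close>

lemma harm_even_term:
  "harm (2 * m - 1) / real (2 * m) ^ 3 = (odd_harm 1 m / real m ^ 3 + harm (m - 1) / real m ^ 3 / 2) / 8"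
proof (cases m)
  case (Suc j)
  have g: "gen_harm 1 n = harm n" for n
    by (simp add: gen_harm_def harm_def inverse_eq_divide)
  have "harm (2 * m) = odd_harm 1 m + harm m / 2"
    using gen_harm_double[of 1 m] unfolding g by simp
  moreover have "harm (2 * m) = harm (2 * m - 1) + 1 / (2 * real m)"
    using harm_Suc[of "2 * m - 1", where 'a = real] Suc by (simp add: inverse_eq_divide)
  moreover have "harm m = harm (m - 1) + 1 / real m"
    using harm_Suc[of j, where 'a = real] Suc by (simp add: inverse_eq_divide)
  ultimately have "harm (2 * m - 1) = odd_harm 1 m + harm (m - 1) / 2"
    by (simp add: add_divide_distrib)
  then have "harm (2 * m - 1) / real (2 * m) ^ 3 = (odd_harm 1 m + harm (m - 1) / 2) / (8 * real m ^ 3)"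
    by (simp add: power_mult_distrib)
  then show ?thesis by (simp add: add_divide_distrib)
qed simp

text \<open>Two values for the even-indexed part of \<open>hsum\<close>: half of
  \<open>hsum + ahsum\<close>, and the splitting of \<open>harm (2 * m - 1)\<close> into odd and
  even denominators.\<close>

lemma osum_eq: "osum = 4 * (hsum + ahsum) - hsum / 2"
proof -
  have "(\<lambda>m. harm (2 * m - 1) / real (2 * m) ^ 3) sums ((hsum + ahsum) / 2)"
    by (rule sums_even_terms[OF hsum_sums ahsum_sums])
  moreover have "(\<lambda>m. harm (2 * m - 1) / real (2 * m) ^ 3) sums ((osum + hsum / 2) / 8)"
    unfolding harm_even_term by (intro sums_divide sums_add osum_sums hsum_sums)
  ultimately have "(hsum + ahsum) / 2 = (osum + hsum / 2) / 8"
    by (rule sums_unique2)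
  then show ?thesis by simp
qed

text \<open>The cosine keeps the even indices with alternating signs, so integrating over the half
  interval \<open>(0, pi/2)\<close> is what brings in \<open>aosum\<close>.\<close>

lemma cos_harm_sums:
  "(\<lambda>n. cos (real n * (pi / 2)) * (harm (n - 1) / real n ^ 3)) sums ((aosum + ahsum / 2) / 8)"
proof (rule sums_cos_half_pi)
  have "(\<lambda>m. ((-1) ^ m * (odd_harm 1 m / real m ^ 3) + (-1) ^ m * (harm (m - 1) / real m ^ 3) / 2) / 8) sums ((aosum + ahsum / 2) / 8)"
    by (intro sums_divide sums_add aosum_sums ahsum_sums)
  then show "(\<lambda>m. (-1) ^ m * (harm (2 * m - 1) / real (2 * m) ^ 3)) sums ((aosum + ahsum / 2) / 8)"
    unfolding harm_even_term by (simp add: distrib_left)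
qed

section \<open>Logarithmic integrals over \<open>(0, pi/2)\<close> by Fourier series\<close>

lemma has_integral_scale:
  fixes f :: "real \<Rightarrow> real"
  assumes "(f has_integral I) {0<..<a}" "0 < m"
  shows "((\<lambda>x. f (m * x)) has_integral I / m) {0<..<a / m}"
proof -
  have "(f has_integral I) (cbox 0 a)"
    using assms by (simp add: has_integral_Icc_iff_Ioo)
  from has_integral_affinity'[OF this assms(2), of 0]
  show ?thesis
    by (simp add: has_integral_Icc_iff_Ioo divide_inverse mult.commute)
qed

lemma has_integral_mirror:
  fixes f :: "real \<Rightarrow> real"
  assumes "(f has_integral I) {0<..<a}"
  shows "((\<lambda>x. f (a - x)) has_integral I) {0<..<a}"
proof (cases "0 \<le> a")
  case True
  have "(f has_integral I) (cbox 0 a)"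
    using assms by (simp add: has_integral_Icc_iff_Ioo)
  from has_integral_affinity[OF this, of "-1" a]
  have "((\<lambda>x. f (a - x)) has_integral I) ((\<lambda>x. a - x) ` {0..a})"
    by (simp add: algebra_simps)
  moreover have "(\<lambda>x. a - x) ` {0..a} = {0..a}"
    by (auto simp: image_iff intro!: bexI[of _ "a - _"])
  ultimately show ?thesis by (simp add: has_integral_Icc_iff_Ioo)
qed (use assms in simp)

lemma has_integral_phi_cos:
  "((\<lambda>t. t * cos (real n * t)) has_integral (if n = 0 then pi\<^sup>2 / 2 else ((-1) ^ n - 1) / real n ^ 2)) {0<..<pi}"
proof (cases "n = 0")
  case True
  have "((\<lambda>t. t) has_integral (pi\<^sup>2 / 2 - 0\<^sup>2 / 2)) {0<..<pi}"
    by (rule has_integral_FTC_continuous) (auto intro!: derivative_eq_intros continuous_intros)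
  then show ?thesis using True by simp
next
  case False
  define N where "N = real n"
  have "N > 0" using False by (simp add: N_def)
  define F where "F x = x * sin (N * x) / N + cos (N * x) / N\<^sup>2" for x
  have "((\<lambda>t. t * cos (N * t)) has_integral (F pi - F 0)) {0<..<pi}"
  proof (rule has_integral_FTC_continuous)
    show "continuous_on {0..pi} F" unfolding F_def using \<open>N > 0\<close> by (intro continuous_intros) auto
    show "(F has_real_derivative x * cos (N * x)) (at x)" for x
      unfolding F_def using \<open>N > 0\<close>
      by (auto intro!: derivative_eq_intros simp: field_simps power2_eq_square)
  qed simp
  moreover have "F pi - F 0 = ((-1) ^ n - 1) / real n ^ 2"
    by (simp add: F_def N_def diff_divide_distrib)
  ultimately show ?thesis using False by (simp add: N_def)
qed

lemma has_integral_compl_phi_cos: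
  "((\<lambda>t. (pi/2 - t) * cos (real n * t)) has_integral
      (if n = 0 then pi\<^sup>2 / 8 else (1 - cos (real n * (pi / 2))) / real n ^ 2)) {0<..<pi/2}"
proof (cases "n = 0")
  case True
  have "((\<lambda>t. pi/2 - t) has_integral ((pi/2 * (pi/2) - (pi/2)\<^sup>2 / 2) - (pi/2 * 0 - 0\<^sup>2 / 2))) {0<..<pi/2}"
    by (rule has_integral_FTC_continuous) (auto intro!: derivative_eq_intros continuous_intros)
  then show ?thesis using True by (simp add: power2_eq_square)
next
  case False
  define N where "N = real n"
  have "N > 0" using False by (simp add: N_def)
  define F where "F x = (pi/2 - x) * sin (N * x) / N - cos (N * x) / N\<^sup>2" for x
  have "((\<lambda>t. (pi/2 - t) * cos (N * t)) has_integral (F (pi/2) - F 0)) {0<..<pi/2}"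
  proof (rule has_integral_FTC_continuous)
    show "continuous_on {0..pi/2} F" unfolding F_def using \<open>N > 0\<close> by (intro continuous_intros) auto
    show "(F has_real_derivative (pi/2 - x) * cos (N * x)) (at x)" for x
      unfolding F_def using \<open>N > 0\<close>
      by (auto intro!: derivative_eq_intros simp: field_simps power2_eq_square)
  qed simp
  moreover have "F (pi/2) - F 0 = (1 - cos (real n * (pi / 2))) / real n ^ 2"
    by (simp add: F_def N_def diff_divide_distrib)
  ultimately show ?thesis using False by (simp add: N_def)
qed

text \<open>The test function \<open>t\<close> on \<open>(0, pi)\<close> has cosine moments
  \<open>((-1) ^ n - 1) / n\<^sup>2\<close>, hence the difference \<open>ahsum - hsum\<close>. The
  term \<open>pi ^ 4 / 48\<close> restores the squared sawtooth, and rescaling \<open>t\<close> to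
  \<open>2 * t\<close> gives the final factor 1/4.\<close>

lemma has_integral_ln_sin_square:
  "((\<lambda>t. t * ln (sin t) ^ 2) has_integral
      (pi ^ 4 / 48 + (ln 2)\<^sup>2 * (pi\<^sup>2 / 2) + 2 * ahsum - 2 * hsum - 7 / 2 * ln 2 * zeta_nat 3) / 4) {0<..<pi/2}"
proof -
  define \<mu> :: real where "\<mu> = ln 2"
  define \<gamma> where "\<gamma> n = (if n = 0 then pi\<^sup>2 / 2 else ((-1) ^ n - 1) / real n ^ 2)" for n
  define S where "S = (\<Sum>n. ((2 * harm (n - 1) + 2 * \<mu>) / real n + (if n = 0 then \<mu>\<^sup>2 else 0)) * \<gamma> n)"
  have 1: "((\<lambda>t. t * ((ln (2 * sin (t / 2)) - \<mu>)\<^sup>2 - ((pi - t) / 2)\<^sup>2)) has_integral S) {0<..<pi}"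
    unfolding S_def
  proof (rule log_square_fourier[where C = 2])
    show "((\<lambda>t. t * cos (real n * t)) has_integral \<gamma> n) {0<..<pi}" for n
      unfolding \<gamma>_def by (rule has_integral_phi_cos)
    show "\<bar>\<gamma> n\<bar> \<le> 2 / real n ^ 2" if "0 < n" for n
      using that by (auto simp: \<gamma>_def minus_one_power_iff)
  qed (auto intro: continuous_intros)
  have S: "S = (\<mu>\<^sup>2 * (pi\<^sup>2 / 2) + 2 * ahsum - 2 * hsum - 7 / 2 * \<mu> * zeta_nat 3)"
  proof -
    let ?f = "\<lambda>n. 2 * ((-1) ^ n * (harm (n - 1) / real n ^ 3)) - 2 * (harm (n - 1) / real n ^ 3)
        + 2 * \<mu> * ((-1) ^ n / real n ^ 3) - 2 * \<mu> * (1 / real n ^ 3) + (if n = 0 then \<mu>\<^sup>2 * (pi\<^sup>2 / 2) else 0)"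
    have "(\<lambda>n. ?f n)
      sums (2 * ahsum - 2 * hsum + 2 * \<mu> * ((2 / 2 ^ 3 - 1) * zeta_nat 3) - 2 * \<mu> * zeta_nat 3 + \<mu>\<^sup>2 * (pi\<^sup>2 / 2))"
      using sums_single[of 0 "\<lambda>_. \<mu>\<^sup>2 * (pi\<^sup>2 / 2)"]
      by (intro sums_add sums_diff sums_mult ahsum_sums hsum_sums alternating_zeta_sums zeta_nat_sums) auto
    moreover have "((2 * harm (n - 1) + 2 * \<mu>) / real n + (if n = 0 then \<mu>\<^sup>2 else 0)) * \<gamma> n
      = ?f n" for n
      by (auto simp: \<gamma>_def field_simps eval_nat_numeral)
    ultimately show ?thesis unfolding S_def by (simp add: sums_iff)
  qed
  have 2: "((\<lambda>t. t * ((pi - t) / 2)\<^sup>2) has_integral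
      ((pi\<^sup>2 * pi\<^sup>2 / 8 - pi * pi ^ 3 / 6 + pi ^ 4 / 16) - (pi\<^sup>2 * 0\<^sup>2 / 8 - pi * 0 ^ 3 / 6 + 0 ^ 4 / 16))) {0<..<pi}"
    by (rule has_integral_FTC_continuous)
       (auto intro!: derivative_eq_intros continuous_intros simp: field_simps power2_eq_square power3_eq_cube)
  have 3: "(pi\<^sup>2 * pi\<^sup>2 / 8 - pi * pi ^ 3 / 6 + pi ^ 4 / 16) - (pi\<^sup>2 * 0\<^sup>2 / 8 - pi * 0 ^ 3 / 6 + 0 ^ 4 / 16) = pi ^ 4 / 48"
    by (simp add: eval_nat_numeral)
  have "((\<lambda>t. t * ((ln (2 * sin (t / 2)) - \<mu>)\<^sup>2 - ((pi - t) / 2)\<^sup>2) + t * ((pi - t) / 2)\<^sup>2)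
      has_integral (S + pi ^ 4 / 48)) {0<..<pi}"
    using has_integral_add[OF 1 2] unfolding 3 .
  then have "((\<lambda>t. t * ln (sin (t / 2)) ^ 2) has_integral (S + pi ^ 4 / 48)) {0<..<pi}"
  proof (rule has_integral_eq[rotated])
    fix t assume "t \<in> {0<..<pi}"
    then have "sin (t / 2) > 0" by (intro sin_gt_zero) auto
    then show "t * ((ln (2 * sin (t / 2)) - \<mu>)\<^sup>2 - ((pi - t) / 2)\<^sup>2) + t * ((pi - t) / 2)\<^sup>2
       = t * ln (sin (t / 2)) ^ 2"
      by (simp add: ln_mult \<mu>_def algebra_simps)
  qed
  from has_integral_divide[OF has_integral_scale[OF this, of 2], of 2]
  show ?thesis unfolding S \<mu>_def by (simp add: algebra_simps)
qed

text \<open>Computed for \<open>1 - cos t = 2 * sin\<^sup>2 (t / 2)\<close> with test function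
  \<open>pi/2 - t\<close> and then reflected at the end. The test function vanishes at
  \<open>pi/2\<close>, which removes the slowly decaying \<open>1 / n\<close> part of its cosine
  moments.\<close>

lemma has_integral_ln_one_minus_sin_square:
  "((\<lambda>t. t * ln (1 - sin t) ^ 2) has_integral
      4 * (17 * pi ^ 4 / 768 + (ln 2)\<^sup>2 * (pi\<^sup>2 / 32) + 2 * hsum - (aosum + ahsum / 2) / 4 + 35 / 32 * ln 2 * zeta_nat 3)) {0<..<pi/2}"
proof -
  define \<mu> :: real where "\<mu> = ln 2 / 2"
  define \<gamma> where "\<gamma> n = (if n = 0 then pi\<^sup>2 / 8 else (1 - cos (real n * (pi / 2))) / real n ^ 2)" for n
  define S where "S = (\<Sum>n. ((2 * harm (n - 1) + 2 * \<mu>) / real n + (if n = 0 then \<mu>\<^sup>2 else 0)) * \<gamma> n)"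
  have 1: "((\<lambda>t. (pi/2 - t) * ((ln (2 * sin (t / 2)) - \<mu>)\<^sup>2 - ((pi - t) / 2)\<^sup>2)) has_integral S) {0<..<pi/2}"
    unfolding S_def
  proof (rule log_square_fourier[where C = 2])
    show "((\<lambda>t. (pi/2 - t) * cos (real n * t)) has_integral \<gamma> n) {0<..<pi/2}" for n
      unfolding \<gamma>_def by (rule has_integral_compl_phi_cos)
    show "\<bar>\<gamma> n\<bar> \<le> 2 / real n ^ 2" if "0 < n" for n
    proof -
      have "\<bar>1 - cos (real n * (pi / 2))\<bar> \<le> 2"
        using abs_cos_le_one[of "real n * (pi / 2)"] by linarith
      then show ?thesis using that by (auto simp: \<gamma>_def intro!: divide_right_mono)
    qed
  qed (auto intro!: continuous_intros)
  have S: "S = \<mu>\<^sup>2 * (pi\<^sup>2 / 8) + 2 * hsum - (aosum + ahsum / 2) / 4 + 35 / 16 * \<mu> * zeta_nat 3"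
  proof -
    define C where "C n = cos (real n * (pi / 2))" for n
    let ?f = "\<lambda>n. 2 * (harm (n - 1) / real n ^ 3) - 2 * (C n * (harm (n - 1) / real n ^ 3))
        + 2 * \<mu> * (1 / real n ^ 3) - 2 * \<mu> * (C n * (1 / real n ^ 3)) + (if n = 0 then \<mu>\<^sup>2 * (pi\<^sup>2 / 8) else 0)"
    have "(\<lambda>n. ?f n)
      sums (2 * hsum - 2 * ((aosum + ahsum / 2) / 8) + 2 * \<mu> * zeta_nat 3 - 2 * \<mu> * ((2 / 2 ^ 3 - 1) / 2 ^ 3 * zeta_nat 3) + \<mu>\<^sup>2 * (pi\<^sup>2 / 8))"
      unfolding C_def using sums_single[of 0 "\<lambda>_. \<mu>\<^sup>2 * (pi\<^sup>2 / 8)"]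
      by (intro sums_add sums_diff sums_mult hsum_sums cos_harm_sums cos_half_pi_zeta_sums zeta_nat_sums) auto
    moreover have "((2 * harm (n - 1) + 2 * \<mu>) / real n + (if n = 0 then \<mu>\<^sup>2 else 0)) * \<gamma> n
      = ?f n" for n
      unfolding \<gamma>_def C_def[symmetric] by (auto simp: field_simps eval_nat_numeral)
    ultimately have "S = 2 * hsum - 2 * ((aosum + ahsum / 2) / 8) + 2 * \<mu> * zeta_nat 3 - 2 * \<mu> * ((2 / 2 ^ 3 - 1) / 2 ^ 3 * zeta_nat 3) + \<mu>\<^sup>2 * (pi\<^sup>2 / 8)"
      unfolding S_def by (simp only: sums_iff)
    then show ?thesis by (simp add: field_simps)
  qed
  \<comment> \<open>A primitive of \<open>u * ((u + pi/2) / 2)\<^sup>2\<close>, where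
    \<open>u = pi/2 - t\<close>.\<close>
  define F where "F x = x ^ 4 / 16 + pi * x ^ 3 / 12 + pi\<^sup>2 * x\<^sup>2 / 32" for x
  have 2: "((\<lambda>t. (pi/2 - t) * ((pi - t) / 2)\<^sup>2) has_integral (- F (pi/2 - pi/2) - (- F (pi/2 - 0)))) {0<..<pi/2}"
    unfolding F_def
    by (rule has_integral_FTC_continuous)
       (auto intro!: derivative_eq_intros continuous_intros simp: field_simps power2_eq_square power3_eq_cube)
  have 3: "- F (pi/2 - pi/2) - (- F (pi/2 - 0)) = 17 * pi ^ 4 / 768"
    by (simp add: F_def eval_nat_numeral)
  have "((\<lambda>t. 4 * ((pi/2 - t) * ((ln (2 * sin (t / 2)) - \<mu>)\<^sup>2 - ((pi - t) / 2)\<^sup>2) + (pi/2 - t) * ((pi - t) / 2)\<^sup>2))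
      has_integral 4 * (S + 17 * pi ^ 4 / 768)) {0<..<pi/2}"
    using has_integral_mult_right[OF has_integral_add[OF 1 2], of 4] unfolding 3 .
  then have "((\<lambda>t. (pi/2 - t) * ln (1 - cos t) ^ 2) has_integral 4 * (S + 17 * pi ^ 4 / 768)) {0<..<pi/2}"
  proof (rule has_integral_eq[rotated])
    fix t assume "t \<in> {0<..<pi/2}"
    then have s: "sin (t / 2) > 0" by (intro sin_gt_zero) auto
    have "1 - cos t = 2 * (sin (t / 2))\<^sup>2"
      using cos_double_sin[of "t / 2"] by simp
    then have ln_eq: "ln (1 - cos t) = 2 * (ln (2 * sin (t / 2)) - \<mu>)"
      using s by (simp add: ln_mult ln_realpow \<mu>_def)
    show "4 * ((pi/2 - t) * ((ln (2 * sin (t / 2)) - \<mu>)\<^sup>2 - ((pi - t) / 2)\<^sup>2) + (pi/2 - t) * ((pi - t) / 2)\<^sup>2)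
       = (pi/2 - t) * ln (1 - cos t) ^ 2"
      unfolding ln_eq by (simp add: power2_eq_square algebra_simps)
  qed
  from has_integral_mirror[OF this]
  show ?thesis unfolding S \<mu>_def by (simp add: cos_diff power_divide algebra_simps)
qed

text \<open>On the circle \<open>Ln (1 - z) - Ln (1 + z)\<close> is
  \<open>ln (tan (t / 2)) - \<i> * pi / 2\<close>; the real part of its square supplies the shift
  \<open>pi\<^sup>2 / 4\<close>. For \<open>t < pi/2\<close> the real part of
  \<open>1 + r * cis t\<close> is at least 1, so the singularity at \<open>z = -1\<close> stays out
  of reach.\<close>

lemma has_integral_ln_tan_square_fourier:
  "((\<lambda>t. (pi/2 - t) * (ln (tan (t / 2)) ^ 2 - pi\<^sup>2 / 4)) has_integral (osum - aosum)) {0<..<pi/2}"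
proof -
  define \<gamma> where "\<gamma> m = (if 2 * m = 0 then pi\<^sup>2 / 8 else (1 - cos (real (2 * m) * (pi / 2))) / real (2 * m) ^ 2)" for m
  define c where "c m = 4 * odd_harm 1 m / real m" for m
  have summand: "c m * \<gamma> m = odd_harm 1 m / real m ^ 3 - (-1) ^ m * (odd_harm 1 m / real m ^ 3)" for m
    by (auto simp: c_def \<gamma>_def field_simps eval_nat_numeral)
  have "((\<lambda>t. (pi/2 - t) * Re ((Ln (1 - cis t) - Ln (1 + cis t))\<^sup>2)) has_integral (\<Sum>m. c m * \<gamma> m)) {0<..<pi/2}"
  proof (rule has_integral_boundary_power_series[where p = "\<lambda>m. 2 * m" and B = 4])
    show "(\<lambda>m. of_real (c m) * z ^ (2 * m)) sums (Ln (1 - z) - Ln (1 + z))\<^sup>2" if "norm z < 1" for z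
      unfolding c_def by (rule artanh_square_sums[OF that])
    show "\<bar>c m\<bar> \<le> 4" for m
      using odd_harm_1_le[of m] by (cases "m = 0") (auto simp: c_def divide_le_eq)
    show "isCont (\<lambda>z. (Ln (1 - z) - Ln (1 + z))\<^sup>2) (cis t)" if "0 < t" "t < pi/2" for t
      using that one_minus_cis_not_nonpos[of t] one_plus_cis_not_nonpos[of t] by (intro continuous_intros) auto
    show "norm ((Ln (1 - of_real r * cis t) - Ln (1 + of_real r * cis t))\<^sup>2) \<le> (8 + 2 * pi - ln t)\<^sup>2"
      if t: "0 < t" "t < pi/2" and r: "0 < r" "r < 1" for t r
    proof -
      have "0 \<le> r * cos t" using t r by (intro mult_nonneg_nonneg cos_ge_zero) auto
      then have "1 \<le> Re (1 + of_real r * cis t)" by simp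
      then have "1 \<le> norm (1 + of_real r * cis t)"
        using complex_Re_le_cmod order_trans by blast
      moreover have "norm (1 + of_real r * cis t) \<le> 2"
        using norm_triangle_ineq[of 1 "of_real r * cis t"] r by (simp add: norm_mult)
      ultimately have "norm (Ln (1 + of_real r * cis t)) \<le> 3 + pi - ln 1"
        by (intro norm_Ln_bound) auto
      moreover have "norm (Ln (1 - of_real r * cis t)) \<le> 5 + pi - ln t"
        using t r by (intro Ln_one_minus_cis_bound) auto
      moreover have "norm (Ln (1 - of_real r * cis t) - Ln (1 + of_real r * cis t))
          \<le> norm (Ln (1 - of_real r * cis t)) + norm (Ln (1 + of_real r * cis t))"
        by (rule norm_triangle_ineq4)
      ultimately show ?thesis
        unfolding norm_power by (intro power_mono) auto
    qed
    show "(\<lambda>t. (8 + 2 * pi - ln t)\<^sup>2) integrable_on {0<..<pi/2}"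
      by (intro integrable_minus_ln_square) simp
    show "((\<lambda>t. (pi/2 - t) * Re (cis (real (2 * m) * t))) has_integral \<gamma> m) {0<..<pi/2}" for m
      using has_integral_compl_phi_cos[of "2 * m"] unfolding \<gamma>_def by simp
    have "summable (\<lambda>m. \<bar>(odd_harm 1 m - (-1) ^ m * odd_harm 1 m) / 2 / real m ^ 3\<bar>)"
      using odd_harm_1_le by (intro summable_div_cube) (auto simp: minus_one_power_iff)
    moreover have "\<bar>c m * \<gamma> m\<bar> = 2 * \<bar>(odd_harm 1 m - (-1) ^ m * odd_harm 1 m) / 2 / real m ^ 3\<bar>" for m
    proof -
      have "(odd_harm 1 m - (-1) ^ m * odd_harm 1 m) / 2 / real m ^ 3
          = (odd_harm 1 m / real m ^ 3 - (-1) ^ m * (odd_harm 1 m / real m ^ 3)) / 2"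
        by (simp add: diff_divide_distrib)
      then show ?thesis unfolding summand by (simp only: abs_divide) simp
    qed
    ultimately show "summable (\<lambda>m. \<bar>c m * \<gamma> m\<bar>)"
      by (simp only:) (intro summable_mult)
  qed (auto intro!: continuous_intros bounded_linear_Re)
  moreover have "(\<Sum>m. c m * \<gamma> m) = osum - aosum"
    unfolding summand using sums_diff[OF osum_sums aosum_sums] by (simp add: sums_iff)
  ultimately have "((\<lambda>t. (pi/2 - t) * Re ((Ln (1 - cis t) - Ln (1 + cis t))\<^sup>2)) has_integral (osum - aosum)) {0<..<pi/2}"
    by simp
  then show ?thesis
  proof (rule has_integral_eq[rotated])
    fix t assume t: "t \<in> {0<..<pi/2}"
    have "sin (t / 2) > 0" "cos (t / 2) > 0"
      using t by (auto intro!: sin_gt_zero cos_gt_zero)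
    then have "ln (tan (t / 2)) = ln (2 * sin (t / 2)) - ln (2 * cos (t / 2))"
      by (simp add: tan_def ln_div ln_mult)
    moreover have "Ln (1 - cis t) - Ln (1 + cis t) = of_real (ln (2 * sin (t / 2)) - ln (2 * cos (t / 2))) - \<i> * of_real (pi / 2)"
      using t by (subst Ln_one_minus_cis Ln_one_plus_cis; simp)+ (simp add: field_simps)
    ultimately show "(pi/2 - t) * Re ((Ln (1 - cis t) - Ln (1 + cis t))\<^sup>2) = (pi/2 - t) * (ln (tan (t / 2)) ^ 2 - pi\<^sup>2 / 4)"
      by (simp add: power2_eq_square)
  qed
qed

subsection \<open>Polylogarithms and Euler sums\<close>

text \<open>Signs \<open>e\<close> and exponents \<open>p\<close> are kept general to treat together
  the polylogarithm (\<open>e = 1\<close>, \<open>p = Suc\<close>) and the inverse tangent integral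
  (alternating signs, odd exponents).\<close>

definition pl :: "(nat \<Rightarrow> real) \<Rightarrow> (nat \<Rightarrow> nat) \<Rightarrow> nat \<Rightarrow> real \<Rightarrow> real" where
  "pl e p k x = (\<Sum>m. e m * x ^ p m / real (p m) ^ k)"

context
  fixes e :: "nat \<Rightarrow> real" and p :: "nat \<Rightarrow> nat"
  assumes e: "\<And>m. \<bar>e m\<bar> \<le> 1" and p: "\<And>m. m < p m"
begin

lemma pl_term_le:
  assumes "0 \<le> x" "x \<le> 1"
  shows "\<bar>e m * x ^ p m / real (p m) ^ k\<bar> \<le> x ^ m / real (Suc m) ^ k"
proof -
  have "\<bar>e m * x ^ p m / real (p m) ^ k\<bar> = \<bar>e m\<bar> * (x ^ p m / real (p m) ^ k)"
    using assms by (simp add: abs_mult)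
  also have "\<dots> \<le> 1 * (x ^ p m / real (p m) ^ k)"
    using e assms by (intro mult_right_mono) auto
  also have "1 * (x ^ p m / real (p m) ^ k) \<le> x ^ m / real (Suc m) ^ k"
  proof -
    have "x ^ p m \<le> x ^ m"
      using assms p[of m] by (intro power_decreasing) auto
    moreover have "real (Suc m) ^ k \<le> real (p m) ^ k"
      using p[of m] by (intro power_mono) auto
    ultimately show ?thesis using assms by (simp add: frac_le del: of_nat_Suc)
  qed
  finally show ?thesis .
qed

lemma pl_summable_abs:
  assumes "0 \<le> x" "x < 1"
  shows "summable (\<lambda>m. \<bar>e m * x ^ p m / real (p m) ^ k\<bar>)"
proof (rule summable_comparison_test')
  show "summable (\<lambda>m. x ^ m)" using assms by (intro summable_geometric) auto
  fix m
  have "x ^ m / real (Suc m) ^ k \<le> x ^ m / 1"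
    using assms by (intro divide_left_mono) (auto intro: one_le_power)
  then show "norm \<bar>e m * x ^ p m / real (p m) ^ k\<bar> \<le> x ^ m"
    using pl_term_le[of x m k] assms by simp
qed

lemma pl_sums:
  assumes "0 \<le> x" "x < 1"
  shows "(\<lambda>m. e m * x ^ p m / real (p m) ^ k) sums pl e p k x"
  unfolding pl_def by (rule summable_sums[OF summable_rabs_cancel[OF pl_summable_abs[OF assms]]])

text \<open>From order 2 on the series is dominated by \<open>1 / (m + 1) ^ k\<close>, so continuity
  includes \<open>x = 1\<close>, where the zeta value, \<open>catalan\<close> and
  \<open>beta(3)\<close> are read off.\<close>

lemma pl_continuous:
  assumes "2 \<le> k"
  shows "continuous_on {0..1} (pl e p k)"
proof -
  have "uniform_limit {0..1} (\<lambda>n x. \<Sum>m<n. e m * x ^ p m / real (p m) ^ k) (pl e p k) sequentially"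
    unfolding pl_def
  proof (rule Weierstrass_m_test)
    show "summable (\<lambda>m. 1 / real (Suc m) ^ k)"
      using zeta_nat_Suc_sums[OF assms] by (simp add: sums_iff)
    fix m and x :: real assume x: "x \<in> {0..1}"
    have "x ^ m / real (Suc m) ^ k \<le> 1 / real (Suc m) ^ k"
      using x by (intro divide_right_mono power_le_one) auto
    then show "norm (e m * x ^ p m / real (p m) ^ k) \<le> 1 / real (Suc m) ^ k"
      using pl_term_le[of x m k] x by (simp del: of_nat_Suc)
  qed
  then show ?thesis
    by (rule uniform_limit_theorem[rotated])
       (auto intro!: always_eventually continuous_intros simp: p[THEN gr_implies_not0])
qed

lemma pl_deriv:
  assumes "0 < x" "x < 1"
  shows "(pl e p (Suc k) has_real_derivative pl e p k x / x) (at x)"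
proof -
  \<comment> \<open>The midpoint between \<open>x\<close> and 1 gives a geometric majorant on a
    neighbourhood of \<open>x\<close>.\<close>
  define \<rho> where "\<rho> = (1 + x) / 2"
  have \<rho>: "x < \<rho>" "\<rho> < 1" "0 < \<rho>" using assms by (auto simp: \<rho>_def)
  have p0: "real (p m) > 0" for m using p[of m] by simp
  have "((\<lambda>x. \<Sum>m. e m * x ^ p m / real (p m) ^ Suc k) has_real_derivative (\<Sum>m. e m * x ^ (p m - 1) / real (p m) ^ k)) (at x)"
  proof (rule has_field_derivative_series'[where S = "{0<..<\<rho>}" and x0 = x])
    show "((\<lambda>x. e m * x ^ p m / real (p m) ^ Suc k) has_real_derivative e m * y ^ (p m - 1) / real (p m) ^ k) (at y within {0<..<\<rho>})" for m y
      using p0[of m] by (auto intro!: derivative_eq_intros)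
    have "uniform_limit {0<..<\<rho>} (\<lambda>n y. \<Sum>m<n. e m * y ^ (p m - 1) / real (p m) ^ k)
        (\<lambda>y. \<Sum>m. e m * y ^ (p m - 1) / real (p m) ^ k) sequentially"
    proof (rule Weierstrass_m_test)
      show "summable (\<lambda>m. \<rho> ^ m)" using \<rho> by (intro summable_geometric) auto
      fix m and y :: real assume y: "y \<in> {0<..<\<rho>}"
      have "y ^ (p m - 1) \<le> y ^ m"
        using y \<rho> p[of m] by (intro power_decreasing) auto
      also have "\<dots> \<le> \<rho> ^ m" using y by (intro power_mono) auto
      finally have 1: "y ^ (p m - 1) \<le> \<rho> ^ m" .
      have 2: "1 \<le> real (p m) ^ k" using p[of m] by (intro one_le_power) auto
      have "\<bar>e m\<bar> * y ^ (p m - 1) \<le> 1 * \<rho> ^ m"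
        using 1 e[of m] y by (intro mult_mono) auto
      also have "\<dots> \<le> \<rho> ^ m * real (p m) ^ k"
        using 2 \<rho> by simp
      finally show "norm (e m * y ^ (p m - 1) / real (p m) ^ k) \<le> \<rho> ^ m"
        using 2 y p0[of m] by (simp add: abs_mult divide_le_eq)
    qed
    then show "uniformly_convergent_on {0<..<\<rho>} (\<lambda>n y. \<Sum>m<n. e m * y ^ (p m - 1) / real (p m) ^ k)"
      by (auto simp: uniformly_convergent_on_def)
    show "summable (\<lambda>m. e m * x ^ p m / real (p m) ^ Suc k)"
      by (rule summable_rabs_cancel[OF pl_summable_abs]) (use assms in auto)
  qed (use \<rho> assms in auto)
  moreover have "(\<Sum>m. e m * x ^ (p m - 1) / real (p m) ^ k) = pl e p k x / x"
  proof -
    have "(\<lambda>m. e m * x ^ p m / real (p m) ^ k / x) sums (pl e p k x / x)"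
      using assms by (intro sums_divide pl_sums) auto
    moreover have "e m * x ^ p m / real (p m) ^ k / x = e m * x ^ (p m - 1) / real (p m) ^ k" for m
    proof -
      have "x ^ p m = x * x ^ (p m - 1)" using p[of m] by (cases "p m") auto
      then show ?thesis using assms by simp
    qed
    ultimately show ?thesis by (simp add: sums_iff)
  qed
  moreover have "pl e p (Suc k) = (\<lambda>x. \<Sum>m. e m * x ^ p m / real (p m) ^ Suc k)"
    by (rule ext) (simp only: pl_def)
  ultimately show ?thesis by simp
qed

end

section \<open>The Euler sum \<open>hsum\<close>\<close>

lemma has_integral_power_ln_one_minus:
  "((\<lambda>x. x ^ m * (- ln (1 - x))) has_integral harm (Suc m) / (real m + 1)) {0<..<1}"
proof -
  define P where "P x = (\<Sum>i=1..Suc m. x ^ i / real i)" for x :: real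
  define N where "N = real m + 1"
  define F where "F x = ((1 - x ^ Suc m) * ln (1 - x) + P x) / N" for x
  have "N > 0" by (simp add: N_def)
  have geo: "1 - x ^ Suc m = (1 - x) * (\<Sum>i<Suc m. x ^ i)" for x :: real
    by (rule one_diff_power_eq)
  have "((\<lambda>x. x ^ m * (- ln (1 - x))) has_integral P 1 / N - F 0) {0<..<1}"
  proof (rule has_integral_FTC_limits)
    show "(F \<longlongrightarrow> F 0) (at_right 0)"
      unfolding F_def P_def using \<open>N > 0\<close> by (intro tendsto_intros) auto
    have lim: "((\<lambda>x::real. (1 - x) * ln (1 - x)) \<longlongrightarrow> 0) (at_left 1)"
      by real_asymp
    have "((\<lambda>x. ((\<Sum>i<Suc m. x ^ i) * ((1 - x) * ln (1 - x)) + P x) / N) \<longlongrightarrow> ((\<Sum>i<Suc m. 1 ^ i) * 0 + P 1) / N) (at_left 1)"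
      unfolding P_def using \<open>N > 0\<close> by (intro tendsto_intros lim) auto
    then show "(F \<longlongrightarrow> P 1 / N) (at_left 1)"
      unfolding F_def geo by (simp add: mult_ac)
    fix x :: real assume x: "0 < x" "x < 1"
    have dP: "(P has_real_derivative (\<Sum>i<Suc m. x ^ i)) (at x)"
      unfolding P_def by (rule DERIV_truncated_log)
    define Q where "Q = (\<Sum>i<Suc m. x ^ i)"
    have p: "((\<lambda>x. 1 - x ^ Suc m) has_real_derivative - (N * x ^ m)) (at x)"
      using DERIV_diff[OF DERIV_const[of 1] DERIV_power[OF DERIV_ident, of "Suc m"]] by (simp add: N_def add.commute del: power_Suc)
    have l: "((\<lambda>x. ln (1 - x)) has_real_derivative - 1 / (1 - x)) (at x)"
      using x by (auto intro!: derivative_eq_intros)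
    have "(F has_real_derivative ((- (N * x ^ m)) * ln (1 - x) + - 1 / (1 - x) * (1 - x ^ Suc m) + Q) / N) (at x)"
      unfolding F_def Q_def by (rule DERIV_cdivide[OF DERIV_add[OF DERIV_mult[OF p l] dP]])
    also have "((- (N * x ^ m)) * ln (1 - x) + - 1 / (1 - x) * (1 - x ^ Suc m) + Q) / N = x ^ m * (- ln (1 - x))"
      unfolding geo Q_def[symmetric] using x \<open>N > 0\<close> by (simp add: field_simps)
    finally show "(F has_real_derivative x ^ m * (- ln (1 - x))) (at x)" .
  qed simp
  moreover have "F 0 = 0"
    by (auto simp: F_def P_def intro!: sum.neutral)
  moreover have "P 1 = harm (Suc m)"
    by (simp add: P_def harm_def inverse_eq_divide)
  ultimately show ?thesis by (simp add: N_def)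
qed

text \<open>\<open>\<Sum> H n / n\<^sup>3 = \<integral> Li\<^sub>2 dLi\<^sub>2 = \<zeta>(2)\<^sup>2 / 2\<close>.\<close>

lemma hsum_eq: "hsum = zeta_nat 4 / 4"
proof -
  define Li where "Li = pl (\<lambda>_. 1) Suc"
  note Li_simps = pl_sums[of "\<lambda>_. 1" Suc, folded Li_def] pl_deriv[of "\<lambda>_. 1" Suc, folded Li_def] pl_continuous[of "\<lambda>_. 1" Suc, folded Li_def]
  have Li_1: "Li 1 x = - ln (1 - x)" if "0 \<le> x" "x < 1" for x
  proof -
    have "(\<lambda>n. - ((- (- x)) ^ n) / of_nat n) sums ln (1 + - x)"
      using that by (intro ln_series') auto
    then have "(\<lambda>n. - (x ^ Suc n) / real (Suc n)) sums ln (1 - x)"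
      by (subst sums_Suc_iff) simp
    from sums_minus[OF this] have "(\<lambda>n. 1 * x ^ Suc n / real (Suc n) ^ 1) sums - ln (1 - x)"
      by (simp del: of_nat_Suc)
    then show ?thesis using Li_simps(1)[of x 1] that sums_unique2 by fastforce
  qed
  have "((\<lambda>x. Li 2 x * (- ln (1 - x)) / x) has_integral (Li 2 1 ^ 2 / 2 - Li 2 0 ^ 2 / 2)) {0<..<1}"
  proof (rule has_integral_FTC_continuous)
    show "continuous_on {0..1} (\<lambda>x. Li 2 x ^ 2 / 2)"
      by (intro continuous_intros Li_simps) auto
    fix x :: real assume x: "0 < x" "x < 1"
    have "(Li 2 has_real_derivative - ln (1 - x) / x) (at x)"
      using Li_simps(2)[of x 1] x Li_1[of x] by (simp add: numeral_2_eq_2)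
    then show "((\<lambda>x. Li 2 x ^ 2 / 2) has_real_derivative Li 2 x * (- ln (1 - x)) / x) (at x)"
      by (auto intro!: derivative_eq_intros)
  qed simp
  moreover have "Li 2 1 = zeta_nat 2" "Li 2 0 = 0"
    by (simp_all add: Li_def pl_def zeta_nat_def)
  ultimately have I: "((\<lambda>x. Li 2 x * (- ln (1 - x)) / x) has_integral zeta_nat 2 ^ 2 / 2) {0<..<1}"
    by simp
  have "(\<lambda>m. 1 / real (Suc m) ^ 2 * (harm (Suc m) / (real m + 1))) sums (zeta_nat 2 ^ 2 / 2)"
  proof (rule sums_integral_nonneg[OF _ _ _ I])
    show "((\<lambda>x. 1 / real (Suc m) ^ 2 * (x ^ m * (- ln (1 - x)))) has_integral 1 / real (Suc m) ^ 2 * (harm (Suc m) / (real m + 1))) {0<..<1}" for m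
      by (intro has_integral_mult_right has_integral_power_ln_one_minus)
    show "0 \<le> 1 / real (Suc m) ^ 2 * (x ^ m * (- ln (1 - x)))" if "x \<in> {0<..<1}" for m x
      using that by (intro mult_nonneg_nonneg) auto
    show "(\<lambda>m. 1 / real (Suc m) ^ 2 * (x ^ m * (- ln (1 - x)))) sums (Li 2 x * (- ln (1 - x)) / x)" if "x \<in> {0<..<1}" for x
    proof -
      have "(\<lambda>m. 1 * x ^ Suc m / real (Suc m) ^ 2 * (- ln (1 - x)) / x) sums (Li 2 x * (- ln (1 - x)) / x)"
        using that by (intro sums_divide sums_mult2 Li_simps) auto
      then show ?thesis using that by (simp add: mult_ac del: of_nat_Suc)
    qed
  qed
  \<comment> \<open>Passing from \<open>harm n\<close> to \<open>harm (n - 1)\<close> costs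
    \<open>1 / n ^ 4\<close>, so \<open>hsum = zeta(2)\<^sup>2 / 2 - zeta(4)\<close>, and
    \<open>zeta(2)\<^sup>2 = 5 / 2 * zeta(4)\<close>.\<close>
  moreover have "1 / real (Suc m) ^ 2 * (harm (Suc m) / (real m + 1)) = harm (Suc m - 1) / real (Suc m) ^ 3 + 1 / real (Suc m) ^ 4" for m
  proof -
    define N where "N = real (Suc m)"
    have "N > 0" "real m + 1 = N" by (simp_all add: N_def)
    moreover have "harm (Suc m) = harm m + 1 / N"
      by (simp add: harm_Suc N_def inverse_eq_divide)
    ultimately show ?thesis
      unfolding N_def[symmetric] by (simp add: field_simps eval_nat_numeral)
  qed
  ultimately have "(\<lambda>m. harm (Suc m - 1) / real (Suc m) ^ 3 + 1 / real (Suc m) ^ 4) sums (zeta_nat 2 ^ 2 / 2)"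
    by simp
  then have "(\<lambda>m. harm (m - 1) / real m ^ 3 + 1 / real m ^ 4) sums (zeta_nat 2 ^ 2 / 2)"
    by (subst (asm) sums_Suc_iff) simp
  moreover have "(\<lambda>m. harm (m - 1) / real m ^ 3 + 1 / real m ^ 4) sums (hsum + zeta_nat 4)"
    by (intro sums_add hsum_sums zeta_nat_sums) simp
  ultimately have "hsum + zeta_nat 4 = zeta_nat 2 ^ 2 / 2"
    by (rule sums_unique2[symmetric])
  then show ?thesis
    unfolding zeta_2 zeta_4 by (simp add: eval_nat_numeral)
qed

section \<open>Remainders of the series for \<open>ln 2\<close> and the square of Catalan's
  constant\<close>

definition ln2_rem :: "nat \<Rightarrow> real" where
  "ln2_rem m = (\<Sum>j<m. (-1) ^ j / (real j + 1)) - ln 2"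

lemma has_integral_odd_power: "((\<lambda>t. 2 * t ^ (2 * m + 1)) has_integral 1 / (real m + 1)) {0<..<1::real}"
proof -
  have "((\<lambda>t. 2 * t ^ (2 * m + 1)) has_integral (1 ^ (2 * m + 2) / (real m + 1) - 0 ^ (2 * m + 2) / (real m + 1))) {0<..<1::real}"
  proof (rule has_integral_FTC_continuous)
    fix t :: real
    define M where "M = real m + 1"
    have M: "M > 0" "real (2 * m + 2) = M * 2" "2 * m + 2 - Suc 0 = 2 * m + 1" by (simp_all add: M_def)
    have "((\<lambda>t. t ^ (2 * m + 2) / M) has_real_derivative real (2 * m + 2) * t ^ (2 * m + 2 - Suc 0) / M) (at t)"
      by (rule DERIV_cdivide[OF DERIV_pow])
    also have "real (2 * m + 2) * t ^ (2 * m + 2 - Suc 0) / M = 2 * t ^ (2 * m + 1)"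
      unfolding M(2,3) using M(1) by simp
    finally show "((\<lambda>t. t ^ (2 * m + 2) / (real m + 1)) has_real_derivative 2 * t ^ (2 * m + 1)) (at t)"
      unfolding M_def .
  qed (auto intro!: continuous_intros)
  then show ?thesis by simp
qed

text \<open>The tail of the geometric expansion of \<open>2 * t / (1 + t\<^sup>2)\<close>. This
  integral form determines sign and size of the remainder, and later allows sums over
  \<open>ln2_rem\<close> to be carried out under the integral.\<close>

lemma has_integral_ln2_rem:
  "((\<lambda>t. 2 * t ^ (2 * m + 1) / (1 + t\<^sup>2)) has_integral (- ((-1) ^ m) * ln2_rem m)) {0<..<1}"
proof (induction m)
  case 0
  have pos: "1 + t\<^sup>2 > 0" for t :: real
    by (simp add: add_pos_nonneg)
  have "((\<lambda>t. 2 * t / (1 + t\<^sup>2)) has_integral (ln (1 + 1\<^sup>2) - ln (1 + 0\<^sup>2))) {0<..<1::real}"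
  proof (rule has_integral_FTC_continuous)
    show "continuous_on {0..1} (\<lambda>t::real. ln (1 + t\<^sup>2))"
      using pos by (intro continuous_intros) (auto simp: less_imp_neq[symmetric])
    show "((\<lambda>t. ln (1 + t\<^sup>2)) has_real_derivative 2 * t / (1 + t\<^sup>2)) (at t)" for t :: real
      using pos[of t] by (auto intro!: derivative_eq_intros)
  qed simp
  then show ?case by (simp add: ln2_rem_def)
next
  case (Suc m)
  from has_integral_diff[OF has_integral_odd_power Suc]
  have "((\<lambda>t. 2 * t ^ (2 * Suc m + 1) / (1 + t\<^sup>2)) has_integral (1 / (real m + 1) - (- ((-1) ^ m) * ln2_rem m))) {0<..<1}"
  proof (rule has_integral_eq[rotated])
    fix t :: real
    have "1 + t\<^sup>2 > 0" by (simp add: add_pos_nonneg)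
    then show "2 * t ^ (2 * m + 1) - 2 * t ^ (2 * m + 1) / (1 + t\<^sup>2) = 2 * t ^ (2 * Suc m + 1) / (1 + t\<^sup>2)"
      by (simp add: field_simps power2_eq_square)
  qed
  moreover have "1 / (real m + 1) - (- ((-1) ^ m) * ln2_rem m) = - ((-1) ^ Suc m) * ln2_rem (Suc m)"
    by (simp add: ln2_rem_def algebra_simps power_mult_distrib[symmetric])
  ultimately show ?case by (simp only:)
qed

lemma ln2_rem_le: "\<bar>ln2_rem m\<bar> \<le> 1 / (real m + 1)"
proof -
  have "- ((-1) ^ m) * ln2_rem m \<le> 1 / (real m + 1)"
    using has_integral_ln2_rem[of m] has_integral_odd_power
  proof (rule has_integral_le)
    fix t :: real assume t: "t \<in> {0<..<1}"
    have "2 * t ^ (2 * m + 1) / (1 + t\<^sup>2) \<le> 2 * t ^ (2 * m + 1) / 1"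
      using t by (intro divide_left_mono) (auto simp: add_pos_nonneg)
    then show "2 * t ^ (2 * m + 1) / (1 + t\<^sup>2) \<le> 2 * t ^ (2 * m + 1)" by simp
  qed
  moreover have "0 \<le> - ((-1) ^ m) * ln2_rem m"
    using has_integral_ln2_rem[of m] by (rule has_integral_nonneg) (auto simp: add_nonneg_nonneg)
  moreover have "\<bar>ln2_rem m\<bar> = \<bar>- ((-1) ^ m) * ln2_rem m\<bar>"
    by (simp add: abs_mult)
  ultimately show ?thesis by simp
qed

text \<open>Dividing by \<open>1 - z\<^sup>2\<close> forms partial sums of coefficients. Subtracting
  \<open>ln 2\<close> makes the numerator vanish at \<open>z\<^sup>2 = 1\<close>, so the quotient
  has no pole there and its coefficients tend to 0. On the circle \<open>z / (1 - z\<^sup>2)\<close>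
  is \<open>\<i> / (2 * sin t)\<close>, the source of the factor \<open>1 / sin t\<close>.\<close>

lemma ln2_rem_series:
  fixes z :: complex
  assumes "norm z < 1"
  shows "(\<lambda>m. of_real (ln2_rem m) * z ^ (2 * m + 1)) sums (z * (Ln (1 + z\<^sup>2) - of_real (ln 2)) / (1 - z\<^sup>2))"
proof -
  define w where "w = z\<^sup>2"
  have w: "norm w < 1"
    using assms by (simp add: w_def norm_power power_less_one_iff abs_square_less_1)
  define b :: "nat \<Rightarrow> real" where "b i = - ((-1) ^ i) / real i + (if i = 0 then - ln 2 else 0)" for i
  have b_le: "\<bar>b i\<bar> \<le> 1" for i
    using ln_2_less_1 by (auto simp: b_def divide_le_eq)
  have b_sums: "(\<lambda>i. of_real (b i) * w ^ i) sums (Ln (1 + w) - of_real (ln 2))"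
  proof -
    have "(\<lambda>i. - ((- w) ^ i) / of_nat i + (if i = 0 then - of_real (ln 2) else 0)) sums (Ln (1 + w) + - of_real (ln 2))"
      using sums_single[of 0 "\<lambda>_. - complex_of_real (ln 2)"] by (intro sums_add Ln_series' w) auto
    moreover have "of_real (b i) * w ^ i = - ((- w) ^ i) / of_nat i + (if i = 0 then - of_real (ln 2) else 0)" for i
      by (cases "i = 0") (auto simp: b_def power_minus[of w])
    ultimately show ?thesis by simp
  qed
  have "summable (\<lambda>i. norm (of_real (b i) * w ^ i))"
  proof (rule summable_comparison_test')
    show "summable (\<lambda>i. norm w ^ i)" using w by (intro summable_geometric) auto
    show "norm (norm (of_real (b i) * w ^ i)) \<le> norm w ^ i" for i
      using mult_right_mono[OF b_le[of i], of "norm w ^ i"] by (simp add: norm_mult norm_power)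
  qed
  moreover have "summable (\<lambda>i. norm (w ^ i))"
    unfolding norm_power using w by (intro summable_geometric) auto
  ultimately have "(\<lambda>m. \<Sum>i\<le>m. (of_real (b i) * w ^ i) * w ^ (m - i)) sums
      ((\<Sum>i. of_real (b i) * w ^ i) * (\<Sum>i. w ^ i))"
    by (rule Cauchy_product_sums)
  moreover have "(\<Sum>i. of_real (b i) * w ^ i) = Ln (1 + w) - of_real (ln 2)"
    using b_sums by (simp add: sums_iff)
  moreover have "(\<Sum>i. w ^ i) = 1 / (1 - w)"
    using w by (rule suminf_geometric)
  moreover have "(\<Sum>i\<le>m. (of_real (b i) * w ^ i) * w ^ (m - i)) = of_real (ln2_rem m) * w ^ m" for m
  proof -
    \<comment> \<open>The coefficient at index 0 is \<open>- ln 2\<close>, its fraction being 0 by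
      division by zero; the sum up to \<open>m\<close> therefore contains exactly \<open>m\<close>
      terms of the alternating series.\<close>
    have "(\<Sum>i\<le>m. b i) = ln2_rem m"
      by (induction m) (simp_all add: b_def ln2_rem_def add.commute)
    moreover have "(\<Sum>i\<le>m. (of_real (b i) * w ^ i) * w ^ (m - i)) = (\<Sum>i\<le>m. of_real (b i) * w ^ m)"
      by (rule sum.cong) (simp_all add: mult.assoc power_add[symmetric])
    ultimately show ?thesis by (simp add: sum_distrib_right[symmetric] of_real_sum[symmetric] del: of_real_sum)
  qed
  ultimately have "(\<lambda>m. of_real (ln2_rem m) * w ^ m) sums ((Ln (1 + w) - of_real (ln 2)) * (1 / (1 - w)))"
    by simp
  from sums_mult[OF this, of z] show ?thesis
    by (simp add: w_def power_mult[symmetric] mult_ac)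
qed

text \<open>Near \<open>w = 1\<close> numerator and denominator are both small, and with
  \<open>v = (w - 1) / 2\<close> the numerator is \<open>Ln (1 + v)\<close>, at most of the size of
  \<open>1 - w\<close>. Elsewhere the denominator is at least 1 and only the logarithmic singularity
  at \<open>w = -1\<close> remains; \<open>\<psi>\<close> is the angular distance of
  \<open>w\<close> from it.\<close>

lemma ln2_rem_series_bound:
  assumes t: "0 < t" "t < pi / 2" and r: "0 < r" "r < 1"
  defines "z \<equiv> of_real r * cis t"
  shows "norm (z * (Ln (1 + z\<^sup>2) - of_real (ln 2)) / (1 - z\<^sup>2)) \<le> (6 + pi - ln (pi - 2 * t))\<^sup>2"
proof -
  define w where "w = z\<^sup>2"
  define \<psi> where "\<psi> = pi - 2 * t"
  have \<psi>: "0 < \<psi>" "\<psi> < pi" using t by (auto simp: \<psi>_def)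
  have z: "norm z < 1" using r by (simp add: z_def norm_mult)
  have "norm (z * (Ln (1 + w) - of_real (ln 2)) / (1 - w)) \<le> 6 + pi - ln \<psi>"
  proof (cases "norm (1 - w) < 1")
    case True
    define v where "v = (w - 1) / 2"
    have v: "norm v = norm (1 - w) / 2"
      by (simp add: v_def norm_divide norm_minus_commute)
    then have v_half: "norm v < 1 / 2" using True by simp
    have "w \<noteq> -1" using True by auto
    then have "Ln (1 + w) - of_real (ln 2) = Ln ((1 + w) / of_real 2)"
      by (subst Ln_divide_of_real) (auto simp: add_eq_0_iff)
    also have "(1 + w) / of_real 2 = 1 + v" by (simp add: v_def field_simps)
    finally have eq: "Ln (1 + w) - of_real (ln 2) = Ln (1 + v)" .
    have "norm (Ln (1 + v)) \<le> norm (Ln (1 + v) - v) + norm v"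
      using norm_triangle_ineq[of "Ln (1 + v) - v" v] by simp
    also have "norm (Ln (1 + v) - v) \<le> norm v ^ 2 / (1 - norm v)"
      using v_half by (intro Ln_approx_linear) auto
    also have "norm v ^ 2 / (1 - norm v) \<le> norm v"
    proof -
      have "norm v * norm v \<le> norm v * (1 - norm v)"
        using v_half by (intro mult_left_mono) auto
      then show ?thesis using v_half by (simp add: divide_le_eq power2_eq_square)
    qed
    finally have "norm (Ln (1 + v)) \<le> norm (1 - w)" using v by simp
    then have "norm z * norm (Ln (1 + v)) \<le> 1 * norm (1 - w)"
      using z by (intro mult_mono) auto
    then have "norm (z * (Ln (1 + w) - of_real (ln 2)) / (1 - w)) \<le> 1"
      unfolding eq norm_mult norm_divide by (cases "1 - w = 0") (auto simp: divide_le_eq)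
    then show ?thesis using minus_ln_le_square(1)[OF \<psi>] by linarith
  next
    case False
    \<comment> \<open>Up to conjugation \<open>1 + w\<close> is
      \<open>1 - r\<^sup>2 * cis \<psi>\<close>, which transfers the estimates around
      \<open>z = 1\<close> to the point \<open>w = -1\<close>.\<close>
    have "norm (1 + w) = norm (1 - of_real (r\<^sup>2) * cis \<psi>)"
    proof -
      have "1 - of_real (r\<^sup>2) * cis \<psi> = cnj (1 + w)"
        by (simp add: w_def z_def \<psi>_def power_mult_distrib Complex.DeMoivre complex_eq_iff cos_diff sin_diff)
      then show ?thesis by (metis complex_mod_cnj)
    qed
    moreover have "\<psi> / 4 \<le> norm (1 - of_real (r\<^sup>2) * cis \<psi>)" "norm (1 - of_real (r\<^sup>2) * cis \<psi>) \<le> 2"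
      using norm_one_minus_cis[of \<psi> "r\<^sup>2"] \<psi> r by (auto simp: power_le_one)
    ultimately have "norm (Ln (1 + w)) \<le> 3 + pi - ln (\<psi> / 2)"
      using \<psi> pi_less_4 by (intro norm_Ln_bound) auto
    moreover have "ln (\<psi> / 2) = ln \<psi> - ln 2" using \<psi> by (simp add: ln_div)
    moreover have "norm (Ln (1 + w) - of_real (ln 2)) \<le> norm (Ln (1 + w)) + ln 2"
      using norm_triangle_ineq4[of "Ln (1 + w)" "of_real (ln 2)"] by simp
    ultimately have le: "norm (Ln (1 + w) - of_real (ln 2)) \<le> 6 + pi - ln \<psi>"
      using ln_2_less_1 by linarith
    have "norm z * norm (Ln (1 + w) - of_real (ln 2)) \<le> 1 * (6 + pi - ln \<psi>)"
      using z le by (intro mult_mono) auto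
    also have "\<dots> \<le> (6 + pi - ln \<psi>) * norm (1 - w)"
      using False le order_trans[OF norm_ge_zero le] mult_left_mono[of 1 "norm (1 - w)" "6 + pi - ln \<psi>"] by simp
    finally show ?thesis
      using False unfolding norm_mult norm_divide by (subst pos_divide_le_eq) auto
  qed
  also have "6 + pi - ln \<psi> \<le> (6 + pi - ln \<psi>)\<^sup>2"
    by (rule minus_ln_le_square(2)[OF \<psi>])
  finally show ?thesis by (simp add: w_def \<psi>_def)
qed

lemma has_integral_square_sin:
  assumes p: "odd n"
  shows "((\<lambda>t. (pi/2 - t)\<^sup>2 * sin (real n * t)) has_integral pi\<^sup>2 / (4 * real n) - 2 / real n ^ 3) {0<..<pi/2}"
proof -
  define N where "N = real n"
  have "N > 0" using p by (auto simp: N_def intro!: Nat.gr0I)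
  define F where "F x = - (pi/2 - x)\<^sup>2 * cos (N * x) / N - 2 * (pi/2 - x) * sin (N * x) / N\<^sup>2 + 2 * cos (N * x) / N ^ 3" for x
  have "((\<lambda>t. (pi/2 - t)\<^sup>2 * sin (N * t)) has_integral (F (pi/2) - F 0)) {0<..<pi/2}"
  proof (rule has_integral_FTC_continuous)
    show "continuous_on {0..pi/2} F" unfolding F_def using \<open>N > 0\<close> by (intro continuous_intros) auto
    show "(F has_real_derivative (pi/2 - x)\<^sup>2 * sin (N * x)) (at x)" for x
      unfolding F_def using \<open>N > 0\<close>
      by (auto intro!: derivative_eq_intros simp: field_simps power2_eq_square power3_eq_cube)
  qed simp
  moreover have "cos (N * (pi / 2)) = 0"
    using p by (auto simp: N_def cos_zero_iff_int elim!: oddE intro!: exI[of _ "int n"])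
  ultimately show ?thesis by (simp add: N_def F_def power_divide)
qed

text \<open>The boundary value of the preceding series is
  \<open>(\<i> * ln (cos t) - t) / (2 * sin t)\<close>, and its imaginary part is half the wanted
  integrand. The bound on \<open>\<gamma>\<close>, together with that on \<open>ln2_rem\<close>,
  gives absolute convergence and is used again when the sum is moved under an integral.\<close>

lemma ln2_rem_fourier:
  defines "\<gamma> \<equiv> \<lambda>m. pi\<^sup>2 / (4 * real (2 * m + 1)) - 2 / real (2 * m + 1) ^ 3"
  shows "((\<lambda>t. (pi/2 - t)\<^sup>2 * (ln (cos t) / sin t)) has_integral 2 * (\<Sum>m. ln2_rem m * \<gamma> m)) {0<..<pi/2}"
    and "\<And>m. \<bar>\<gamma> m\<bar> \<le> (pi\<^sup>2 / 4 + 2) / (real m + 1)"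
proof -
  show \<gamma>_le: "\<bar>\<gamma> m\<bar> \<le> (pi\<^sup>2 / 4 + 2) / (real m + 1)" for m
  proof -
    define N where "N = real (2 * m + 1)"
    have N: "1 \<le> N" "real m + 1 \<le> N" by (auto simp: N_def)
    have "\<bar>pi\<^sup>2 / (4 * N)\<bar> \<le> pi\<^sup>2 / 4 / (real m + 1)"
      using N by (simp add: frac_le)
    moreover have "\<bar>2 / N ^ 3\<bar> \<le> 2 / (real m + 1)"
    proof -
      have "N \<le> N ^ 3" using N by (intro self_le_power) auto
      then have "real m + 1 \<le> N ^ 3" using N by linarith
      then show ?thesis using N by (simp add: frac_le)
    qed
    ultimately show ?thesis
      unfolding \<gamma>_def N_def[symmetric] add_divide_distrib by linarith
  qed
  define f where "f z = z * (Ln (1 + z\<^sup>2) - of_real (ln 2)) / (1 - z\<^sup>2)" for z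
  have cis_sq: "(cis t)\<^sup>2 = cis (2 * t)" for t
    by (simp add: Complex.DeMoivre)
  have "((\<lambda>t. (pi/2 - t)\<^sup>2 * Im (f (cis t))) has_integral (\<Sum>m. ln2_rem m * \<gamma> m)) {0<..<pi/2}"
  proof (rule has_integral_boundary_power_series[where p = "\<lambda>m. 2 * m + 1" and B = 1])
    show "(\<lambda>m. of_real (ln2_rem m) * z ^ (2 * m + 1)) sums f z" if "norm z < 1" for z
      unfolding f_def by (rule ln2_rem_series[OF that])
    have "1 / (real m + 1) \<le> 1" for m by simp
    then show "\<bar>ln2_rem m\<bar> \<le> 1" for m
      using ln2_rem_le[of m] order_trans by blast
    show "isCont f (cis t)" if "0 < t" "t < pi/2" for t
    proof -
      have "1 + (cis t)\<^sup>2 \<notin> \<real>\<^sub>\<le>\<^sub>0" "1 - (cis t)\<^sup>2 \<noteq> 0"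
        unfolding cis_sq using that one_plus_cis_not_nonpos[of "2 * t"] one_minus_cis_not_nonpos[of "2 * t"] by auto
      then show ?thesis unfolding f_def by (intro continuous_intros) auto
    qed
    show "norm (f (of_real r * cis t)) \<le> (6 + pi - ln (pi - 2 * t))\<^sup>2" if "0 < t" "t < pi/2" "0 < r" "r < 1" for t r
      unfolding f_def by (rule ln2_rem_series_bound[OF that])
    show "(\<lambda>t. (6 + pi - ln (pi - 2 * t))\<^sup>2) integrable_on {0<..<pi/2}"
    proof -
      obtain I where "((\<lambda>x. (6 + pi - ln x)\<^sup>2) has_integral I) {0<..<pi}"
        using integrable_minus_ln_square[of pi "6 + pi"] by auto
      from has_integral_mirror[OF has_integral_scale[OF this, of 2]]
      show ?thesis by (auto simp: integrable_on_def algebra_simps)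
    qed
    show "((\<lambda>t. (pi/2 - t)\<^sup>2 * Im (cis (real (2 * m + 1) * t))) has_integral \<gamma> m) {0<..<pi/2}" for m
      using has_integral_square_sin[of "2 * m + 1"] unfolding \<gamma>_def by simp
    show "summable (\<lambda>m. \<bar>ln2_rem m * \<gamma> m\<bar>)"
    proof (rule summable_comparison_test')
      have "summable (\<lambda>m. 1 / real (Suc m) ^ 2)"
        using zeta_nat_Suc_sums[of 2] by (simp add: sums_iff)
      then show "summable (\<lambda>m. (pi\<^sup>2 / 4 + 2) * (1 / real (Suc m) ^ 2))" by (rule summable_mult)
      show "norm \<bar>ln2_rem m * \<gamma> m\<bar> \<le> (pi\<^sup>2 / 4 + 2) * (1 / real (Suc m) ^ 2)" for m
      proof -
        have "\<bar>ln2_rem m\<bar> * \<bar>\<gamma> m\<bar> \<le> 1 / (real m + 1) * ((pi\<^sup>2 / 4 + 2) / (real m + 1))"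
          by (intro mult_mono ln2_rem_le \<gamma>_le) auto
        then show ?thesis by (simp add: abs_mult power2_eq_square add.commute)
      qed
    qed
  qed (auto intro!: continuous_intros bounded_linear_Im)
  from has_integral_mult_right[OF this, of 2]
  show "((\<lambda>t. (pi/2 - t)\<^sup>2 * (ln (cos t) / sin t)) has_integral 2 * (\<Sum>m. ln2_rem m * \<gamma> m)) {0<..<pi/2}"
  proof (rule has_integral_eq[rotated])
    fix t assume t: "t \<in> {0<..<pi/2}"
    have s: "sin t > 0" "cos t > 0" using t by (auto intro!: sin_gt_zero cos_gt_zero)
    have num: "Ln (1 + cis (2 * t)) - of_real (ln 2) = of_real (ln (cos t)) + \<i> * of_real t"
      using t s by (subst Ln_one_plus_cis) (auto simp: ln_mult)
    \<comment> \<open>This phase cancels that of \<open>1 - cis (2 * t)\<close> in its polar form,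
      so the denominator becomes the real number \<open>2 * sin t\<close>.\<close>
    have "cis t = \<i> * cis ((2 * t - pi) / 2)"
      by (simp add: complex_eq_iff diff_divide_distrib cos_diff sin_diff)
    then have "f (cis t) = (\<i> * (of_real (ln (cos t)) + \<i> * of_real t)) / of_real (2 * sin t)"
      unfolding f_def cis_sq num one_minus_cis_eq using s by simp
    also have "\<dots> = (\<i> * of_real (ln (cos t)) - of_real t) / of_real (2 * sin t)"
      by (simp add: algebra_simps)
    finally have "f (cis t) = (\<i> * of_real (ln (cos t)) - of_real t) / of_real (2 * sin t)" .
    then have "Im (f (cis t)) = ln (cos t) / (2 * sin t)"
      by (simp only: Im_divide_of_real) simp
    then show "2 * ((pi/2 - t)\<^sup>2 * Im (f (cis t))) = (pi/2 - t)\<^sup>2 * (ln (cos t) / sin t)"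
      by simp
  qed
qed

text \<open>For a chain \<open>a\<close>, \<open>f2\<close>, \<open>f3\<close> of iterated integrals
  against \<open>dt / t\<close>, both \<open>a * f3\<close> and \<open>f2\<^sup>2\<close> produce
  \<open>a * f2 / t\<close>; the coefficients 4 and -2 cancel it and leave a multiple of
  \<open>i\<close>. The square \<open>f2\<^sup>2\<close> is what becomes
  \<open>G\<^sup>2\<close>.\<close>

lemma DERIV_polylog_combination:
  fixes a f2 f3 :: "real \<Rightarrow> real"
  assumes d1: "(a has_real_derivative i) (at t)"
    and d2: "(f2 has_real_derivative a t / t) (at t)"
    and d3: "(f3 has_real_derivative f2 t / t) (at t)"
  shows "((\<lambda>t. - q * (a t)\<^sup>2 + 4 * (a t * f3 t) - 2 * (f2 t)\<^sup>2) has_real_derivative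
        - 2 * (q * a t - 2 * f3 t) * i) (at t)"
proof -
  have alg: "- q * (2 * (i * b)) + 4 * (i * T + X * b) - 4 * (b * X) = - 2 * (q * b - 2 * T) * i" for b T X :: real
    by algebra
  have "((\<lambda>t. - q * (a t)\<^sup>2 + 4 * (a t * f3 t) - 2 * (f2 t)\<^sup>2) has_real_derivative
    - q * (real 2 * (i * a t ^ (2 - Suc 0))) + 4 * (i * f3 t + f2 t / t * a t) - 2 * (real 2 * (a t / t * f2 t ^ (2 - Suc 0)))) (at t)"
    by (rule DERIV_diff[OF DERIV_add[OF DERIV_cmult[OF DERIV_power[OF d1]]
          DERIV_cmult[OF DERIV_mult[OF d1 d3]]] DERIV_cmult[OF DERIV_power[OF d2]]])
  also have "- q * (real 2 * (i * a t ^ (2 - Suc 0))) + 4 * (i * f3 t + f2 t / t * a t) - 2 * (real 2 * (a t / t * f2 t ^ (2 - Suc 0)))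
     = - q * (2 * (i * a t)) + 4 * (i * f3 t + f2 t / t * a t) - 4 * (a t * (f2 t / t))"
    by simp
  also have "\<dots> = - 2 * (q * a t - 2 * f3 t) * i"
    by (rule alg)
  finally show ?thesis .
qed

text \<open>Inserting the integral form of \<open>ln2_rem\<close> and summing over \<open>m\<close>
  gives \<open>pi\<^sup>2 / 4 * Ti 1 - 2 * Ti 3\<close> over \<open>1 + t\<^sup>2\<close>, where
  \<open>Ti 1 = arctan\<close>. This has an explicit primitive, and at \<open>t = 1\<close> the
  values \<open>pi / 4\<close>, \<open>G\<close> and \<open>pi ^ 3 / 32\<close> give the
  result.\<close>

lemma has_integral_catalan:
  "((\<lambda>t. (pi/2 - t)\<^sup>2 * (ln (cos t) / sin t)) has_integral (pi ^ 4 / 32 - 4 * catalan\<^sup>2)) {0<..<pi/2}"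
proof -
  define \<gamma> :: "nat \<Rightarrow> real" where "\<gamma> m = pi\<^sup>2 / (4 * real (2 * m + 1)) - 2 / real (2 * m + 1) ^ 3" for m
  define C where "C = pi\<^sup>2 / 4 + 2"
  have \<gamma>_le: "\<bar>\<gamma> m\<bar> \<le> C / (real m + 1)" for m
    using ln2_rem_fourier(2)[of m] by (simp add: \<gamma>_def C_def)
  define Ti where "Ti = pl (\<lambda>m. (-1) ^ m) (\<lambda>m. 2 * m + 1)"
  have e: "\<bar>(-1) ^ m\<bar> \<le> (1::real)" and p: "m < 2 * m + 1" for m :: nat by auto
  note Ti_sums = pl_sums[of "\<lambda>m. (-1) ^ m" "\<lambda>m. 2 * m + 1", OF e p, folded Ti_def]
  note Ti_deriv = pl_deriv[of "\<lambda>m. (-1) ^ m" "\<lambda>m. 2 * m + 1", OF e p, folded Ti_def]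
  note Ti_cont = pl_continuous[of "\<lambda>m. (-1) ^ m" "\<lambda>m. 2 * m + 1", OF e p, folded Ti_def]
  have Ti_1: "Ti 1 x = arctan x" if "0 \<le> x" "x < 1" for x
    using arctan_series[of x] that by (simp add: Ti_def pl_def add.commute mult.commute)
  have pos: "1 + t\<^sup>2 > 0" for t :: real by (simp add: add_pos_nonneg)
  let ?F = "\<lambda>t. - 2 * (pi\<^sup>2 / 4 * arctan t - 2 * Ti 3 t) / (1 + t\<^sup>2)"
  let ?g = "\<lambda>m t. C / (real m + 1) * (2 * t ^ (2 * m + 1))"
  let ?f = "\<lambda>m t. - ((-1) ^ m) * \<gamma> m * (2 * t ^ (2 * m + 1) / (1 + t\<^sup>2))"
  have "((\<lambda>t. ?F t) has_integral (\<Sum>m. ln2_rem m * \<gamma> m)) {0<..<1}"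
  proof (rule has_integral_sums_dominated(2))
    show "((\<lambda>t. ?f m t) has_integral ln2_rem m * \<gamma> m) {0<..<1}" for m
    proof -
      have "(-1) ^ m * (- 1) ^ m = (1::real)" by (simp add: power_mult_distrib[symmetric])
      then have "- ((-1) ^ m) * \<gamma> m * (- ((-1) ^ m) * ln2_rem m) = ln2_rem m * \<gamma> m"
        by (metis (no_types, lifting) minus_mult_minus mult.assoc mult.commute mult.left_neutral mult_minus_left)
      then show ?thesis
        using has_integral_mult_right[OF has_integral_ln2_rem[of m], of "- ((-1) ^ m) * \<gamma> m"] by (simp only:)
    qed
    show "((\<lambda>t. ?g m t) has_integral C / (real m + 1) * (1 / (real m + 1))) {0<..<1}" for m
      by (intro has_integral_mult_right has_integral_odd_power)
    show "\<bar>?f m t\<bar> \<le> ?g m t"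
      if t: "t \<in> {0<..<1}" for m t
    proof -
      have "2 * t ^ (2 * m + 1) / (1 + t\<^sup>2) \<le> 2 * t ^ (2 * m + 1) / 1"
        using t by (intro divide_left_mono) (auto simp: add_pos_nonneg)
      then have "\<bar>\<gamma> m\<bar> * (2 * t ^ (2 * m + 1) / (1 + t\<^sup>2)) \<le> ?g m t"
        using \<gamma>_le[of m] t pos[of t] by (intro mult_mono) (auto simp: C_def)
      then show ?thesis using t pos[of t] by (simp add: abs_mult)
    qed
    show "summable (\<lambda>m. ?g m t)" if t: "t \<in> {0<..<1}" for t
    proof (rule summable_comparison_test')
      show "summable (\<lambda>m. C * (2 * t ^ m))"
        using t by (intro summable_mult summable_geometric) auto
      fix m
      have "t ^ (2 * m + 1) \<le> t ^ m" using t by (intro power_decreasing) auto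
      moreover have "C / (real m + 1) \<le> C / 1" by (intro divide_left_mono) (auto simp: C_def)
      ultimately have "?g m t \<le> C * (2 * t ^ m)"
        using t by (intro mult_mono) (auto simp: C_def)
      then show "norm (?g m t) \<le> C * (2 * t ^ m)"
        using t by (simp add: C_def)
    qed
    have "summable (\<lambda>m. 1 / real (Suc m) ^ 2)"
        using zeta_nat_Suc_sums[of 2] by (simp add: sums_iff)
    then have "summable (\<lambda>m. C * (1 / real (Suc m) ^ 2))" by (rule summable_mult)
    then show "summable (\<lambda>m. C / (real m + 1) * (1 / (real m + 1)))"
      by (simp add: power2_eq_square add.commute)
    show "(\<lambda>m. ?f m t) sums (?F t)"
      if t: "t \<in> {0<..<1}" for t
    proof -
      let ?h = "\<lambda>m. - 2 * (pi\<^sup>2 / 4 * ((-1) ^ m * t ^ (2 * m + 1) / real (2 * m + 1) ^ 1)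
           - 2 * ((-1) ^ m * t ^ (2 * m + 1) / real (2 * m + 1) ^ 3)) / (1 + t\<^sup>2)"
      have "(\<lambda>m. ?h m)
         sums (- 2 * (pi\<^sup>2 / 4 * Ti 1 t - 2 * Ti 3 t) / (1 + t\<^sup>2))"
        using t by (intro sums_divide sums_mult sums_diff Ti_sums) auto
      moreover have "?h m
         = ?f m t" for m
      proof -
        define A N T where "A = (-1::real) ^ m" and "N = real (2 * m + 1)" and "T = t ^ (2 * m + 1)"
        have "N > 0" by (simp add: N_def)
        then show ?thesis
          unfolding \<gamma>_def A_def[symmetric] N_def[symmetric] T_def[symmetric]
          using pos[of t] by (simp add: field_simps)
      qed
      ultimately show ?thesis using Ti_1[of t] t by simp
    qed
  qed
  moreover have "((\<lambda>t. ?F t) has_integral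
     ((- (pi\<^sup>2 / 4) * (arctan 1)\<^sup>2 + 4 * (arctan 1 * Ti 3 1) - 2 * (Ti 2 1)\<^sup>2)
      - (- (pi\<^sup>2 / 4) * (arctan 0)\<^sup>2 + 4 * (arctan 0 * Ti 3 0) - 2 * (Ti 2 0)\<^sup>2))) {0<..<1}"
  proof (rule has_integral_FTC_continuous)
    show "continuous_on {0..1} (\<lambda>t. - (pi\<^sup>2 / 4) * (arctan t)\<^sup>2 + 4 * (arctan t * Ti 3 t) - 2 * (Ti 2 t)\<^sup>2)"
      by (intro continuous_intros Ti_cont) auto
    fix t :: real assume t: "0 < t" "t < 1"
    have d2: "(Ti 2 has_real_derivative arctan t / t) (at t)"
      using Ti_deriv[of t 1] Ti_1[of t] t by (simp add: numeral_2_eq_2)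
    have d3: "(Ti 3 has_real_derivative Ti 2 t / t) (at t)"
      using Ti_deriv[of t 2] t by (simp add: numeral_3_eq_3 numeral_2_eq_2)
    show "((\<lambda>t. - (pi\<^sup>2 / 4) * (arctan t)\<^sup>2 + 4 * (arctan t * Ti 3 t) - 2 * (Ti 2 t)\<^sup>2) has_real_derivative
        ?F t) (at t)"
      unfolding divide_inverse[of _ "1 + t\<^sup>2"] by (rule DERIV_polylog_combination[OF DERIV_arctan d2 d3])
  qed simp
  ultimately have eq: "(\<Sum>m. ln2_rem m * \<gamma> m) = (- (pi\<^sup>2 / 4) * (arctan 1)\<^sup>2 + 4 * (arctan 1 * Ti 3 1) - 2 * (Ti 2 1)\<^sup>2)
      - (- (pi\<^sup>2 / 4) * (arctan 0)\<^sup>2 + 4 * (arctan 0 * Ti 3 0) - 2 * (Ti 2 0)\<^sup>2)"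
    by (rule has_integral_unique)
  have "Ti 2 1 = catalan"
    by (simp add: Ti_def pl_def catalan_def add.commute)
  moreover have "Ti 3 1 = pi ^ 3 / 32"
    using beta_3_sums by (simp add: Ti_def pl_def sums_iff add.commute)
  moreover have "Ti 2 0 = 0" by (simp add: Ti_def pl_def)
  ultimately have "2 * (\<Sum>m. ln2_rem m * \<gamma> m) = pi ^ 4 / 32 - 4 * catalan\<^sup>2"
    unfolding eq by (simp add: arctan_one eval_nat_numeral)
  then show ?thesis
    using ln2_rem_fourier(1) by (simp add: \<gamma>_def)
qed

text \<open>With \<open>y = tan (t / 2)\<close>, so that
  \<open>dt = 2 * dy / (1 + y\<^sup>2)\<close>, the geometric series evaluates the integral of
  \<open>ln\<^sup>2 y\<close> as \<open>4 * beta(3)\<close>. The part with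
  \<open>t * ln\<^sup>2 y\<close> is integrated by parts to \<open>- t\<^sup>2 * ln y / y\<close>,
  and \<open>t\<^sup>2 = (2 * arctan y)\<^sup>2\<close> expands with odd harmonic coefficients,
  which gives \<open>- aosum\<close>.\<close>

lemma has_integral_ln_tan_square:
  "((\<lambda>t. (pi/2 - t) * ln (tan (t / 2)) ^ 2) has_integral (pi ^ 4 / 16 + aosum)) {0<..<pi/2}"
proof -
  define y where "y t = tan (t / 2)" for t :: real
  define y' where "y' t = (1 + (y t)\<^sup>2) / 2" for t
  have dy: "(y has_real_derivative y' t) (at t)" if "0 < t" "t < pi/2" for t
  proof -
    have c: "cos (t / 2) \<noteq> 0"
      using that cos_gt_zero[of "t / 2"] by simp
    have "((\<lambda>t. tan (t / 2)) has_real_derivative inverse ((cos (t / 2))\<^sup>2) * (1 / 2)) (at t)"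
      by (rule DERIV_chain2[where f = tan and g = "\<lambda>t. t / 2", OF DERIV_tan[OF c]]) (auto intro!: derivative_eq_intros)
    moreover have "inverse ((cos (t / 2))\<^sup>2) * (1 / 2) = y' t"
      unfolding y'_def y_def using tan_sec[OF c] by (simp add: power_inverse)
    ultimately show ?thesis by (simp add: y_def[abs_def])
  qed
  have y_pos: "0 < y t" if "0 < t" "t < pi/2" for t
    unfolding y_def using that by (intro tan_gt_zero) auto
  have y_less: "y t < 1" if "0 < t" "t < pi/2" for t
    unfolding y_def using that tan_monotone'[of "t / 2" "pi / 4"] by (auto simp: tan_45)
  have y'_pos: "0 < y' t" for t
    by (simp add: y'_def add_pos_nonneg)
  have lim0: "(y \<longlongrightarrow> 0) (at_right 0)"
  proof -
    have "(y \<longlongrightarrow> tan (0 / 2)) (at_right 0)"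
      unfolding y_def by (intro tendsto_intros) auto
    then show ?thesis by simp
  qed
  have lim1: "(y \<longlongrightarrow> 1) (at_left (pi/2))"
  proof -
    have "(y \<longlongrightarrow> tan (pi / 2 / 2)) (at_left (pi/2))"
      unfolding y_def by (intro tendsto_intros) (auto simp: cos_45)
    then show ?thesis by (simp add: tan_45)
  qed
  note pow1 = has_integral_power_ln_1[where y = y and y' = y' and \<alpha> = 0 and \<beta> = "pi/2" and \<mu> = 0, OF _ dy y_pos lim0 lim1, simplified]
  note pow2 = has_integral_power_ln_2[where y = y and y' = y' and \<alpha> = 0 and \<beta> = "pi/2" and \<mu> = 0, OF _ dy y_pos lim0 lim1, simplified]
  have geo: "(\<lambda>m. (y t) ^ (2 * m)) sums (1 / (1 - (y t)\<^sup>2))" "(\<lambda>m. (-1) ^ m * (y t) ^ (2 * m)) sums (1 / (1 + (y t)\<^sup>2))"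
    if "0 < t" "t < pi/2" for t
  proof -
    have "\<bar>(y t)\<^sup>2\<bar> < 1"
      using y_pos[OF that] y_less[OF that] by (simp add: abs_square_less_1)
    then show "(\<lambda>m. (y t) ^ (2 * m)) sums (1 / (1 - (y t)\<^sup>2))"
      "(\<lambda>m. (-1) ^ m * (y t) ^ (2 * m)) sums (1 / (1 + (y t)\<^sup>2))"
      using geometric_sums[of "(y t)\<^sup>2"] geometric_sums[of "- (y t)\<^sup>2"]
      by (simp_all add: power_mult power_minus[of "(y t)\<^sup>2"])
  qed
  let ?f = "\<lambda>m t. 2 * (-1) ^ m * (y' t * (y t ^ (2 * m) * ln (y t) ^ 2))"
  let ?g = "\<lambda>m t. 2 * (y' t * (y t ^ (2 * m) * ln (y t) ^ 2))"
  have I1: "((\<lambda>t. ln (y t) ^ 2) has_integral (\<Sum>m. 4 * ((-1) ^ m / (2 * real m + 1) ^ 3))) {0<..<pi/2}"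
  proof (rule has_integral_sums_dominated(2))
    show "((\<lambda>t. ?f m t) has_integral 4 * ((-1) ^ m / (2 * real m + 1) ^ 3)) {0<..<pi/2}" for m
      using has_integral_mult_right[OF pow2[of "2 * m"], of "2 * (-1) ^ m"] by (simp add: mult_ac)
    show "((\<lambda>t. ?g m t) has_integral 4 / (2 * real m + 1) ^ 3) {0<..<pi/2}" for m
      using has_integral_mult_right[OF pow2[of "2 * m"], of 2] by simp
    show "\<bar>?f m t\<bar> \<le> ?g m t"
      if "t \<in> {0<..<pi/2}" for m t
      using that y_pos[of t] y'_pos[of t] by (simp add: abs_mult power_abs)
    show "summable (\<lambda>m. ?g m t)" if "t \<in> {0<..<pi/2}" for t
      using geo(1)[of t] that by (intro summable_mult summable_mult2) (auto simp: sums_iff)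
    show "summable (\<lambda>m. 4 / (2 * real m + 1) ^ 3)"
    proof (rule summable_comparison_test')
      have "summable (\<lambda>m. 1 / real (Suc m) ^ 3)"
        using zeta_nat_Suc_sums[of 3] by (simp add: sums_iff)
      then show "summable (\<lambda>m. 4 * (1 / real (Suc m) ^ 3))" by (rule summable_mult)
      show "norm (4 / (2 * real m + 1) ^ 3) \<le> 4 * (1 / real (Suc m) ^ 3)" for m
        by (auto intro!: divide_left_mono power_mono)
    qed
    show "(\<lambda>m. ?f m t) sums (ln (y t) ^ 2)" if "t \<in> {0<..<pi/2}" for t
    proof -
      have "(\<lambda>m. 2 * y' t * ln (y t) ^ 2 * ((-1) ^ m * (y t) ^ (2 * m))) sums (2 * y' t * ln (y t) ^ 2 * (1 / (1 + (y t)\<^sup>2)))"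
        using geo(2)[of t] that by (intro sums_mult) auto
      moreover have "2 * y' t * ln (y t) ^ 2 * (1 / (1 + (y t)\<^sup>2)) = ln (y t) ^ 2"
      proof -
        have "1 + (y t)\<^sup>2 > 0" by (simp add: add_pos_nonneg)
        then show ?thesis by (simp add: y'_def)
      qed
      ultimately show ?thesis by (simp add: mult_ac)
    qed
  qed
  have I1_val: "(\<Sum>m. 4 * ((-1) ^ m / (2 * real m + 1) ^ 3)) = pi ^ 3 / 8"
    using sums_mult[OF beta_3_sums, of 4] by (simp add: sums_iff)
  let ?f = "\<lambda>m t. - 4 * ((-1) ^ Suc m * (odd_harm 1 (Suc m) / real (Suc m))) * (y' t * (y t ^ (2 * m + 1) * ln (y t)))"
  let ?g = "\<lambda>m t. - 4 * (odd_harm 1 (Suc m) / real (Suc m)) * (y' t * (y t ^ (2 * m + 1) * ln (y t)))"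
  have I2: "((\<lambda>t. t\<^sup>2 * (ln (y t) * y' t / y t)) has_integral (\<Sum>m. (-1) ^ Suc m * (odd_harm 1 (Suc m) / real (Suc m) ^ 3))) {0<..<pi/2}"
  proof (rule has_integral_sums_dominated(2))
    have "((\<lambda>t. y' t * (y t ^ (2 * m + 1) * ln (y t))) has_integral - 1 / (4 * real (Suc m) ^ 2)) {0<..<pi/2}" for m
    proof -
      have "(1 + (1 + 2 * real m))\<^sup>2 = 4 * (real (Suc m))\<^sup>2"
        by (simp add: power2_eq_square algebra_simps)
      then show ?thesis using pow1[of "2 * m + 1"] by (simp add: add_ac)
    qed
    note base = this
    show "((\<lambda>t. ?f m t)
       has_integral (-1) ^ Suc m * (odd_harm 1 (Suc m) / real (Suc m) ^ 3)) {0<..<pi/2}" for m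
      using has_integral_mult_right[OF base[of m], of "- 4 * ((-1) ^ Suc m * (odd_harm 1 (Suc m) / real (Suc m)))"]
      by (simp add: power2_eq_square power3_eq_cube mult.assoc del: of_nat_Suc)
    show "((\<lambda>t. ?g m t)
       has_integral odd_harm 1 (Suc m) / real (Suc m) ^ 3) {0<..<pi/2}" for m
      using has_integral_mult_right[OF base[of m], of "- 4 * (odd_harm 1 (Suc m) / real (Suc m))"]
      by (simp add: power2_eq_square power3_eq_cube mult.assoc del: of_nat_Suc)
    show "\<bar>?f m t\<bar>
        \<le> ?g m t"
      if "t \<in> {0<..<pi/2}" for m t
    proof -
      have "ln (y t) < 0" using that y_pos[of t] y_less[of t] by simp
      then show ?thesis
        using that y_pos[of t] y'_pos[of t] odd_harm_1_le(1)[of "Suc m"]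
        by (simp add: abs_mult power_abs del: of_nat_Suc)
    qed
    show "summable (\<lambda>m. odd_harm 1 (Suc m) / real (Suc m) ^ 3)"
      using osum_sums by (subst summable_Suc_iff) (simp add: sums_iff)
    show "summable (\<lambda>m. ?g m t)"
      if "t \<in> {0<..<pi/2}" for t
    proof (rule summable_comparison_test')
      have y: "0 < y t" "y t < 1" using that y_pos[of t] y_less[of t] by auto
      then have l: "ln (y t) < 0" by simp
      show "summable (\<lambda>m. 4 * (y' t * (- ln (y t))) * y t ^ m)"
        using y by (intro summable_mult summable_geometric) auto
      fix m
      have "odd_harm 1 (Suc m) / real (Suc m) \<le> 1"
        using odd_harm_1_le(2)[of "Suc m"] by (simp add: divide_le_eq del: of_nat_Suc)
      moreover have "y t ^ (2 * m + 1) \<le> y t ^ m" using y by (intro power_decreasing) auto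
      ultimately have "odd_harm 1 (Suc m) / real (Suc m) * y t ^ (2 * m + 1) \<le> 1 * y t ^ m"
        using y by (intro mult_mono) auto
      then have "4 * (y' t * (- ln (y t))) * (odd_harm 1 (Suc m) / real (Suc m) * y t ^ (2 * m + 1)) \<le> 4 * (y' t * (- ln (y t))) * (1 * y t ^ m)"
        using y'_pos[of t] l by (intro mult_left_mono) (auto intro!: mult_nonneg_nonneg mult_nonneg_nonpos)
      then show "norm (?g m t) \<le> 4 * (y' t * (- ln (y t))) * y t ^ m"
        using y y'_pos[of t] l odd_harm_1_le(1)[of "Suc m"]
        by (simp add: abs_mult power_abs mult_ac del: of_nat_Suc)
    qed
    show "(\<lambda>m. ?f m t)
      sums (t\<^sup>2 * (ln (y t) * y' t / y t))" if t: "t \<in> {0<..<pi/2}" for t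
    proof -
      have y: "0 < y t" "y t < 1" using t y_pos[of t] y_less[of t] by auto
      have c: "cos (t / 2) > 0" using t by (intro cos_gt_zero) auto
      \<comment> \<open>At \<open>z = \<i> * y\<close> the squared artanh series becomes that of the
        squared arctangent: \<open>1 + z\<close> and \<open>1 - z\<close> have equal modulus and
        angles \<open>t / 2\<close> and \<open>- t / 2\<close>, so the difference of logarithms is
        \<open>- \<i> * t\<close>.\<close>
      define z where "z = \<i> * of_real (y t)"
      have "1 + z = of_real (1 / cos (t / 2)) * cis (t / 2)"
        using c by (simp add: z_def y_def tan_def complex_eq_iff)
      moreover have "1 - z = of_real (1 / cos (t / 2)) * cis (- (t / 2))"
        using c by (simp add: z_def y_def tan_def complex_eq_iff)
      ultimately have "Ln (1 - z) - Ln (1 + z) = (of_real (ln (1 / cos (t / 2))) + \<i> * of_real (- (t / 2)))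
          - (of_real (ln (1 / cos (t / 2))) + \<i> * of_real (t / 2))"
        using c t Ln_of_real_times_cis[of "1 / cos (t / 2)" "- (t / 2)"]
          Ln_of_real_times_cis[of "1 / cos (t / 2)" "t / 2"] by (simp del: of_real_divide of_real_minus)
      also have "\<dots> = - (\<i> * of_real t)" by (simp add: field_simps)
      finally have "(\<lambda>m. of_real (4 * odd_harm 1 m / real m) * z ^ (2 * m)) sums (- (\<i> * of_real t))\<^sup>2"
        using artanh_square_sums[of z] y by (simp add: z_def norm_mult)
      moreover have "of_real (4 * odd_harm 1 m / real m) * z ^ (2 * m) = complex_of_real (4 * (-1) ^ m * (odd_harm 1 m / real m) * y t ^ (2 * m))" for m
        by (simp add: z_def power_mult_distrib power_mult power_minus[of "(complex_of_real (y t))\<^sup>2"])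
      moreover have "(- (\<i> * of_real t))\<^sup>2 = complex_of_real (- t\<^sup>2)"
        by (simp add: power_mult_distrib)
      ultimately have "(\<lambda>m. 4 * (-1) ^ m * (odd_harm 1 m / real m) * y t ^ (2 * m)) sums (- t\<^sup>2)"
        by (simp only: sums_of_real_iff)
      then have "(\<lambda>m. 4 * (-1) ^ Suc m * (odd_harm 1 (Suc m) / real (Suc m)) * y t ^ (2 * Suc m)) sums (- t\<^sup>2)"
        by (subst sums_Suc_iff) simp
      from sums_mult[OF this, of "- (ln (y t) * y' t / y t)"]
      show ?thesis using y by (simp add: mult_ac del: of_nat_Suc)
    qed
  qed
  have I2_val: "(\<Sum>m. (-1) ^ Suc m * (odd_harm 1 (Suc m) / real (Suc m) ^ 3)) = aosum"
  proof -
    have "(\<lambda>m. (-1) ^ Suc m * (odd_harm 1 (Suc m) / real (Suc m) ^ 3)) sums aosum"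
      using aosum_sums by (subst sums_Suc_iff) simp
    then show ?thesis by (simp only: sums_iff)
  qed
  \<comment> \<open>Integration by parts through the primitive
    \<open>t\<^sup>2 * ln\<^sup>2 y\<close>, which vanishes at both ends since \<open>y\<close>
    tends to 1 at \<open>pi/2\<close>.\<close>
  have I3: "((\<lambda>t. 2 * (t * ln (y t) ^ 2) + 2 * (t\<^sup>2 * (ln (y t) * y' t / y t))) has_integral (0 - 0)) {0<..<pi/2}"
  proof (rule has_integral_FTC_limits)
    show "((\<lambda>t. t\<^sup>2 * ln (y t) ^ 2) \<longlongrightarrow> 0) (at_right 0)"
      unfolding y_def by real_asymp
    have "((\<lambda>t. t\<^sup>2 * ln (y t) ^ 2) \<longlongrightarrow> (pi/2)\<^sup>2 * ln 1 ^ 2) (at_left (pi/2))"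
      by (intro tendsto_intros lim1) auto
    then show "((\<lambda>t. t\<^sup>2 * ln (y t) ^ 2) \<longlongrightarrow> 0) (at_left (pi/2))" by simp
    show "((\<lambda>t. t\<^sup>2 * ln (y t) ^ 2) has_real_derivative
      2 * (t * ln (y t) ^ 2) + 2 * (t\<^sup>2 * (ln (y t) * y' t / y t))) (at t)" if "0 < t" "t < pi/2" for t
      using dy[OF that] y_pos[OF that] by (auto intro!: derivative_eq_intros simp: divide_inverse)
  qed simp
  have "((\<lambda>t. pi/2 * ln (y t) ^ 2 - ((2 * (t * ln (y t) ^ 2) + 2 * (t\<^sup>2 * (ln (y t) * y' t / y t))) / 2
        - t\<^sup>2 * (ln (y t) * y' t / y t)))
     has_integral (pi/2 * (pi ^ 3 / 8) - ((0 - 0) / 2 - aosum))) {0<..<pi/2}"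
    using I1[unfolded I1_val] I2[unfolded I2_val] I3
    by (intro has_integral_diff has_integral_mult_right has_integral_divide)
  then have "((\<lambda>t. (pi/2 - t) * ln (y t) ^ 2) has_integral (pi/2 * (pi ^ 3 / 8) - ((0 - 0) / 2 - aosum))) {0<..<pi/2}"
    by (rule has_integral_eq[rotated]) (simp add: algebra_simps)
  moreover have "pi/2 * (pi ^ 3 / 8) - ((0 - 0) / 2 - aosum) = pi ^ 4 / 16 + aosum"
    by (simp add: eval_nat_numeral)
  ultimately show ?thesis unfolding y_def by (simp only:)
qed

text \<open>Two evaluations of the integral of \<open>(pi/2 - t) * ln\<^sup>2 (tan (t/2))\<close>, by Fourier series
  and by powers of \<open>tan (t/2)\<close>, agree.\<close>

lemma aosum_eq: "aosum = osum / 2 - pi ^ 4 / 64"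
proof -
  have "((\<lambda>t. pi/2 - t) has_integral pi\<^sup>2 / 8) {0<..<pi/2}"
    using has_integral_compl_phi_cos[of 0] by simp
  from has_integral_diff[OF has_integral_ln_tan_square has_integral_mult_right[OF this, of "pi\<^sup>2 / 4"]]
  have "((\<lambda>t. (pi/2 - t) * (ln (tan (t / 2)) ^ 2 - pi\<^sup>2 / 4)) has_integral (pi ^ 4 / 16 + aosum - pi\<^sup>2 / 4 * (pi\<^sup>2 / 8))) {0<..<pi/2}"
    by (rule has_integral_eq[rotated]) (simp add: algebra_simps)
  then have "pi ^ 4 / 16 + aosum - pi\<^sup>2 / 4 * (pi\<^sup>2 / 8) = osum - aosum"
    using has_integral_ln_tan_square_fourier by (rule has_integral_unique)
  then show ?thesis by (simp add: eval_nat_numeral)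
qed

section \<open>The alternating Euler sum \<open>ahsum\<close>\<close>

lemma has_integral_over_one_plus:
  fixes L :: "real \<Rightarrow> real"
  assumes base: "\<And>m. ((\<lambda>x. x ^ m * L x) has_integral C / (real m + 1) ^ k) {0<..<1}"
    and sign: "\<And>x. 0 < x \<Longrightarrow> x < 1 \<Longrightarrow> \<bar>L x\<bar> = \<epsilon> * L x" and k: "2 \<le> k"
  shows "((\<lambda>x. L x / (1 + x)) has_integral C * ((1 - 2 / 2 ^ k) * zeta_nat k)) {0<..<1}"
proof -
  have sum: "(\<lambda>m. (-1) ^ m / (real m + 1) ^ k) sums ((1 - 2 / 2 ^ k) * zeta_nat k)"
  proof -
    have "(\<lambda>n. (-1) ^ n / real n ^ k) sums ((2 / 2 ^ k - 1) * zeta_nat k)"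
      by (rule alternating_zeta_sums[OF k])
    then have "(\<lambda>m. (-1) ^ Suc m / real (Suc m) ^ k) sums ((2 / 2 ^ k - 1) * zeta_nat k)"
      using k by (subst sums_Suc_iff) (simp add: power_0_left)
    from sums_minus[OF this] show ?thesis by (simp add: algebra_simps add.commute)
  qed
  have "((\<lambda>x. L x / (1 + x)) has_integral (\<Sum>m. (-1) ^ m * (C / (real m + 1) ^ k))) {0<..<1}"
  proof (rule has_integral_sums_dominated(2))
    show "((\<lambda>x. (-1) ^ m * (x ^ m * L x)) has_integral (-1) ^ m * (C / (real m + 1) ^ k)) {0<..<1}" for m
      by (intro has_integral_mult_right base)
    \<comment> \<open>\<open>\<epsilon>\<close> is the constant sign of \<open>L\<close>, so the
      majorant \<open>x ^ m * \<bar>L x\<bar>\<close> has moments of the same form, summable because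
      \<open>2 \<le> k\<close>.\<close>
    show "((\<lambda>x. \<epsilon> * (x ^ m * L x)) has_integral \<epsilon> * (C / (real m + 1) ^ k)) {0<..<1}" for m
      by (intro has_integral_mult_right base)
    show "\<bar>(-1) ^ m * (x ^ m * L x)\<bar> \<le> \<epsilon> * (x ^ m * L x)" if "x \<in> {0<..<1}" for m x
      using that sign[of x] by (simp add: abs_mult power_abs)
    show "summable (\<lambda>m. \<epsilon> * (x ^ m * L x))" if "x \<in> {0<..<1}" for x
      using that by (intro summable_mult summable_mult2 summable_geometric) auto
    have "summable (\<lambda>m. 1 / real (Suc m) ^ k)" using zeta_nat_Suc_sums[OF k] by (simp add: sums_iff)
    from summable_mult[OF this, of "\<epsilon> * C"] show "summable (\<lambda>m. \<epsilon> * (C / (real m + 1) ^ k))"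
      by (simp add: add.commute)
    show "(\<lambda>m. (-1) ^ m * (x ^ m * L x)) sums (L x / (1 + x))" if "x \<in> {0<..<1}" for x
    proof -
      have "(\<lambda>m. L x * (- x) ^ m) sums (L x * (1 / (1 - (- x))))"
        using that by (intro sums_mult geometric_sums) auto
      then show ?thesis by (simp add: power_minus[of x] mult_ac)
    qed
  qed
  moreover have "(\<Sum>m. (-1) ^ m * (C / (real m + 1) ^ k)) = C * ((1 - 2 / 2 ^ k) * zeta_nat k)"
    using sums_mult[OF sum, of C] by (simp add: sums_iff mult_ac)
  ultimately show ?thesis by simp
qed

lemma
  shows has_integral_ln_over_one_plus: "((\<lambda>x. ln x / (1 + x)) has_integral - (zeta_nat 2 / 2)) {0<..<1::real}" (is ?A)
    and has_integral_ln_square_over_one_plus: "((\<lambda>x. ln x ^ 2 / (1 + x)) has_integral 3 / 2 * zeta_nat 3) {0<..<1::real}" (is ?B)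
    and has_integral_ln_cube_over_one_plus: "((\<lambda>x. ln x ^ 3 / (1 + x)) has_integral - (21 / 4 * zeta_nat 4)) {0<..<1::real}" (is ?C)
proof -
  have lims: "((\<lambda>x. x) \<longlongrightarrow> 0) (at_right (0::real))" "((\<lambda>x. x) \<longlongrightarrow> 1) (at_left (1::real))"
    by (auto intro: tendsto_ident_at)
  note pow1 = has_integral_power_ln_1[where y = "\<lambda>x. x" and y' = "\<lambda>_. 1" and \<alpha> = 0 and \<beta> = 1 and \<mu> = 0, OF _ _ _ lims, simplified]
  note pow2 = has_integral_power_ln_2[where y = "\<lambda>x. x" and y' = "\<lambda>_. 1" and \<alpha> = 0 and \<beta> = 1 and \<mu> = 0, OF _ _ _ lims, simplified]
  note pow3 = has_integral_power_ln_3[where y = "\<lambda>x. x" and y' = "\<lambda>_. 1" and \<alpha> = 0 and \<beta> = 1 and \<mu> = 0, OF _ _ _ lims, simplified]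
  have "((\<lambda>x. ln x / (1 + x)) has_integral (-1) * ((1 - 2 / 2 ^ 2) * zeta_nat 2)) {0<..<1::real}"
    by (rule has_integral_over_one_plus[where \<epsilon> = "-1"]) (use pow1 in auto)
  then show ?A by simp
  have "((\<lambda>x. ln x ^ 2 / (1 + x)) has_integral 2 * ((1 - 2 / 2 ^ 3) * zeta_nat 3)) {0<..<1::real}"
    by (rule has_integral_over_one_plus[where \<epsilon> = 1]) (use pow2 in auto)
  then show ?B by simp
  have "((\<lambda>x. ln x ^ 3 / (1 + x)) has_integral (-6) * ((1 - 2 / 2 ^ 4) * zeta_nat 4)) {0<..<1::real}"
    by (rule has_integral_over_one_plus[where \<epsilon> = "-1"])
       (use pow3 in \<open>auto simp: abs_if power3_eq_cube mult_less_0_iff zero_less_mult_iff\<close>)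
  then show ?C by simp
qed

text \<open>The squared logarithm series at \<open>z = - x\<close> expands
  \<open>ln (1 + x) ^ 2\<close> with coefficients \<open>2 * (-1) ^ n * harm (n - 1) / n\<close>,
  and the integral of \<open>x ^ (n - 1) * ln x\<close> supplies
  \<open>- 1 / n\<^sup>2\<close>.\<close>

lemma has_integral_ahsum:
  "((\<lambda>x. ln x * ln (1 + x) ^ 2 / x) has_integral - 2 * ahsum) {0<..<1::real}"
proof -
  have lims: "((\<lambda>x. x) \<longlongrightarrow> 0) (at_right (0::real))" "((\<lambda>x. x) \<longlongrightarrow> 1) (at_left (1::real))"
    by (auto intro: tendsto_ident_at)
  note pow1 = has_integral_power_ln_1[where y = "\<lambda>x. x" and y' = "\<lambda>_. 1" and \<alpha> = 0 and \<beta> = 1 and \<mu> = 0, OF _ _ _ lims, simplified]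
  define a :: "nat \<Rightarrow> real" where "a m = 2 * harm m / (real m + 1)" for m
  have a: "0 \<le> a m" "a m \<le> 2" for m
    using harm_le[of m] harm_nonneg[of m, where 'a = real] by (auto simp: a_def divide_le_eq)
  have "((\<lambda>x. ln x * ln (1 + x) ^ 2 / x) has_integral (\<Sum>m. (-1) ^ Suc m * a m * - (1 / (real m + 1) ^ 2))) {0<..<1::real}"
  proof (rule has_integral_sums_dominated(2))
    show "((\<lambda>x. (-1) ^ Suc m * a m * (x ^ m * ln x)) has_integral (-1) ^ Suc m * a m * - (1 / (real m + 1) ^ 2)) {0<..<1}" for m
      by (intro has_integral_mult_right pow1)
    show "((\<lambda>x. - a m * (x ^ m * ln x)) has_integral - a m * - (1 / (real m + 1) ^ 2)) {0<..<1}" for m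
      by (intro has_integral_mult_right pow1)
    show "\<bar>(-1) ^ Suc m * a m * (x ^ m * ln x)\<bar> \<le> - a m * (x ^ m * ln x)" if "x \<in> {0<..<1}" for m x
      using that a[of m] by (simp add: abs_mult power_abs)
    show "summable (\<lambda>m. - a m * (x ^ m * ln x))" if "x \<in> {0<..<1}" for x
    proof (rule summable_comparison_test')
      show "summable (\<lambda>m. 2 * (- ln x) * x ^ m)"
        using that by (intro summable_mult summable_geometric) auto
      fix m
      have "a m * ((- ln x) * x ^ m) \<le> 2 * ((- ln x) * x ^ m)"
        using a[of m] that by (intro mult_right_mono mult_nonneg_nonneg) auto
      then show "norm (- a m * (x ^ m * ln x)) \<le> 2 * (- ln x) * x ^ m"
        using a[of m] that by (simp add: abs_mult power_abs mult_ac)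
    qed
    have "summable (\<lambda>m. harm (Suc m - 1) / real (Suc m) ^ 3)"
      using hsum_sums by (subst summable_Suc_iff) (simp add: sums_iff)
    from summable_mult[OF this, of 2] show "summable (\<lambda>m. - a m * - (1 / (real m + 1) ^ 2))"
      by (simp add: a_def eval_nat_numeral add.commute)
    show "(\<lambda>m. (-1) ^ Suc m * a m * (x ^ m * ln x)) sums (ln x * ln (1 + x) ^ 2 / x)" if x: "x \<in> {0<..<1}" for x
    proof -
      have "(\<lambda>n. of_real (2 * harm (n - 1) / real n) * (- of_real x) ^ n) sums (Ln (1 - (- of_real x)))\<^sup>2"
        using x by (intro Ln_one_minus_square_sums) auto
      moreover have "Ln (1 - (- of_real x)) = of_real (ln (1 + x))"
        using x Ln_of_real[of "1 + x"] by simp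
      moreover have "of_real (2 * harm (n - 1) / real n) * (- of_real x) ^ n = complex_of_real ((-1) ^ n * (2 * harm (n - 1) / real n) * x ^ n)" for n
        by (simp add: power_minus[of "complex_of_real x"])
      ultimately have "(\<lambda>n. (-1) ^ n * (2 * harm (n - 1) / real n) * x ^ n) sums (ln (1 + x))\<^sup>2"
        by (simp only: sums_of_real_iff of_real_power[symmetric])
      then have "(\<lambda>m. (-1) ^ Suc m * (2 * harm (Suc m - 1) / real (Suc m)) * x ^ Suc m) sums (ln (1 + x))\<^sup>2"
        by (subst sums_Suc_iff) simp
      from sums_mult[OF this, of "ln x / x"] show ?thesis
        using x by (simp add: a_def mult_ac add.commute)
    qed
  qed
  moreover have "(\<lambda>m. (-1) ^ Suc m * a m * - (1 / (real m + 1) ^ 2)) sums (- 2 * ahsum)"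
  proof -
    have "(\<lambda>m. (-1) ^ Suc m * (harm (Suc m - 1) / real (Suc m) ^ 3)) sums ahsum"
      using ahsum_sums by (subst sums_Suc_iff) simp
    from sums_mult[OF this, of "- 2"] show ?thesis
      by (simp add: a_def eval_nat_numeral add.commute mult_ac)
  qed
  ultimately show ?thesis by (simp only: sums_iff)
qed

lemma Li4_half_sums: "(\<lambda>k. (1/2) ^ Suc k / real (Suc k) ^ 4) sums Li4 (1/2)"
  unfolding Li4_def
proof (rule summable_sums, rule summable_comparison_test')
  show "summable (\<lambda>k. (1/2) ^ k :: real)" by (intro summable_geometric) auto
  show "norm ((1/2) ^ Suc k / real (Suc k) ^ 4) \<le> (1/2::real) ^ k" for k
  proof -
    have "(1/2) ^ Suc k / real (Suc k) ^ 4 \<le> (1/2) ^ Suc k / 1"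
      by (intro divide_left_mono one_le_power) auto
    also have "\<dots> \<le> (1/2) ^ k" by simp
    finally show ?thesis by simp
  qed
qed

text \<open>The substitutions \<open>s = x / (1 + x)\<close> and \<open>t = 1 - s\<close>, which halve the unit interval;
  the shift by \<open>ln 2\<close> makes all boundary terms at \<open>s = 1/2\<close> vanish except \<open>Li4 (1/2)\<close>.\<close>

lemma
  shows has_integral_landen_cube: "((\<lambda>x. ln (1 + x) ^ 3 / (x * (1 + x)) - (ln x - ln (1 + x)) ^ 3 / (1 + x)) has_integral 6 * zeta_nat 4) {0<..<1::real}" (is ?A)
    and has_integral_landen_square: "((\<lambda>x. ln (1 + x) ^ 2 / (x * (1 + x)) + (ln x - ln (1 + x)) ^ 2 / (1 + x)) has_integral 2 * zeta_nat 3) {0<..<1::real}" (is ?B)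
    and has_integral_landen_Li4: "((\<lambda>x. - ((ln 2 + (ln x - ln (1 + x))) ^ 3) / (1 + x)) has_integral 6 * Li4 (1/2)) {0<..<1::real}" (is ?C)
proof -
  define s t ds dt :: "real \<Rightarrow> real" where "s x = x / (1 + x)" and "t x = 1 / (1 + x)"
    and "ds x = 1 / (1 + x)\<^sup>2" and "dt x = - (1 / (1 + x)\<^sup>2)" for x
  have deriv: "(s has_real_derivative ds x) (at x)" "(t has_real_derivative dt x) (at x)" if "0 < x" for x
    unfolding s_def t_def ds_def dt_def using that
    by (auto intro!: derivative_eq_intros simp: divide_simps power2_eq_square)
  have range: "0 < s x" "s x < 1 / 2" "0 < t x" "t x < 1" "0 < ds x" "dt x < 0" if "0 < x" "x < 1" for x
    using that by (auto simp: s_def t_def ds_def dt_def divide_simps)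
  have lims: "(s \<longlongrightarrow> 0) (at_right 0)" "(s \<longlongrightarrow> 1/2) (at_left 1)" "(t \<longlongrightarrow> 1) (at_right 0)" "(t \<longlongrightarrow> 1/2) (at_left 1)"
    unfolding s_def t_def by real_asymp+
  have lns: "ln (s x) = ln x - ln (1 + x)" "ln (t x) = - ln (1 + x)" if "0 < x" for x
    unfolding s_def t_def using that by (simp_all add: ln_div)
  \<comment> \<open>In the variable \<open>x\<close>, \<open>ds / (1 - s) = dx / (1 + x)\<close> and
    \<open>dt / (1 - t) = - dx / (x * (1 + x))\<close>; both are expanded geometrically.\<close>
  have geo: "(\<lambda>k. ds x * (s x ^ k * c)) sums (c / (1 + x))" "(\<lambda>k. dt x * (t x ^ k * c)) sums (- c / (x * (1 + x)))"
    if x: "0 < x" "x < 1" for x c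
  proof -
    have "norm (s x) < 1" "norm (t x) < 1"
      using range[OF x] by auto
    from sums_mult[OF geometric_sums[OF this(1)], of "ds x * c"] sums_mult[OF geometric_sums[OF this(2)], of "dt x * c"]
    have "(\<lambda>k. ds x * c * s x ^ k) sums (ds x * c * (1 / (1 - s x)))" "(\<lambda>k. dt x * c * t x ^ k) sums (dt x * c * (1 / (1 - t x)))"
      by this+
    moreover have "1 / (1 - s x) = 1 + x" "1 / (1 - t x) = (1 + x) / x"
      using x by (simp_all add: s_def t_def field_simps)
    then have "ds x * c * (1 / (1 - s x)) = c / (1 + x)" "dt x * c * (1 / (1 - t x)) = - c / (x * (1 + x))"
      using x by (simp_all add: ds_def dt_def power2_eq_square)
    ultimately show "(\<lambda>k. ds x * (s x ^ k * c)) sums (c / (1 + x))" "(\<lambda>k. dt x * (t x ^ k * c)) sums (- c / (x * (1 + x)))"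
      by (simp_all add: mult_ac)
  qed
  have zeta_Suc: "(\<lambda>m. C / (real m + 1) ^ k) sums (C * zeta_nat k)" if "2 \<le> k" for k C
    using sums_mult[OF zeta_nat_Suc_sums[OF that], of C] by (simp add: add.commute)
  note s2 = has_integral_power_ln_2[where y = s and y' = ds and \<alpha> = 0 and \<beta> = 1, OF _ deriv(1) range(1) lims(1,2)]
  note t2 = has_integral_power_ln_2[where y = t and y' = dt and \<alpha> = 0 and \<beta> = 1, OF _ deriv(2) range(3) lims(3,4)]
  note s3 = has_integral_power_ln_3[where y = s and y' = ds and \<alpha> = 0 and \<beta> = 1, OF _ deriv(1) range(1) lims(1,2)]
  note t3 = has_integral_power_ln_3[where y = t and y' = dt and \<alpha> = 0 and \<beta> = 1, OF _ deriv(2) range(3) lims(3,4)]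
  let ?f = "\<lambda>k x. dt x * (t x ^ k * (0 + ln (t x)) ^ 3) - ds x * (s x ^ k * (0 + ln (s x)) ^ 3)"
  \<comment> \<open>\<open>s\<close> sweeps \<open>(0, 1/2)\<close> and \<open>t\<close> runs
    backwards from 1 to \<open>1/2\<close>. The primitives at \<open>1/2\<close> cancel in the
    difference, and only the endpoint \<open>t = 1\<close> contributes.\<close>
  show ?A
  proof (rule has_integral_sums_nonneg)
    show "((\<lambda>x. ?f k x) has_integral 6 / (real k + 1) ^ 4) {0<..<1}" for k
      using has_integral_diff[OF t3[of k 0] s3[of k 0]] by simp
    show "0 \<le> ?f k x" if "x \<in> {0<..<1}" for k x
    proof -
      have x: "0 < x" "x < 1" using that by auto
      note r = range[OF x]
      have "ln (t x) ^ 3 \<le> 0" "ln (s x) ^ 3 \<le> 0" using r by (auto simp: power_le_zero_eq)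
      then have "0 \<le> dt x * (t x ^ k * ln (t x) ^ 3)" "ds x * (s x ^ k * ln (s x) ^ 3) \<le> 0"
        using r by (auto intro!: mult_nonpos_nonpos mult_nonneg_nonpos)
      then show ?thesis by simp
    qed
    show "(\<lambda>k. ?f k x) sums
        (ln (1 + x) ^ 3 / (x * (1 + x)) - (ln x - ln (1 + x)) ^ 3 / (1 + x))" if "x \<in> {0<..<1}" for x
      using sums_diff[OF geo(2)[of x "ln (t x) ^ 3"] geo(1)[of x "ln (s x) ^ 3"]] that by (simp add: lns)
    show "(\<lambda>k. 6 / (real k + 1) ^ 4) sums (6 * zeta_nat 4)" by (rule zeta_Suc) simp
  qed
  let ?g = "\<lambda>k x. ds x * (s x ^ k * (0 + ln (s x)) ^ 2) - dt x * (t x ^ k * (0 + ln (t x)) ^ 2)"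
  show ?B
  proof (rule has_integral_sums_nonneg)
    show "((\<lambda>x. ?g k x) has_integral 2 / (real k + 1) ^ 3) {0<..<1}" for k
      using has_integral_diff[OF s2[of k 0] t2[of k 0]] by simp
    show "0 \<le> ?g k x" if "x \<in> {0<..<1}" for k x
    proof -
      have x: "0 < x" "x < 1" using that by auto
      note r = range[OF x]
      have "0 \<le> ds x * (s x ^ k * ln (s x) ^ 2)" "dt x * (t x ^ k * ln (t x) ^ 2) \<le> 0"
        using r by (auto intro!: mult_nonpos_nonneg mult_nonneg_nonneg)
      then show ?thesis by simp
    qed
    show "(\<lambda>k. ?g k x) sums
        (ln (1 + x) ^ 2 / (x * (1 + x)) + (ln x - ln (1 + x)) ^ 2 / (1 + x))" if "x \<in> {0<..<1}" for x
      using sums_diff[OF geo(1)[of x "ln (s x) ^ 2"] geo(2)[of x "ln (t x) ^ 2"]] that by (simp add: lns add.commute)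
    show "(\<lambda>k. 2 / (real k + 1) ^ 3) sums (2 * zeta_nat 3)" by (rule zeta_Suc) simp
  qed
  let ?h = "\<lambda>k x. ds x * (s x ^ k * (ln 2 + ln (s x)) ^ 3)"
  show ?C
  proof (rule has_integral_sums_nonneg)
    have "ln 2 + ln (1/2) = (0::real)" by (simp add: ln_div)
    then show "((\<lambda>x. - (?h k x)) has_integral 6 * ((1/2) ^ Suc k / real (Suc k) ^ 4)) {0<..<1}" for k
      using has_integral_neg[OF s3[of k "ln 2"]] by (simp add: add.commute)
    show "0 \<le> - (?h k x)" if "x \<in> {0<..<1}" for k x
    proof -
      have x: "0 < x" "x < 1" using that by auto
      note r = range[OF x]
      have "ln (s x) \<le> ln (1 / 2)" using r by (intro ln_mono) auto
      then have "(ln 2 + ln (s x)) ^ 3 \<le> 0" by (auto simp: power_le_zero_eq ln_div)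
      then have "?h k x \<le> 0"
        using r by (auto intro!: mult_nonneg_nonpos)
      then show ?thesis by simp
    qed
    show "(\<lambda>k. - (?h k x)) sums (- ((ln 2 + (ln x - ln (1 + x))) ^ 3) / (1 + x))" if "x \<in> {0<..<1}" for x
      using sums_minus[OF geo(1)[of x "(ln 2 + ln (s x)) ^ 3"]] that by (simp add: lns)
    show "(\<lambda>k. 6 * ((1/2) ^ Suc k / real (Suc k) ^ 4)) sums (6 * Li4 (1/2))"
      by (intro sums_mult Li4_half_sums)
  qed
qed

text \<open>Expanding the cube in the Landen integral for \<open>Li4 (1/2)\<close> leaves the
  integrals of \<open>(u - v) ^ j / (1 + x)\<close>, up to order 3. Total derivatives of
  \<open>v ^ n\<close>, \<open>u * v\<^sup>2\<close>, \<open>u * v ^ 3\<close> and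
  \<open>u\<^sup>2 * v\<^sup>2\<close> together with the other Landen integrals reduce them to zeta
  values, powers of \<open>ln 2\<close> and the integral of \<open>u * v\<^sup>2 / x\<close>, which
  is \<open>- 2 * ahsum\<close>; the resulting linear equation is solved for
  \<open>ahsum\<close>.\<close>

lemma ahsum_eq:
  "ahsum = 2 * Li4 (1/2) + 7 / 4 * ln 2 * zeta_nat 3 - (ln 2)\<^sup>2 * zeta_nat 2 / 2 + (ln 2) ^ 4 / 12 - 15 / 8 * zeta_nat 4"
proof -
  define l :: real where "l = ln 2"
  define S :: "real set" where "S = {0<..<1}"
  define u v :: "real \<Rightarrow> real" where "u x = ln x" and "v x = ln (1 + x)" for x
  have dv: "(v has_real_derivative 1 / (1 + x)) (at x)" if "0 < x" for x
    unfolding v_def using that by (auto intro!: derivative_eq_intros)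
  have du: "(u has_real_derivative 1 / x) (at x)" if "0 < x" for x
    unfolding u_def using that by (auto intro!: derivative_eq_intros)
  have v0: "(v \<longlongrightarrow> 0) (at_right 0)" and v1: "(v \<longlongrightarrow> l) (at_left 1)" and u1: "(u \<longlongrightarrow> 0) (at_left 1)"
    unfolding v_def u_def l_def by real_asymp+
  have pv: "((\<lambda>x. real n * v x ^ (n - 1) / (1 + x)) has_integral l ^ n) S" if "n > 0" for n
  proof -
    have "((\<lambda>x. real n * v x ^ (n - 1) / (1 + x)) has_integral l ^ n - 0 ^ n) S"
      unfolding S_def
    proof (rule has_integral_FTC_limits)
      show "((\<lambda>x. v x ^ n) has_real_derivative real n * v x ^ (n - 1) / (1 + x)) (at x)" if "0 < x" for x
        using DERIV_power[OF dv[OF that], of n] by (simp add: mult_ac)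
      show "((\<lambda>x. v x ^ n) \<longlongrightarrow> 0 ^ n) (at_right 0)" "((\<lambda>x. v x ^ n) \<longlongrightarrow> l ^ n) (at_left 1)"
        by (intro tendsto_power v0 v1)+
    qed simp
    then show ?thesis using that by (simp add: zero_power)
  qed
  have uv2: "((\<lambda>x. v x ^ 2 / x + 2 * u x * v x / (1 + x)) has_integral 0 * l ^ 2 - 0) S"
    unfolding S_def
  proof (rule has_integral_FTC_limits)
    show "((\<lambda>x. u x * v x ^ 2) \<longlongrightarrow> 0 * l ^ 2) (at_left 1)" by (intro tendsto_intros v1 u1)
    show "((\<lambda>x. u x * v x ^ 2) \<longlongrightarrow> 0) (at_right 0)" unfolding u_def v_def by real_asymp
    show "((\<lambda>x. u x * v x ^ 2) has_real_derivative v x ^ 2 / x + 2 * u x * v x / (1 + x)) (at x)" if "0 < x" for x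
      using DERIV_mult[OF du[OF that] DERIV_power[OF dv[OF that], of 2]] by (simp add: mult_ac)
  qed simp
  have uv3: "((\<lambda>x. v x ^ 3 / x + 3 * u x * v x ^ 2 / (1 + x)) has_integral 0 * l ^ 3 - 0) S"
    unfolding S_def
  proof (rule has_integral_FTC_limits)
    show "((\<lambda>x. u x * v x ^ 3) \<longlongrightarrow> 0 * l ^ 3) (at_left 1)" by (intro tendsto_intros v1 u1)
    show "((\<lambda>x. u x * v x ^ 3) \<longlongrightarrow> 0) (at_right 0)" unfolding u_def v_def by real_asymp
    show "((\<lambda>x. u x * v x ^ 3) has_real_derivative v x ^ 3 / x + 3 * u x * v x ^ 2 / (1 + x)) (at x)" if "0 < x" for x
      using DERIV_mult[OF du[OF that] DERIV_power[OF dv[OF that], of 3]] by (simp add: mult_ac)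
  qed simp
  have u2v2: "((\<lambda>x. 2 * u x * v x ^ 2 / x + 2 * u x ^ 2 * v x / (1 + x)) has_integral 0 ^ 2 * l ^ 2 - 0) S"
    unfolding S_def
  proof (rule has_integral_FTC_limits)
    show "((\<lambda>x. u x ^ 2 * v x ^ 2) \<longlongrightarrow> 0 ^ 2 * l ^ 2) (at_left 1)" by (intro tendsto_intros v1 u1)
    show "((\<lambda>x. u x ^ 2 * v x ^ 2) \<longlongrightarrow> 0) (at_right 0)" unfolding u_def v_def by real_asymp
    show "((\<lambda>x. u x ^ 2 * v x ^ 2) has_real_derivative 2 * u x * v x ^ 2 / x + 2 * u x ^ 2 * v x / (1 + x)) (at x)" if "0 < x" for x
      using DERIV_mult[OF DERIV_power[OF du[OF that], of 2] DERIV_power[OF dv[OF that], of 2]] by (simp add: mult_ac)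
  qed simp
  note U1 = has_integral_ln_over_one_plus[folded u_def S_def]
  note U2 = has_integral_ln_square_over_one_plus[folded u_def S_def]
  note U3 = has_integral_ln_cube_over_one_plus[folded u_def S_def]
  note V = has_integral_ahsum[folded u_def v_def S_def]
  note L3 = has_integral_landen_cube[folded u_def v_def S_def]
  note L2 = has_integral_landen_square[folded u_def v_def S_def]
  note LL = has_integral_landen_Li4[folded u_def v_def S_def l_def]
  \<comment> \<open>In the expanded cube, \<open>u2v2\<close> trades
    \<open>u\<^sup>2 * v / (1 + x)\<close> for \<open>u * v\<^sup>2 / x\<close>, and
    \<open>uv3\<close> trades \<open>u * v\<^sup>2 / (1 + x)\<close> for \<open>v ^ 3 / x\<close>.
    The latter is known only through \<open>L3\<close>, which brings the cube back with the opposite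
    sign; solving for the cube gives the factor 1/2.\<close>
  define E3 where "E3 = (- (21 / 4 * zeta_nat 4) + 3 * (- 2 * ahsum) - l ^ 4 / 2 - 6 * zeta_nat 4) / 2"
  have E3: "((\<lambda>x. (u x - v x) ^ 3 / (1 + x)) has_integral E3) S"
  proof -
    let ?f = "\<lambda>x. (u x ^ 3 / (1 + x) + 3 * (u x * v x ^ 2 / x)
         - 3 / 2 * (2 * u x * v x ^ 2 / x + 2 * u x ^ 2 * v x / (1 + x))
         + (v x ^ 3 / x + 3 * u x * v x ^ 2 / (1 + x)) - 1 / 2 * (real 4 * v x ^ (4 - 1) / (1 + x))
         - (v x ^ 3 / (x * (1 + x)) - (u x - v x) ^ 3 / (1 + x))) / 2"
    have "((\<lambda>x. ?f x)
      has_integral (- (21 / 4 * zeta_nat 4) + 3 * (- 2 * ahsum) - 3 / 2 * (0 ^ 2 * l ^ 2 - 0) + (0 * l ^ 3 - 0) - 1 / 2 * l ^ 4 - 6 * zeta_nat 4) / 2) S"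
      by (intro has_integral_divide has_integral_diff has_integral_add has_integral_mult_right U3 V u2v2 uv3 pv L3) simp
    then have "((\<lambda>x. (u x - v x) ^ 3 / (1 + x)) has_integral
        (- (21 / 4 * zeta_nat 4) + 3 * (- 2 * ahsum) - 3 / 2 * (0 ^ 2 * l ^ 2 - 0) + (0 * l ^ 3 - 0) - 1 / 2 * l ^ 4 - 6 * zeta_nat 4) / 2) S"
    proof (rule has_integral_eq[rotated])
      fix x assume "x \<in> S"
      then have x: "x > 0" by (simp add: S_def)
      define i j where "i = 1 / x" and "j = 1 / (1 + x)"
      have ij: "a / x = a * i" "a / (1 + x) = a * j" "a / (x * (1 + x)) = a * (i - j)" for a
        using x by (simp_all add: i_def j_def field_simps)
      show "?f x = (u x - v x) ^ 3 / (1 + x)"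
        unfolding ij by (simp add: field_simps power2_eq_square power3_eq_cube)
    qed
    then show ?thesis by (simp add: E3_def)
  qed
  \<comment> \<open>The same pattern one degree lower: \<open>uv2\<close> produces
    \<open>v\<^sup>2 / x\<close>, and \<open>L2\<close> returns the square itself.\<close>
  define E2 where "E2 = (3 / 2 * zeta_nat 3 + 2 / 3 * l ^ 3 + 2 * zeta_nat 3) / 2"
  have E2: "((\<lambda>x. (u x - v x) ^ 2 / (1 + x)) has_integral E2) S"
  proof -
    let ?f = "\<lambda>x. (u x ^ 2 / (1 + x) - (v x ^ 2 / x + 2 * u x * v x / (1 + x)) + 2 / 3 * (real 3 * v x ^ (3 - 1) / (1 + x))
         + (v x ^ 2 / (x * (1 + x)) + (u x - v x) ^ 2 / (1 + x))) / 2"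
    have "((\<lambda>x. ?f x)
      has_integral (3 / 2 * zeta_nat 3 - (0 * l ^ 2 - 0) + 2 / 3 * l ^ 3 + 2 * zeta_nat 3) / 2) S"
      by (intro has_integral_divide has_integral_diff has_integral_add has_integral_mult_right U2 uv2 pv L2) simp
    then have "((\<lambda>x. (u x - v x) ^ 2 / (1 + x)) has_integral (3 / 2 * zeta_nat 3 - (0 * l ^ 2 - 0) + 2 / 3 * l ^ 3 + 2 * zeta_nat 3) / 2) S"
    proof (rule has_integral_eq[rotated])
      fix x assume "x \<in> S"
      then have x: "x > 0" by (simp add: S_def)
      define i j where "i = 1 / x" and "j = 1 / (1 + x)"
      have ij: "a / x = a * i" "a / (1 + x) = a * j" "a / (x * (1 + x)) = a * (i - j)" for a
        using x by (simp_all add: i_def j_def field_simps)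
      show "?f x = (u x - v x) ^ 2 / (1 + x)"
        unfolding ij by (simp add: field_simps power2_eq_square)
    qed
    then show ?thesis by (simp add: E2_def)
  qed
  have E1: "((\<lambda>x. u x / (1 + x) - 1 / 2 * (real 2 * v x ^ (2 - 1) / (1 + x))) has_integral - (zeta_nat 2 / 2) - 1 / 2 * l ^ 2) S"
    by (intro has_integral_diff has_integral_mult_right U1 pv) simp
  let ?f = "\<lambda>x. - ((u x - v x) ^ 3 / (1 + x) + 3 * l * ((u x - v x) ^ 2 / (1 + x))
        + 3 * l ^ 2 * (u x / (1 + x) - 1 / 2 * (real 2 * v x ^ (2 - 1) / (1 + x))) + l ^ 3 * (real 1 * v x ^ (1 - 1) / (1 + x)))"
  have "((\<lambda>x. ?f x)
     has_integral - (E3 + 3 * l * E2 + 3 * l ^ 2 * (- (zeta_nat 2 / 2) - 1 / 2 * l ^ 2) + l ^ 3 * l ^ 1)) S"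
    by (intro has_integral_neg has_integral_add has_integral_mult_right E3 E2 E1 pv) simp
  then have "((\<lambda>x. - ((l + (u x - v x)) ^ 3) / (1 + x)) has_integral
      - (E3 + 3 * l * E2 + 3 * l ^ 2 * (- (zeta_nat 2 / 2) - 1 / 2 * l ^ 2) + l ^ 3 * l ^ 1)) S"
  proof (rule has_integral_eq[rotated])
    fix x assume "x \<in> S"
    define j where "j = 1 / (1 + x)"
    have j: "a / (1 + x) = a * j" for a by (simp add: j_def)
    show "?f x
      = - ((l + (u x - v x)) ^ 3) / (1 + x)"
      unfolding j by (simp add: algebra_simps power2_eq_square power3_eq_cube)
  qed
  with LL have "6 * Li4 (1/2) = - (E3 + 3 * l * E2 + 3 * l ^ 2 * (- (zeta_nat 2 / 2) - 1 / 2 * l ^ 2) + l ^ 3 * l ^ 1)"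
    by (rule has_integral_unique)
  then show ?thesis
    unfolding E3_def E2_def l_def[symmetric] by (simp add: field_simps eval_nat_numeral)
qed

section \<open>Assembly of the two sums\<close>

lemma cb_gen_harm_double_sums:
  "(\<lambda>k. cb (Suc k) * gen_harm 2 (2 * Suc k)) sums
     (- 8 * catalan ^ 2 + 11 * zeta_nat 4 + 2 * Li4 (1/2) + (ln 2)^2 * zeta_nat 2 + (ln 2)^4 / 12)"
proof -
  define A where "A = 8 * ((pi ^ 4 / 48 + (ln 2)\<^sup>2 * (pi\<^sup>2 / 2) + 2 * ahsum - 2 * hsum - 7 / 2 * ln 2 * zeta_nat 3) / 4)"
  have A: "(\<lambda>k. cb (Suc k) / (real (Suc k))\<^sup>2) sums A"
    unfolding A_def by (rule cb_div_square_sums[OF has_integral_ln_sin_square])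
  have "(\<lambda>k. cb (Suc k) * odd_harm 2 (Suc k) + (cb (Suc k) * gen_harm 2 k + cb (Suc k) / (real (Suc k))\<^sup>2) / 4)
      sums ((pi ^ 4 / 16 + 2 * (pi ^ 4 / 32 - 4 * catalan\<^sup>2)) + (pi ^ 4 / 24 + A) / 4)"
    by (intro sums_add sums_divide cb_odd_harm_sums has_integral_catalan cb_gen_harm_sums A)
  moreover have "cb (Suc k) * odd_harm 2 (Suc k) + (cb (Suc k) * gen_harm 2 k + cb (Suc k) / (real (Suc k))\<^sup>2) / 4
      = cb (Suc k) * gen_harm 2 (2 * Suc k)" for k
  proof -
    have "gen_harm 2 (2 * Suc k) = odd_harm 2 (Suc k) + (gen_harm 2 k + 1 / (real (Suc k))\<^sup>2) / 4"
      unfolding gen_harm_double[of 2 "Suc k"] gen_harm_Suc[of 2 k] by (simp add: add.commute)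
    then show ?thesis by (simp add: distrib_left add_divide_distrib del: of_nat_Suc mult_Suc_right)
  qed
  moreover have "(pi ^ 4 / 16 + 2 * (pi ^ 4 / 32 - 4 * catalan\<^sup>2)) + (pi ^ 4 / 24 + A) / 4
      = - 8 * catalan ^ 2 + 11 * zeta_nat 4 + 2 * Li4 (1/2) + (ln 2)^2 * zeta_nat 2 + (ln 2)^4 / 12"
  proof -
    \<comment> \<open>Written in zeta values the identity is linear arithmetic. \<open>A / 4\<close>
      contains \<open>ahsum\<close> with coefficient 1, and its
      \<open>7 / 4 * ln 2 * zeta(3)\<close> cancels the \<open>zeta(3)\<close> term of the Fourier
      evaluation.\<close>
    have "pi ^ 4 = 90 * zeta_nat 4" "pi\<^sup>2 = 6 * zeta_nat 2" by (simp_all add: zeta_4 zeta_2)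
    then show ?thesis
      unfolding A_def ahsum_eq hsum_eq by (simp add: field_simps)
  qed
  ultimately show ?thesis by (simp only:)
qed

lemma cb_harm_double_sums:
  "(\<lambda>k. cb (Suc k) * ((harm (2 * Suc k))\<^sup>2 + gen_harm 2 (2 * Suc k))) sums
     (125 / 2 * zeta_nat 4 - 20 * Li4 (1/2) + 8 * (ln 2)^2 * zeta_nat 2 - 10 / 12 * (ln 2)^4)"
proof -
  have "pi ^ 4 = 90 * zeta_nat 4" "pi\<^sup>2 = 6 * zeta_nat 2" by (simp_all add: zeta_4 zeta_2)
  \<comment> \<open>By the relations among the Euler sums, \<open>(aosum + ahsum / 2) / 4\<close>
    contains \<open>5 / 8 * ahsum\<close>, and \<open>5 / 8 * 7 / 4 = 35 / 32\<close> is exactly the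
    coefficient of \<open>ln 2 * zeta(3)\<close> to be cancelled.\<close>
  then have "4 * (4 * (17 * pi ^ 4 / 768 + (ln 2)\<^sup>2 * (pi\<^sup>2 / 32) + 2 * hsum - (aosum + ahsum / 2) / 4 + 35 / 32 * ln 2 * zeta_nat 3))
     = 125 / 2 * zeta_nat 4 - 20 * Li4 (1/2) + 8 * (ln 2)^2 * zeta_nat 2 - 10 / 12 * (ln 2)^4"
    unfolding aosum_eq osum_eq ahsum_eq hsum_eq by (simp add: field_simps)
  then show ?thesis
    using cb_harm_sums[OF has_integral_ln_one_minus_sin_square] by (simp only:)
qed

theorem theorem1:
  shows "(\<lambda>k. 4 ^ (Suc k) * gen_harm 2 (2 * Suc k) / ((real (Suc k))^2 * real ((2 * Suc k) choose (Suc k))))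
           sums (- 8 * catalan ^ 2 + 11 * zeta_nat 4 + 2 * Li4 (1/2) + (ln 2)^2 * zeta_nat 2 + (ln 2)^4 / 12) \<and>
         (\<lambda>k. 4 ^ (Suc k) * (harm (2 * Suc k) :: real)^2 / ((real (Suc k))^2 * real ((2 * Suc k) choose (Suc k))))
           sums (8 * catalan ^ 2 + 103 / 2 * zeta_nat 4 - 22 * Li4 (1/2) + 7 * (ln 2)^2 * zeta_nat 2 - 11 / 12 * (ln 2)^4)"
proof
  have cb: "4 ^ Suc k * h / ((real (Suc k))^2 * real ((2 * Suc k) choose (Suc k))) = cb (Suc k) * h" for k h
    unfolding cb_def by (simp only: times_divide_eq_left)
  show "(\<lambda>k. 4 ^ (Suc k) * gen_harm 2 (2 * Suc k) / ((real (Suc k))^2 * real ((2 * Suc k) choose (Suc k))))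
           sums (- 8 * catalan ^ 2 + 11 * zeta_nat 4 + 2 * Li4 (1/2) + (ln 2)^2 * zeta_nat 2 + (ln 2)^4 / 12)"
    unfolding cb by (rule cb_gen_harm_double_sums)
  have "(\<lambda>k. cb (Suc k) * ((harm (2 * Suc k))\<^sup>2 + gen_harm 2 (2 * Suc k)) - cb (Suc k) * gen_harm 2 (2 * Suc k)) sums
     ((125 / 2 * zeta_nat 4 - 20 * Li4 (1/2) + 8 * (ln 2)^2 * zeta_nat 2 - 10 / 12 * (ln 2)^4)
      - (- 8 * catalan ^ 2 + 11 * zeta_nat 4 + 2 * Li4 (1/2) + (ln 2)^2 * zeta_nat 2 + (ln 2)^4 / 12))"
    by (rule sums_diff[OF cb_harm_double_sums cb_gen_harm_double_sums])
  moreover have "(125 / 2 * zeta_nat 4 - 20 * Li4 (1/2) + 8 * (ln 2)^2 * zeta_nat 2 - 10 / 12 * (ln 2)^4)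
      - (- 8 * catalan ^ 2 + 11 * zeta_nat 4 + 2 * Li4 (1/2) + (ln 2)^2 * zeta_nat 2 + (ln 2)^4 / 12)
     = 8 * catalan ^ 2 + 103 / 2 * zeta_nat 4 - 22 * Li4 (1/2) + 7 * (ln 2)^2 * zeta_nat 2 - 11 / 12 * (ln 2)^4"
    by simp
  moreover have "cb (Suc k) * ((harm (2 * Suc k))\<^sup>2 + gen_harm 2 (2 * Suc k)) - cb (Suc k) * gen_harm 2 (2 * Suc k)
     = cb (Suc k) * (harm (2 * Suc k))\<^sup>2" for k
    by (simp only: distrib_left add_diff_cancel_right')
  ultimately show "(\<lambda>k. 4 ^ (Suc k) * (harm (2 * Suc k) :: real)^2 / ((real (Suc k))^2 * real ((2 * Suc k) choose (Suc k))))
           sums (8 * catalan ^ 2 + 103 / 2 * zeta_nat 4 - 22 * Li4 (1/2) + 7 * (ln 2)^2 * zeta_nat 2 - 11 / 12 * (ln 2)^4)"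
    unfolding cb by (simp only:)
qed

end
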